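(* Let $n\ge 2$, let $\Omega\subset\mathbb{R}^n$ be a bounded domain, let $q\in(1,2)$, $p=q/(q-1)$ and $\alpha\in(0,1)$. Let $u\in W^{1,q}_{loc}(\Omega)$ be a local weak solution in $\Omega$ of $$-\mathrm{div}\left((|\nabla u|-1)_+^{q-1}\frac{\nabla u}{|\nabla u|}\right)=f .$$ Then, for the function $H_{\frac q2}(\nabla u)=(|\nabla u|-1)_+^{q/2}\frac{\nabla u}{|\nabla u|}$, the following implications hold: $$f\in W^{1,p}_{loc}(\Omega)\ \Rightarrow\ H_{\frac q2}(\nabla u)\in B^{\frac1{3-q}}_{2,\infty,loc}(\Omega),$$ $$f\in B^{\alpha}_{p,\infty,loc}(\Omega)\ \Rightarrow\ H_{\frac q2}(\nabla u)\in B^{\min\{\frac{\alpha+1}{2},\frac{1}{3-q}\}}_{2,\infty,loc}(\Omega).$$ Furthermore: (a) If $f\in W^{1,p}_{loc}(\Omega)$, then for every ball $B_R\Subset\Omega$ of radius $R$, with $B_{R/2}$ the concentric ball of radius $R/2$, the estimate $$\int_{B_{R/2}}\left|\tau_{s,h}H_{\frac q2}(\nabla u)-H_{\frac q2}(\nabla u)\right|^2dx\le C_1\left(\|\nabla f\|_{L^p(B')}\|\nabla u\|_{L^q(B')}|h|^2+\|\nabla u\|^q_{L^q(B')}|h|^{\frac{2}{3-q}}\right)$$ holds for every $s\in\{1,\dots,n\}$ and every $h\in\mathbb{R}$ with $|h|\le r_0<\frac12\mathrm{dist}(B_R,\partial\Omega)$, where $B'=B_R+B(0,r_0)$ and $C_1=C_1(R,q,n)$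 is a positive constant depending only on $R,q,n$. (b) If $f\in B^{\alpha}_{p,\infty,loc}(\Omega)$, then for every ball $B_R\Subset\Omega$ of radius $R$, with $B_{R/2}$ the concentric ball of radius $R/2$, the estimate $$\int_{B_{R/2}}\left|\tau_{s,h}H_{\frac q2}(\nabla u)-H_{\frac q2}(\nabla u)\right|^2dx\le C_2\left(\|f\|_{B^\alpha_{p,\infty}(B')}\|\nabla u\|_{L^q(B')}|h|^{\alpha+1}+\|\nabla u\|^q_{L^q(B')}|h|^{\frac{2}{3-q}}\right)$$ holds for every $s\in\{1,\dots,n\}$ and every $h\in\mathbb{R}$ with $|h|\le r_0<\frac12\mathrm{dist}(B_R,\partial\Omega)$, where $B'=B_R+B(0,r_0)$ and $C_2=C_2(R,q,n)$ is a positive constant depending only on $R,q,n$.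
   Context: Notation. $(\cdot)_+$ is the positive part. For $a>0$, $H_a(\xi)=(|\xi|-1)_+^{a}\,\xi/|\xi|$ for $\xi\in\mathbb{R}^n$, understood to be $0$ when $|\xi|\le1$ (in particular at $\xi=0$). Local weak solution: $u\in W^{1,q}_{loc}(\Omega)$ satisfies $\int_\Omega\langle H_{q-1}(\nabla u),\nabla\varphi\rangle\,dx=\int_\Omega f\varphi\,dx$ for every $\varphi\in W^{1,q}(\Omega)$ with compact support in $\Omega$. Shift: $\tau_{s,h}F(x)=F(x+he_s)$, where $e_s$ is the unit vector in the $x_s$ direction. Besov spaces: for $0<\beta<1$, $1\le m<\infty$, $v\in B^\beta_{m,\infty}(\mathbb{R}^n)$ means $v\in L^m(\mathbb{R}^n)$ and $[v]_{\dot B^\beta_{m,\infty}(\mathbb{R}^n)}=\sup_{h\in\mathbb{R}^n\setminus\{0\}}\left(\int_{\mathbb{R}^n}\frac{|v(x+h)-v(x)|^m}{|h|^{\beta m}}dx\right)^{1/m}<\infty$. $v\in B^\beta_{m,\infty,loc}(\Omega)$ means $\varphi v\in B^\beta_{m,\infty}(\mathbb{R}^n)$ for every $\varphi\in C_c^\infty(\Omega)$ (componentwise for vector-valued $v$). On a ball $B'$, $\|v\|_{B^\beta_{m,\infty}(B')}=\|v\|_{L^m(B')}+[v]_{\dot B^\beta_{m,\infty}(B')}$, where the seminorm on $B'$ is $\sup_{h\ne0}\left(\int_{\{x\in B':\,x+h\in B'\}}\frac{|v(x+h)-v(x)|^m}{|h|^{\beta m}}dx\right)^{1/m}$. *)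

theory Defs
  imports "HOL-Analysis.Analysis" "HOL-Library.Set_Algebras"
begin

text \<open>
  Functions on a set \<open>\<Omega>\<close> are represented by total functions on the whole space; all notions below only
  depend on the values (almost everywhere) on \<open>\<Omega>\<close>. All integrals are with respect to the (complete)
  Lebesgue measure. The dimension \<open>n\<close> is \<open>CARD('n)\<close>.
\<close>

definition bounded_domain :: "(real^'n) set \<Rightarrow> bool" where
  "bounded_domain \<Omega> \<longleftrightarrow> open \<Omega> \<and> connected \<Omega> \<and> bounded \<Omega> \<and> \<Omega> \<noteq> {}"

text \<open>Since \<open>0 powr a = 0\<close>, the following vanishes for \<open>norm \<xi> \<le> 1\<close>, in particular at \<open>\<xi> = 0\<close>.\<close>

definition H :: "real \<Rightarrow> real^'n \<Rightarrow> real^'n" where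
  "H a \<xi> = (max 0 (norm \<xi> - 1) powr a) *\<^sub>R (\<xi> /\<^sub>R norm \<xi>)"

definition shift :: "'n \<Rightarrow> real \<Rightarrow> (real^'n \<Rightarrow> 'b) \<Rightarrow> real^'n \<Rightarrow> 'b" where
  "shift s h F x = F (x + h *\<^sub>R axis s 1)"

section \<open>Test functions\<close>

definition partial_deriv :: "'n \<Rightarrow> (real^'n \<Rightarrow> real) \<Rightarrow> real^'n \<Rightarrow> real" where
  "partial_deriv i \<phi> x = frechet_derivative \<phi> (at x) (axis i 1)"

primrec Ck :: "nat \<Rightarrow> (real^'n \<Rightarrow> real) \<Rightarrow> bool" where
  "Ck 0 \<phi> \<longleftrightarrow> continuous_on UNIV \<phi>"
| "Ck (Suc k) \<phi> \<longleftrightarrow> (\<forall>x. \<phi> differentiable (at x)) \<and> (\<forall>i. Ck k (partial_deriv i \<phi>))"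

definition test_functions :: "(real^'n) set \<Rightarrow> (real^'n \<Rightarrow> real) set" where
  "test_functions \<Omega> =
     {\<phi>. (\<forall>k. Ck k \<phi>) \<and> compact (closure {x. \<phi> x \<noteq> 0}) \<and> closure {x. \<phi> x \<noteq> 0} \<subseteq> \<Omega>}"

section \<open>Lebesgue and Sobolev spaces\<close>

definition Lp :: "real \<Rightarrow> (real^'n) set \<Rightarrow> (real^'n \<Rightarrow> 'b::euclidean_space) set" where
  "Lp m A = {v. set_borel_measurable lebesgue A v \<and>
                set_integrable lebesgue A (\<lambda>x. norm (v x) powr m)}"

definition Lp_norm :: "real \<Rightarrow> (real^'n) set \<Rightarrow> (real^'n \<Rightarrow> 'b::euclidean_space) \<Rightarrow> real" where
  "Lp_norm m A v = (LINT x:A|lebesgue. norm (v x) powr m) powr (1 / m)"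

definition Lp_loc :: "real \<Rightarrow> (real^'n) set \<Rightarrow> (real^'n \<Rightarrow> 'b::euclidean_space) set" where
  "Lp_loc m \<Omega> = {v. \<forall>K. compact K \<and> K \<subseteq> \<Omega> \<longrightarrow> v \<in> Lp m K}"

text \<open>\<open>Du\<close> is a representative of the weak gradient of \<open>u\<close> in \<open>\<Omega>\<close> (unique up to null sets).\<close>

definition weak_gradient ::
    "(real^'n) set \<Rightarrow> (real^'n \<Rightarrow> real) \<Rightarrow> (real^'n \<Rightarrow> real^'n) \<Rightarrow> bool" where
  "weak_gradient \<Omega> u Du \<longleftrightarrow> u \<in> Lp_loc 1 \<Omega> \<and> Du \<in> Lp_loc 1 \<Omega> \<and>
     (\<forall>\<phi>\<in>test_functions \<Omega>. \<forall>i.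
        (LINT x:\<Omega>|lebesgue. u x * partial_deriv i \<phi> x) = - (LINT x:\<Omega>|lebesgue. Du x $ i * \<phi> x))"

definition W1 :: "real \<Rightarrow> (real^'n) set \<Rightarrow> (real^'n \<Rightarrow> real) set" where
  "W1 m \<Omega> = {u \<in> Lp m \<Omega>. \<exists>Du \<in> Lp m \<Omega>. weak_gradient \<Omega> u Du}"

definition W1_loc :: "real \<Rightarrow> (real^'n) set \<Rightarrow> (real^'n \<Rightarrow> real) set" where
  "W1_loc m \<Omega> = {u \<in> Lp_loc m \<Omega>. \<exists>Du \<in> Lp_loc m \<Omega>. weak_gradient \<Omega> u Du}"

section \<open>Besov spaces\<close>

text \<open>The quotient whose supremum over \<open>h \<noteq> 0\<close> is the seminorm on \<open>A\<close>; \<open>A = UNIV\<close> gives the seminorm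
  on the whole space.\<close>

definition besov_quot ::
    "real \<Rightarrow> real \<Rightarrow> (real^'n) set \<Rightarrow> (real^'n \<Rightarrow> real) \<Rightarrow> real^'n \<Rightarrow> real" where
  "besov_quot \<beta> m A v h =
     (LINT x:{x\<in>A. x + h \<in> A}|lebesgue. \<bar>v (x + h) - v x\<bar> powr m / norm h powr (\<beta> * m)) powr (1 / m)"

text \<open>For \<open>v \<in> Lp m A\<close> every quotient is the value of a convergent integral, so that finiteness of the
  seminorm is boundedness of the quotients. The real-valued supremum is meaningful only in that case.\<close>

definition besov_seminorm :: "real \<Rightarrow> real \<Rightarrow> (real^'n) set \<Rightarrow> (real^'n \<Rightarrow> real) \<Rightarrow> real" where
  "besov_seminorm \<beta> m A v = (SUP h\<in>UNIV - {0}. besov_quot \<beta> m A v h)"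

definition besov_norm :: "real \<Rightarrow> real \<Rightarrow> (real^'n) set \<Rightarrow> (real^'n \<Rightarrow> real) \<Rightarrow> real" where
  "besov_norm \<beta> m A v = Lp_norm m A v + besov_seminorm \<beta> m A v"

definition besov :: "real \<Rightarrow> real \<Rightarrow> (real^'n \<Rightarrow> real) set" where
  "besov \<beta> m = {v \<in> Lp m UNIV. bdd_above (besov_quot \<beta> m UNIV v ` (UNIV - {0}))}"

definition besov_loc :: "real \<Rightarrow> real \<Rightarrow> (real^'n) set \<Rightarrow> (real^'n \<Rightarrow> real) set" where
  "besov_loc \<beta> m \<Omega> = {v. \<forall>\<phi>\<in>test_functions \<Omega>. (\<lambda>x. \<phi> x * v x) \<in> besov \<beta> m}"

definition besov_loc_vec :: "real \<Rightarrow> real \<Rightarrow> (real^'n) set \<Rightarrow> (real^'n \<Rightarrow> real^'n) set" where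
  "besov_loc_vec \<beta> m \<Omega> = {v. \<forall>i. (\<lambda>x. v x $ i) \<in> besov_loc \<beta> m \<Omega>}"

section \<open>Local weak solutions\<close>

definition compact_support_in :: "(real^'n) set \<Rightarrow> (real^'n \<Rightarrow> real) \<Rightarrow> bool" where
  "compact_support_in \<Omega> \<phi> \<longleftrightarrow>
     (\<exists>K. compact K \<and> K \<subseteq> \<Omega> \<and> (AE x in lebesgue. x \<in> \<Omega> - K \<longrightarrow> \<phi> x = 0))"

text \<open>The two integrability conditions say that both sides of the weak formulation exist (library
  integrals of non-integrable functions are \<open>0\<close>). They are automatic if \<open>f\<close> is locally in \<open>Lp\<close> for
  the exponent conjugate to \<open>q\<close>.\<close>

definition weak_solution ::
    "real \<Rightarrow> (real^'n) set \<Rightarrow> (real^'n \<Rightarrow> real) \<Rightarrow> (real^'n \<Rightarrow> real) \<Rightarrow> bool" where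
  "weak_solution q \<Omega> f u \<longleftrightarrow> u \<in> W1_loc q \<Omega> \<and>
     (\<forall>Du \<phi> D\<phi>. weak_gradient \<Omega> u Du \<and> \<phi> \<in> W1 q \<Omega> \<and> weak_gradient \<Omega> \<phi> D\<phi> \<and>
        compact_support_in \<Omega> \<phi> \<longrightarrow>
        set_integrable lebesgue \<Omega> (\<lambda>x. H (q - 1) (Du x) \<bullet> D\<phi> x) \<and>
        set_integrable lebesgue \<Omega> (\<lambda>x. f x * \<phi> x) \<and>
        (LINT x:\<Omega>|lebesgue. H (q - 1) (Du x) \<bullet> D\<phi> x) = (LINT x:\<Omega>|lebesgue. f x * \<phi> x))"

end

theory Submission
  imports Defs
begin

text \<open>The proof is the method of difference quotients. Put \<open>V = H (q/2) (Du)\<close> and write \<open>\<Delta>F(x) = F(x + h) - F(x)\<close>.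
Testing the equation with a backward difference of \<open>\<eta>\<^sup>2 \<Delta>u\<close>, where \<open>\<eta>\<close> is a cutoff function, and moving the
difference to the other factor gives
\<open>\<integral> \<Delta>(H (q-1) (Du)) \<bullet> (\<eta>\<^sup>2 \<Delta>Du + 2 \<eta> \<Delta>u \<nabla>\<eta>) = \<integral> \<Delta>f \<eta>\<^sup>2 \<Delta>u\<close> (\<open>weak_solution_difference_identity\<close>).

Two pointwise facts make this useful. The field \<open>H (q-1)\<close> is monotone, and its monotonicity controls
\<open>(2/p) |\<Delta>V|\<^sup>2\<close> (\<open>H_monotone\<close>). Moreover \<open>H (q-1)\<close> is a function of \<open>H (q/2)\<close> that is Hoelder continuous with
exponent \<open>2/p\<close> (\<open>H_Holder\<close>). Hence the term with \<open>\<nabla>\<eta>\<close> is at most a multiple of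
\<open>(\<eta> |\<Delta>V|) powr (2/p) * |\<Delta>u|\<close>, and Young's inequality with the exponents \<open>p\<close> and \<open>q\<close> absorbs it, up to a
multiple of \<open>|\<Delta>u| powr q\<close>. Since \<open>\<Delta>u\<close> has \<open>L\<^sup>q\<close> norm at most \<open>|h|\<close> times that of \<open>Du\<close> on a slightly larger
ball (\<open>local_difference_bound\<close>), this remainder is of order \<open>|h| powr q\<close>. Hoelder's inequality estimates the
right-hand side by a multiple of \<open>|h|\<close> times the \<open>L\<^sup>p\<close> norm of \<open>\<Delta>f\<close>, which is of order \<open>|h|\<close> if \<open>f\<close> is a Sobolev function and of order
\<open>|h| powr \<alpha>\<close> if \<open>f\<close> is a Besov function. This is \<open>energy_estimate\<close>. Finally
\<open>q * (3 - q) - 2 = (q - 1) * (2 - q)\<close> is positive, so that \<open>|h| powr q \<le> |h| powr (2 / (3 - q))\<close> for \<open>|h| \<le> 1\<close>.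
Shifts that are not small compared with \<open>1\<close> and \<open>R\<close> are harmless, because \<open>|V|\<^sup>2 \<le> |Du| powr q\<close>
(\<open>large_shift_bound\<close>). All cutoff functions are translates of one radial function, so that the constants depend on
\<open>R\<close>, \<open>q\<close> and the dimension only (\<open>local_estimate\<close>). The estimates hold for shifts in all directions, and a finite
covering of the support of a test function turns them into Besov regularity (\<open>besov_loc_vec_if_local_differences\<close>).

The facts on weak gradients rest on two steps. The fundamental lemma of the calculus of variations
(\<open>AE_zero_if_orthogonal_to_test_functions\<close>) makes weak gradients unique almost everywhere. It also yields
\<open>U(x + h) - U(x) = \<integral>\<^sub>0\<^sup>1 DU(x + t h) \<bullet> h dt\<close> for almost every \<open>x\<close> (\<open>weak_directional_ftc\<close>), from which the bound for
difference quotients follows by Jensen's inequality. A function on a domain is first multiplied by a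
cutoff function, so that translations act on functions on the whole space.\<close>

section \<open>The vector fields: coercivity and Hoelder continuity\<close>

lemma norm_H: "0 < a \<Longrightarrow> norm (H a \<xi>) = max 0 (norm \<xi> - 1) powr a"
  by (cases "\<xi> = 0") (simp_all add: H_def)

lemma H_eq_0: "norm \<xi> \<le> 1 \<Longrightarrow> H a \<xi> = 0"
  by (simp add: H_def)

lemma H_0 [simp]: "H a 0 = 0"
  by (simp add: H_def)

lemma H_borel [measurable]: "H a \<in> borel_measurable borel"
  unfolding H_def by measurable

text \<open>The inequality between weighted arithmetic and geometric means of \<open>s powr r\<close> and \<open>1\<close>, with weights \<open>1/r\<close> and \<open>1 - 1/r\<close>.\<close>

lemma Bernoulli_powr:
  fixes s r :: real
  assumes "0 \<le> s" "1 \<le> r"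
  shows "1 - s powr r \<le> r * (1 - s)"
proof (cases "s = 0")
  case False
  have "(s powr r) powr (1/r) * 1 powr (1 - 1/r) \<le> (1/r) * s powr r + (1 - 1/r) * 1"
    using assms False by (intro Youngs_inequality_0) auto
  then have "s \<le> (1/r) * s powr r + (1 - 1/r)" using assms by (simp add: powr_powr)
  then have "r * s \<le> r * ((1/r) * s powr r + (1 - 1/r))" using assms by (intro mult_left_mono) auto
  also have "\<dots> = s powr r + r - 1" using assms by (simp add: field_simps)
  finally show ?thesis by (simp add: algebra_simps)
qed (use assms in simp)

text \<open>By homogeneity only the quotient \<open>t = a/b \<le> 1\<close> matters. One factor \<open>1 - t powr (q/2)\<close> is at most \<open>1 - t\<close>, because \<open>q/2 \<le> 1\<close>; the other one is compared with \<open>1 - t powr (q-1)\<close> by Bernoulli's inequality, which produces the constant.\<close>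

lemma powr_monotonicity_scalar:
  fixes a b q :: real
  assumes q: "1 < q" "q < 2" and ab: "0 < a" "0 < b"
  shows "2 * (q - 1) / q * (a powr (q/2) - b powr (q/2))\<^sup>2 \<le> (a powr (q - 1) - b powr (q - 1)) * (a - b)"
  using ab
proof (induction a b rule: linorder_wlog)
  case (le a b)
  define t where "t = a / b"
  have t: "0 < t" "t \<le> 1" and a: "a = b * t" using le by (auto simp: t_def)
  have 1: "t powr (q/2) \<ge> t" using powr_mono'[of "q/2" 1 t] t q by simp
  have 3: "t powr (q/2) \<le> 1" "t powr (q - 1) \<le> 1" using t q by (auto intro: powr_le1)
  have "1 - (t powr (q - 1)) powr (q / (2 * (q - 1))) \<le> q / (2 * (q - 1)) * (1 - t powr (q - 1))"
    using q by (intro Bernoulli_powr) (auto simp: field_simps)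
  moreover have "(q - 1) * (q / (2 * (q - 1))) = q / 2" using q by (simp add: field_simps)
  ultimately have "1 - t powr (q/2) \<le> q / (2 * (q - 1)) * (1 - t powr (q - 1))"
    by (simp only: powr_powr)
  then have 2: "2 * (q - 1) / q * (1 - t powr (q/2)) \<le> 1 - t powr (q - 1)"
    using q by (simp add: field_simps)
  have "2 * (q - 1) / q * (1 - t powr (q/2)) * (1 - t powr (q/2)) \<le> (1 - t powr (q - 1)) * (1 - t)"
    using 1 2 3 t by (intro mult_mono) auto
  then have "b powr q * (2 * (q - 1) / q * (1 - t powr (q/2)) * (1 - t powr (q/2))) \<le> b powr q * ((1 - t powr (q - 1)) * (1 - t))"
    by (intro mult_left_mono) auto
  moreover have "b powr q = b powr (q/2) * b powr (q/2)" "b powr q = b powr (q - 1) * b"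
    using le powr_add[of b "q/2" "q/2"] powr_add[of b "q - 1" 1] by auto
  moreover have "k * (B * T - B)\<^sup>2 = (B * B) * (k * (1 - T) * (1 - T))" for k B T :: real
    by (simp add: power2_eq_square algebra_simps)
  moreover have "(S * T - S) * (b * t - b) = (S * b) * ((1 - T) * (1 - t))" for S T :: real
    by (simp add: algebra_simps)
  moreover have "(b * t) powr c = b powr c * t powr c" for c using t le by (simp add: powr_mult)
  ultimately show ?case unfolding a by metis
next
  case (sym a b)
  then show ?case by (simp add: power2_commute algebra_simps)
qed

text \<open>After expansion only the mixed terms differ, and these are compared by the inequality between arithmetic and geometric means.\<close>

lemma powr_antimonotone_scalar:
  fixes a b q :: real
  assumes q: "1 < q" "q < 2" and ab: "0 < a" "0 < b"
  shows "(a powr (q/2) + b powr (q/2))\<^sup>2 \<le> (a powr (q - 1) + b powr (q - 1)) * (a + b)"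
proof -
  have e: "c powr q = c powr (q/2) * c powr (q/2)" "c powr q = c powr (q - 1) * c" if "0 < c" for c
    using that powr_add[of c "q/2" "q/2"] powr_add[of c "q - 1" 1] by auto
  define x y where "x = sqrt (a powr (q-1) * b)" and "y = sqrt (b powr (q-1) * a)"
  have xy: "x * y = a powr (q/2) * b powr (q/2)"
  proof -
    have "x * y = sqrt ((a powr q) * (b powr q))"
      using ab by (simp add: x_def y_def real_sqrt_mult[symmetric] e(2) mult_ac)
    also have "\<dots> = sqrt ((a powr (q/2) * b powr (q/2))\<^sup>2)"
      using ab by (simp add: e(1) power2_eq_square mult_ac)
    finally show ?thesis by simp
  qed
  have "2 * (x * y) \<le> x\<^sup>2 + y\<^sup>2" using sum_squares_bound[of x y] by simp
  then have "2 * (a powr (q/2) * b powr (q/2)) \<le> a powr (q-1) * b + b powr (q-1) * a"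
    using ab unfolding xy by (simp add: x_def y_def)
  then show ?thesis using e[OF ab(1)] e[OF ab(2)] by (simp add: power2_eq_square algebra_simps)
qed

lemma polar_decomposition:
  fixes \<xi> :: "'a::real_normed_vector"
  assumes "1 < norm \<xi>"
  shows "norm (\<xi> /\<^sub>R norm \<xi>) = 1" "\<xi> = (1 + (norm \<xi> - 1)) *\<^sub>R (\<xi> /\<^sub>R norm \<xi>)"
proof -
  have "norm \<xi> \<noteq> 0" using assms by linarith
  then show "norm (\<xi> /\<^sub>R norm \<xi>) = 1" "\<xi> = (1 + (norm \<xi> - 1)) *\<^sub>R (\<xi> /\<^sub>R norm \<xi>)" by simp_all
qed

text \<open>If both vectors have norm greater than \<open>1\<close>, they are \<open>(1 + a) e\<close> and \<open>(1 + b) f\<close> with unit vectors \<open>e\<close>, \<open>f\<close>. With \<open>c = e \<bullet> f\<close>, the inner product on the right is the one that belongs to the vectors \<open>a e\<close> and \<open>b f\<close> and the power field without degeneracy, plus the term \<open>(1 - c) (a powr (q-1) + b powr (q-1))\<close>, which is nonnegative. If a vector lies in the unit ball, its image is \<open>0\<close> and the Cauchy--Schwarz inequality suffices.\<close>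

lemma H_monotone:
  fixes \<xi> \<zeta> :: "real^'n"
  assumes q: "1 < q" "q < 2"
  shows "2 * (q - 1) / q * (norm (H (q/2) \<xi> - H (q/2) \<zeta>))\<^sup>2 \<le> (H (q-1) \<xi> - H (q-1) \<zeta>) \<bullet> (\<xi> - \<zeta>)"
proof -
  have c1: "2 * (q - 1) / q \<le> 1" "0 \<le> 2 * (q - 1) / q" using q by (auto simp: field_simps)
  have one: "2 * (q - 1) / q * (norm (H (q/2) \<xi>))\<^sup>2 \<le> H (q-1) \<xi> \<bullet> (\<xi> - \<zeta>)"
    if xi: "1 < norm \<xi>" and ze: "norm \<zeta> \<le> 1" for \<xi> \<zeta> :: "real^'n"
  proof -
    define a e where "a = norm \<xi> - 1" and "e = \<xi> /\<^sub>R norm \<xi>"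
    have a: "0 < a" and e: "norm e = 1" "\<xi> = (1 + a) *\<^sub>R e" using xi polar_decomposition[OF xi] by (simp_all add: a_def e_def)
    have "2 * (q - 1) / q * (norm (H (q/2) \<xi>))\<^sup>2 \<le> 1 * (norm (H (q/2) \<xi>))\<^sup>2"
      using c1 by (intro mult_right_mono) auto
    also have "1 * (norm (H (q/2) \<xi>))\<^sup>2 = a powr q"
      using xi q powr_add[of a "q/2" "q/2"] by (simp add: norm_H a_def power2_eq_square)
    also have "a powr q = a powr (q - 1) * a" using a powr_add[of a "q - 1" 1] by simp
    also have "\<dots> \<le> a powr (q - 1) * (e \<bullet> (\<xi> - \<zeta>))"
    proof (intro mult_left_mono)
      have "e \<bullet> \<zeta> \<le> 1" using norm_cauchy_schwarz[of e \<zeta>] e ze by simp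
      moreover have "e \<bullet> \<xi> = 1 + a" using e by (simp add: power2_norm_eq_inner[symmetric])
      ultimately show "a \<le> e \<bullet> (\<xi> - \<zeta>)" by (simp add: inner_diff_right)
    qed simp
    also have "\<dots> = H (q - 1) \<xi> \<bullet> (\<xi> - \<zeta>)" using xi by (simp add: H_def a_def e_def)
    finally show ?thesis .
  qed
  consider "norm \<xi> \<le> 1" "norm \<zeta> \<le> 1" | "1 < norm \<xi>" "norm \<zeta> \<le> 1" | "norm \<xi> \<le> 1" "1 < norm \<zeta>"
    | "1 < norm \<xi>" "1 < norm \<zeta>" by linarith
  then show ?thesis
  proof cases
    case 1 then show ?thesis by (simp add: H_eq_0)
  next
    case 2 then show ?thesis using one[of \<xi> \<zeta>] by (simp add: H_eq_0)
  next
    case 3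
    have "(H (q-1) \<xi> - H (q-1) \<zeta>) \<bullet> (\<xi> - \<zeta>) = H (q-1) \<zeta> \<bullet> (\<zeta> - \<xi>)"
      using 3 by (simp add: H_eq_0 inner_diff_right)
    then show ?thesis using one[of \<zeta> \<xi>] 3 by (simp add: H_eq_0)
  next
    case 4
    define a e where "a = norm \<xi> - 1" and "e = \<xi> /\<^sub>R norm \<xi>"
    define b f where "b = norm \<zeta> - 1" and "f = \<zeta> /\<^sub>R norm \<zeta>"
    have a: "0 < a" and e: "norm e = 1" "\<xi> = (1 + a) *\<^sub>R e" using 4 polar_decomposition[OF 4(1)] by (simp_all add: a_def e_def)
    have b: "0 < b" and f: "norm f = 1" "\<zeta> = (1 + b) *\<^sub>R f" using 4 polar_decomposition[OF 4(2)] by (simp_all add: b_def f_def)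
    have ef: "e \<bullet> e = 1" "f \<bullet> f = 1" using e f by (simp_all add: power2_norm_eq_inner[symmetric])
    define c where "c = e \<bullet> f"
    have c: "c \<le> 1" "-1 \<le> c" using Cauchy_Schwarz_ineq2[of e f] e f by (auto simp: c_def)
    have Hx: "H s \<xi> = a powr s *\<^sub>R e" "H s \<zeta> = b powr s *\<^sub>R f" for s
      using 4 by (simp_all add: H_def a_def b_def e_def f_def)
    let ?k = "2 * (q - 1) / q"
    let ?A = "a powr (q/2)" and ?B = "b powr (q/2)" and ?a = "a powr (q-1)" and ?b = "b powr (q-1)"
    have L: "(norm (H (q/2) \<xi> - H (q/2) \<zeta>))\<^sup>2 = ?A\<^sup>2 + ?B\<^sup>2 - 2 * c * ?A * ?B"
      unfolding Hx power2_norm_eq_inner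
      using ef by (simp add: inner_diff_left inner_diff_right inner_commute[of f e] c_def power2_eq_square algebra_simps)
    have R: "(H (q-1) \<xi> - H (q-1) \<zeta>) \<bullet> (\<xi> - \<zeta>) =
        (?a * a + ?b * b - c * (?a * b + ?b * a)) + (1 - c) * (?a + ?b)"
      unfolding Hx using ef
      by (subst e(2), subst f(2))
         (simp add: inner_diff_left inner_diff_right inner_commute[of f e] c_def algebra_simps)
    have p1: "?k * (?A - ?B)\<^sup>2 \<le> (?a - ?b) * (a - b)" by (rule powr_monotonicity_scalar[OF q a b])
    have "?k * (?A + ?B)\<^sup>2 \<le> 1 * (?A + ?B)\<^sup>2" using c1 by (intro mult_right_mono) auto
    then have p2: "?k * (?A + ?B)\<^sup>2 \<le> (?a + ?b) * (a + b)"
      using powr_antimonotone_scalar[OF q a b] by linarith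
    \<comment> \<open>both sides are affine in \<open>c\<close>, so that the extreme cases \<open>c = 1\<close> and \<open>c = -1\<close> suffice\<close>
    have "(1 + c)/2 * (?k * (?A - ?B)\<^sup>2) + (1 - c)/2 * (?k * (?A + ?B)\<^sup>2)
       \<le> (1 + c)/2 * ((?a - ?b) * (a - b)) + (1 - c)/2 * ((?a + ?b) * (a + b))"
      using p1 p2 c by (intro add_mono mult_left_mono) auto
    moreover have "(1 + c)/2 * (?k * (?A - ?B)\<^sup>2) + (1 - c)/2 * (?k * (?A + ?B)\<^sup>2) = ?k * (?A\<^sup>2 + ?B\<^sup>2 - 2 * c * ?A * ?B)"
    proof -
      have "(1 + c)/2 * (k * (A - B)\<^sup>2) + (1 - c)/2 * (k * (A + B)\<^sup>2) = k * (A\<^sup>2 + B\<^sup>2 - 2 * c * A * B)" for k A B :: real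
        by (simp add: field_simps power2_eq_square)
      then show ?thesis .
    qed
    moreover have "(1 + c)/2 * ((?a - ?b) * (a - b)) + (1 - c)/2 * ((?a + ?b) * (a + b)) = ?a * a + ?b * b - c * (?a * b + ?b * a)"
      by (simp add: field_simps)
    moreover have "0 \<le> (1 - c) * (?a + ?b)" using c by simp
    ultimately show ?thesis unfolding L R by linarith
  qed
qed

text \<open>Subadditivity of a concave power.\<close>

lemma powr_diff_le:
  fixes r s \<gamma> :: real
  assumes "0 \<le> s" "s \<le> r" "0 \<le> \<gamma>" "\<gamma> \<le> 1"
  shows "r powr \<gamma> - s powr \<gamma> \<le> (r - s) powr \<gamma>"
proof (cases "r = 0")
  case False
  then have r: "0 < r" using assms by linarith
  have x: "x \<le> x powr \<gamma>" if "0 \<le> x" "x \<le> 1" for x :: real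
    using powr_mono'[of \<gamma> 1 x] that assms by (cases "x = 0") auto
  have "1 = s / r + (r - s) / r" using r by (simp add: field_simps)
  also have "\<dots> \<le> (s/r) powr \<gamma> + ((r - s)/r) powr \<gamma>" using assms r by (intro add_mono x) auto
  also have "\<dots> = (s powr \<gamma> + (r - s) powr \<gamma>) / r powr \<gamma>"
    using assms r by (simp add: powr_divide add_divide_distrib)
  finally show ?thesis using r by (simp add: le_divide_eq)
qed (use assms in simp)

text \<open>With \<open>r e = H (q/2) \<xi>\<close> and \<open>s f = H (q/2) \<zeta>\<close> the field \<open>H (q-1)\<close> has the values \<open>r powr \<gamma> * e\<close> and \<open>s powr \<gamma> * f\<close>, where \<open>\<gamma> = 2 (q-1) / q\<close> is at most \<open>1\<close>. The lengths are compared by \<open>powr_diff_le\<close>; for the directions, \<open>s |e - f|\<close> is at most twice the distance of \<open>r e\<close> and \<open>s f\<close>.\<close>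

lemma H_Holder:
  fixes \<xi> \<zeta> :: "real^'n"
  assumes q: "1 < q" "q < 2"
  shows "norm (H (q-1) \<xi> - H (q-1) \<zeta>) \<le> 3 * norm (H (q/2) \<xi> - H (q/2) \<zeta>) powr (2 * (q - 1) / q)"
proof -
  define \<gamma> where "\<gamma> = 2 * (q - 1) / q"
  have \<gamma>: "0 \<le> \<gamma>" "\<gamma> \<le> 1" using q by (auto simp: \<gamma>_def field_simps)
  have qg: "q / 2 * \<gamma> = q - 1" using q by (simp add: \<gamma>_def field_simps)
  have main: "norm (H (q-1) \<xi> - H (q-1) \<zeta>) \<le> 3 * norm (H (q/2) \<xi> - H (q/2) \<zeta>) powr \<gamma>"
    if le: "norm \<zeta> \<le> norm \<xi>" for \<xi> \<zeta> :: "real^'n"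
  proof -
    define r s e f where "r = max 0 (norm \<xi> - 1) powr (q/2)" and "s = max 0 (norm \<zeta> - 1) powr (q/2)"
      and "e = \<xi> /\<^sub>R norm \<xi>" and "f = \<zeta> /\<^sub>R norm \<zeta>"
    have rs: "0 \<le> s" "s \<le> r" unfolding r_def s_def using le q by (auto intro!: powr_mono2)
    have e: "norm e \<le> 1" and f: "norm f \<le> 1"
      by (cases "\<xi> = 0"; cases "\<zeta> = 0"; simp add: e_def f_def)+
    have H1: "H (q/2) \<xi> = r *\<^sub>R e" "H (q/2) \<zeta> = s *\<^sub>R f" by (simp_all add: H_def r_def s_def e_def f_def)
    have H2: "H (q-1) \<xi> = r powr \<gamma> *\<^sub>R e" "H (q-1) \<zeta> = s powr \<gamma> *\<^sub>R f"
      by (simp_all only: H_def r_def s_def e_def f_def powr_powr qg)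
    define d where "d = norm (r *\<^sub>R e - s *\<^sub>R f)"
    have "norm (H (q/2) \<xi>) = r" "norm (H (q/2) \<zeta>) = s" using q by (simp_all add: norm_H r_def s_def)
    then have nr: "norm (r *\<^sub>R e) = r" "norm (s *\<^sub>R f) = s" by (simp_all only: H1)
    have d1: "r - s \<le> d" using norm_triangle_ineq2[of "r *\<^sub>R e" "s *\<^sub>R f"] nr by (simp add: d_def)
    \<comment> \<open>replace \<open>s f\<close> by \<open>r e\<close>, and then \<open>r\<close> by \<open>s\<close>; each step costs at most \<open>d\<close>\<close>
    have sef: "s * norm (e - f) \<le> 2 * d"
    proof -
      have "s * norm (e - f) = norm (s *\<^sub>R (e - f))" using rs by simp
      also have "s *\<^sub>R (e - f) = (r *\<^sub>R e - s *\<^sub>R f) - (r - s) *\<^sub>R e" by (simp add: algebra_simps)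
      also have "norm \<dots> \<le> d + norm ((r - s) *\<^sub>R e)" unfolding d_def by (rule norm_triangle_ineq4)
      also have "norm ((r - s) *\<^sub>R e) \<le> (r - s) * 1" using rs e by (simp add: mult_left_le)
      finally show ?thesis using d1 by simp
    qed
    have ef2: "norm (e - f) \<le> 2" using norm_triangle_ineq4[of e f] e f by simp
    have d0: "0 \<le> d" by (simp add: d_def)
    have "s powr \<gamma> * norm (e - f) \<le> 2 * d powr \<gamma>"
    proof -
      have "norm (e - f) = norm (e - f) powr \<gamma> * norm (e - f) powr (1 - \<gamma>)"
        by (cases "e = f") (auto simp flip: powr_add)
      then have "s powr \<gamma> * norm (e - f) = (s * norm (e - f)) powr \<gamma> * norm (e - f) powr (1 - \<gamma>)"
        using rs by (simp add: powr_mult)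
      also have "\<dots> \<le> (2 * d) powr \<gamma> * 2 powr (1 - \<gamma>)"
        by (rule mult_mono[OF powr_mono2 powr_mono2]) (use sef ef2 rs \<gamma> in auto)
      also have "\<dots> = 2 * d powr \<gamma>" using d0 by (simp add: powr_mult powr_diff)
      finally show ?thesis .
    qed
    moreover have "r powr \<gamma> - s powr \<gamma> \<le> d powr \<gamma>"
      using powr_diff_le[OF rs \<gamma>] powr_mono2[OF \<gamma>(1) _ d1] rs by auto
    moreover have "norm (r powr \<gamma> *\<^sub>R e - s powr \<gamma> *\<^sub>R f) \<le> (r powr \<gamma> - s powr \<gamma>) + s powr \<gamma> * norm (e - f)"
    proof -
      have "r powr \<gamma> *\<^sub>R e - s powr \<gamma> *\<^sub>R f = (r powr \<gamma> - s powr \<gamma>) *\<^sub>R e + s powr \<gamma> *\<^sub>R (e - f)"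
        by (simp add: algebra_simps)
      moreover have "norm ((r powr \<gamma> - s powr \<gamma>) *\<^sub>R e) \<le> r powr \<gamma> - s powr \<gamma>"
        using e powr_mono2[OF \<gamma>(1) rs] by (simp add: mult_left_le)
      ultimately show ?thesis
        using norm_triangle_ineq[of "(r powr \<gamma> - s powr \<gamma>) *\<^sub>R e" "s powr \<gamma> *\<^sub>R (e - f)"] by simp
    qed
    ultimately show ?thesis unfolding H1 H2 d_def[symmetric] by linarith
  qed
  show ?thesis
    using main[of \<xi> \<zeta>] main[of \<zeta> \<xi>] unfolding \<gamma>_def
    by (cases "norm \<zeta> \<le> norm \<xi>") (auto simp: norm_minus_commute)
qed

section \<open>Smooth functions\<close>

definition smooth :: "(real^'n \<Rightarrow> real) \<Rightarrow> bool" where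
  "smooth \<phi> \<longleftrightarrow> (\<forall>k. Ck k \<phi>)"

lemma Ck_Suc_imp: "Ck (Suc k) \<phi> \<Longrightarrow> Ck k \<phi>"
proof (induction k arbitrary: \<phi>)
  case 0
  then show ?case
    by (auto simp: continuous_on_eq_continuous_at differentiable_imp_continuous_within)
next
  case (Suc k)
  then have "\<forall>i. Ck (Suc k) (partial_deriv i \<phi>)" "\<forall>x. \<phi> differentiable (at x)"
    by (auto simp del: Ck.simps simp: Ck.simps(2)[of "Suc k"])
  then show ?case using Suc.IH by auto
qed

lemma smooth_differentiable: "smooth \<phi> \<Longrightarrow> \<phi> differentiable (at x)"
  unfolding smooth_def by (metis Ck.simps(2))

lemma smooth_partial: "smooth \<phi> \<Longrightarrow> smooth (partial_deriv i \<phi>)"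
  unfolding smooth_def by (metis Ck.simps(2))

lemma smooth_continuous: "smooth \<phi> \<Longrightarrow> continuous_on UNIV \<phi>"
  unfolding smooth_def by (metis Ck.simps(1))

lemma partial_deriv_eqI:
  "(\<phi> has_derivative D) (at x) \<Longrightarrow> partial_deriv i \<phi> x = D (axis i 1)"
  unfolding partial_deriv_def by (metis frechet_derivative_at)

lemma has_derivative_partial:
  assumes "\<phi> differentiable (at x)"
  shows "(\<phi> has_derivative (\<lambda>v. \<Sum>i\<in>UNIV. v $ i * partial_deriv i \<phi> x)) (at x)"
proof -
  let ?D = "frechet_derivative \<phi> (at x)"
  have D: "(\<phi> has_derivative ?D) (at x)" using assms frechet_derivative_works by blast
  then have lin: "linear ?D" by (rule has_derivative_linear)
  have "?D v = (\<Sum>i\<in>UNIV. v $ i * partial_deriv i \<phi> x)" for v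
  proof -
    have "?D v = ?D (\<Sum>i\<in>UNIV. v $ i *\<^sub>R axis i 1)"
      using basis_expansion[of v] by (simp add: scalar_mult_eq_scaleR)
    also have "\<dots> = (\<Sum>i\<in>UNIV. v $ i * partial_deriv i \<phi> x)"
      by (simp add: linear_sum[OF lin] linear_scale[OF lin] partial_deriv_def)
    finally show ?thesis .
  qed
  then show ?thesis using D by (metis (no_types, lifting) ext)
qed

lemma Ck_const: "Ck k (\<lambda>_::real^'n. c)"
proof (induction k arbitrary: c)
  case (Suc k)
  have "partial_deriv i (\<lambda>_. c) = (\<lambda>_. 0)" for i :: 'n
    by (rule ext) (rule partial_deriv_eqI[where D="\<lambda>_. 0", THEN trans], auto intro: has_derivative_const)
  then show ?case using Suc by simp
qed simp

lemma partial_deriv_nth: "partial_deriv i (\<lambda>x::real^'n. x $ j) x = (if i = j then 1 else 0)"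
proof -
  have "((\<lambda>x::real^'n. x $ j) has_derivative (\<lambda>x. x $ j)) (at x)"
    by (rule bounded_linear.has_derivative[OF bounded_linear_vec_nth]) (rule has_derivative_ident)
  from partial_deriv_eqI[OF this] show ?thesis by (simp add: axis_def)
qed

lemma Ck_nth: "Ck k (\<lambda>x::real^'n. x $ j)"
proof (cases k)
  case (Suc m)
  have "(\<lambda>x::real^'n. x $ j) differentiable (at x)" for x
    by (rule linear_imp_differentiable) (rule bounded_linear.linear[OF bounded_linear_vec_nth])
  moreover have "partial_deriv i (\<lambda>x::real^'n. x $ j) = (\<lambda>_. if i = j then 1 else 0)" for i
    by (rule ext) (rule partial_deriv_nth)
  ultimately show ?thesis using Suc by (simp add: Ck_const)
qed (simp, intro continuous_intros)

lemma partial_deriv_add: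
  "\<phi> differentiable (at x) \<Longrightarrow> \<psi> differentiable (at x) \<Longrightarrow>
   partial_deriv i (\<lambda>x. \<phi> x + \<psi> x) x = partial_deriv i \<phi> x + partial_deriv i \<psi> x"
  unfolding frechet_derivative_works
  by (drule (1) has_derivative_add, drule partial_deriv_eqI[where i=i]) (simp add: partial_deriv_def)

lemma partial_deriv_mult:
  "\<phi> differentiable (at x) \<Longrightarrow> \<psi> differentiable (at x) \<Longrightarrow>
   partial_deriv i (\<lambda>x. \<phi> x * \<psi> x) x = \<phi> x * partial_deriv i \<psi> x + partial_deriv i \<phi> x * \<psi> x"
  unfolding frechet_derivative_works
  by (drule (1) has_derivative_mult, drule partial_deriv_eqI[where i=i]) (simp add: partial_deriv_def)

lemma Ck_add: "Ck k \<phi> \<Longrightarrow> Ck k \<psi> \<Longrightarrow> Ck k (\<lambda>x. \<phi> x + \<psi> x)"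
proof (induction k arbitrary: \<phi> \<psi>)
  case (Suc k)
  then have "partial_deriv i (\<lambda>x. \<phi> x + \<psi> x) = (\<lambda>x. partial_deriv i \<phi> x + partial_deriv i \<psi> x)" for i
    by (auto intro!: partial_deriv_add)
  then show ?case using Suc by auto
qed (auto intro: continuous_intros)

lemma Ck_mult: "Ck k \<phi> \<Longrightarrow> Ck k \<psi> \<Longrightarrow> Ck k (\<lambda>x. \<phi> x * \<psi> x)"
proof (induction k arbitrary: \<phi> \<psi>)
  case (Suc k)
  have eq: "partial_deriv i (\<lambda>x. \<phi> x * \<psi> x) = (\<lambda>x. \<phi> x * partial_deriv i \<psi> x + partial_deriv i \<phi> x * \<psi> x)" for i
    using Suc.prems by (auto intro!: partial_deriv_mult)
  have "Ck k (\<lambda>x. \<phi> x * partial_deriv i \<psi> x + partial_deriv i \<phi> x * \<psi> x)" for i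
    using Suc.prems Suc.prems[THEN Ck_Suc_imp] by (intro Ck_add Suc.IH) auto
  then show ?case using Suc.prems eq by auto
qed (auto intro: continuous_intros)

lemma Ck_inverse: "Ck k \<phi> \<Longrightarrow> (\<And>x. \<phi> x \<noteq> 0) \<Longrightarrow> Ck k (\<lambda>x. inverse (\<phi> x))"
proof (induction k)
  case (Suc k)
  have eq: "partial_deriv i (\<lambda>x. inverse (\<phi> x)) = (\<lambda>x. (-1) * partial_deriv i \<phi> x * (inverse (\<phi> x) * inverse (\<phi> x)))" for i
  proof
    fix x
    have "(\<phi> has_derivative frechet_derivative \<phi> (at x)) (at x)"
      using Suc.prems frechet_derivative_works by auto
    from Deriv.has_derivative_inverse[OF _ this] Suc.prems(2)
    show "partial_deriv i (\<lambda>x. inverse (\<phi> x)) x = (-1) * partial_deriv i \<phi> x * (inverse (\<phi> x) * inverse (\<phi> x))"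
      by (subst partial_deriv_eqI) (auto simp: partial_deriv_def mult_ac)
  qed
  have "Ck k (\<lambda>x. (-1) * partial_deriv i \<phi> x * (inverse (\<phi> x) * inverse (\<phi> x)))" for i
    using Suc.prems Suc.IH[OF Ck_Suc_imp] by (intro Ck_mult Ck_const) auto
  moreover have "(\<lambda>x. inverse (\<phi> x)) differentiable at x" for x
    using Suc.prems by (intro differentiable_inverse) auto
  ultimately show ?case using eq by auto
qed (auto intro: continuous_intros)

lemma partial_deriv_shift: "partial_deriv i (\<lambda>x. \<phi> (x + a)) x = partial_deriv i \<phi> (x + a)"
  if "\<phi> differentiable (at (x + a))"
proof -
  have "(\<phi> has_derivative frechet_derivative \<phi> (at (x+a))) (at (x+a))"
    using that frechet_derivative_works by blast
  then have "((\<lambda>x. \<phi> (x+a)) has_derivative frechet_derivative \<phi> (at (x+a))) (at x)"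
    using has_derivative_compose[of "\<lambda>x. x+a" "\<lambda>x. x" x UNIV \<phi>] has_derivative_add_const[OF has_derivative_ident]
    by blast
  then show ?thesis by (subst partial_deriv_eqI) (auto simp: partial_deriv_def)
qed

lemma differentiable_shift: "(\<lambda>x. \<phi> (x + a)) differentiable (at x)"
  if "\<phi> differentiable (at (x + a :: 'a::real_normed_vector))"
  using that differentiable_compose[of \<phi> "\<lambda>x. x+a" x UNIV] by (auto intro!: derivative_intros)

lemma Ck_shift: "Ck k \<phi> \<Longrightarrow> Ck k (\<lambda>x. \<phi> (x + a))"
proof (induction k arbitrary: \<phi>)
  case 0
  then show ?case by (auto intro!: continuous_intros continuous_on_compose2[of UNIV \<phi>])
next
  case (Suc k)
  then have "partial_deriv i (\<lambda>x. \<phi> (x + a)) = (\<lambda>x. partial_deriv i \<phi> (x + a))" for i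
    by (auto intro!: partial_deriv_shift)
  then show ?case using Suc by (auto intro: differentiable_shift)
qed

text \<open>Composition with a function of one variable all of whose derivatives exist: \<open>G j\<close> is the derivative of order \<open>j\<close>. The statement is for all \<open>j\<close> at once because the chain rule passes from \<open>G j\<close> to \<open>G (Suc j)\<close>.\<close>

lemma Ck_compose:
  assumes "\<And>j t. (G j has_real_derivative G (Suc j) t) (at t)" and "Ck k \<phi>"
  shows "Ck k (\<lambda>x. G j (\<phi> x))"
  using assms(2)
proof (induction k arbitrary: j)
  case 0
  have "continuous_on UNIV (G j)"
    using assms(1) DERIV_isCont continuous_at_imp_continuous_on by blast
  then show ?case using 0 by (auto intro!: continuous_on_compose2[of UNIV "G j"])
next
  case (Suc k)
  have der: "((\<lambda>x. G j (\<phi> x)) has_derivative (\<lambda>v. frechet_derivative \<phi> (at x) v * G (Suc j) (\<phi> x))) (at x)" for x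
    using has_derivative_compose[of \<phi> "frechet_derivative \<phi> (at x)" x UNIV "G j"] Suc.prems assms(1)[of j "\<phi> x"]
    by (auto simp: frechet_derivative_works[symmetric] has_field_derivative_def mult.commute)
  then have eq: "partial_deriv i (\<lambda>x. G j (\<phi> x)) = (\<lambda>x. partial_deriv i \<phi> x * G (Suc j) (\<phi> x))" for i
    by (auto simp: partial_deriv_eqI[OF der] partial_deriv_def)
  have "Ck k (\<lambda>x. partial_deriv i \<phi> x * G (Suc j) (\<phi> x))" for i
    using Suc.prems Suc.IH[OF Ck_Suc_imp[OF Suc.prems]] by (auto intro!: Ck_mult)
  then show ?case using eq der by (auto simp: differentiable_def)
qed

lemma smooth_const [simp]: "smooth (\<lambda>_. c)" by (simp add: smooth_def Ck_const)
lemma smooth_nth [simp]: "smooth (\<lambda>x. x $ i)" by (simp add: smooth_def Ck_nth)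
lemma smooth_add: "smooth \<phi> \<Longrightarrow> smooth \<psi> \<Longrightarrow> smooth (\<lambda>x. \<phi> x + \<psi> x)" by (simp add: smooth_def Ck_add)
lemma smooth_mult: "smooth \<phi> \<Longrightarrow> smooth \<psi> \<Longrightarrow> smooth (\<lambda>x. \<phi> x * \<psi> x)" by (simp add: smooth_def Ck_mult)
lemma smooth_minus: "smooth \<phi> \<Longrightarrow> smooth \<psi> \<Longrightarrow> smooth (\<lambda>x. \<phi> x - \<psi> x)"
  using smooth_add[of \<phi> "\<lambda>x. (-1) * \<psi> x"] smooth_mult[of "\<lambda>_. -1" \<psi>] by simp
lemma smooth_inverse: "smooth \<phi> \<Longrightarrow> (\<And>x. \<phi> x \<noteq> 0) \<Longrightarrow> smooth (\<lambda>x. inverse (\<phi> x))"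
  by (simp add: smooth_def Ck_inverse)
lemma smooth_shift: "smooth \<phi> \<Longrightarrow> smooth (\<lambda>x. \<phi> (x + a))" by (simp add: smooth_def Ck_shift)
lemma smooth_sum: "finite I \<Longrightarrow> (\<And>i. i \<in> I \<Longrightarrow> smooth (\<phi> i)) \<Longrightarrow> smooth (\<lambda>x. \<Sum>i\<in>I. \<phi> i x)"
  by (induction I rule: finite_induct) (auto intro: smooth_add)
lemma smooth_prod: "finite I \<Longrightarrow> (\<And>i. i \<in> I \<Longrightarrow> smooth (\<phi> i)) \<Longrightarrow> smooth (\<lambda>x. \<Prod>i\<in>I. \<phi> i x)"
  by (induction I rule: finite_induct) (auto intro: smooth_mult)

section \<open>Bump functions\<close>

text \<open>The functions \<open>P (1/t) * exp (-1/t)\<close>, extended by \<open>0\<close>, form a family that is closed under differentiation; \<open>flat_step\<close> is the effect on the polynomial.\<close>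

definition flat :: "real poly \<Rightarrow> real \<Rightarrow> real" where
  "flat P t = (if t \<le> 0 then 0 else poly P (1 / t) * exp (- (1 / t)))"

definition flat_step :: "real poly \<Rightarrow> real poly" where
  "flat_step P = [:0, 0, 1:] * (P - pderiv P)"

lemma poly_times_exp_neg_tendsto_0: "((\<lambda>y. poly P y * exp (- y)) \<longlongrightarrow> 0) at_top" for P :: "real poly"
proof -
  have "((\<lambda>y. \<Sum>i\<le>degree P. coeff P i * (y ^ i / exp y)) \<longlongrightarrow> (\<Sum>i\<le>degree P. coeff P i * 0)) at_top"
    by (intro tendsto_intros tendsto_power_div_exp_0)
  moreover have "(\<lambda>y. poly P y * exp (- y)) = (\<lambda>y. \<Sum>i\<le>degree P. coeff P i * (y ^ i / exp y))"
    by (rule ext) (simp add: poly_altdef sum_distrib_right exp_minus divide_inverse mult.assoc)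
  ultimately show ?thesis by simp
qed

lemma flat_has_derivative: "(flat P has_real_derivative flat (flat_step P) t) (at t)"
proof (cases t "0::real" rule: linorder_cases)
  case less
  have "((\<lambda>_. 0) has_real_derivative 0) (at t)" by simp
  then have "(flat P has_real_derivative 0) (at t)"
    by (rule has_field_derivative_transform_within_open[of _ _ _ "{..<0}"]) (use less in \<open>auto simp: flat_def\<close>)
  then show ?thesis using less by (simp add: flat_def)
next
  case greater
  have "((\<lambda>t. poly P (1 / t) * exp (- (1 / t))) has_real_derivative
      poly (flat_step P) (1/t) * exp (- (1/t))) (at t)"
    using greater
    by (auto intro!: derivative_eq_intros DERIV_chain2[OF poly_DERIV] simp: flat_step_def field_simps power2_eq_square)
  then have "(flat P has_real_derivative poly (flat_step P) (1/t) * exp (- (1/t))) (at t)"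
    by (rule has_field_derivative_transform_within_open[of _ _ _ "{0<..}"]) (use greater in \<open>auto simp: flat_def\<close>)
  then show ?thesis using greater by (simp add: flat_def)
next
  case equal
  have "((\<lambda>y. flat P y / y) \<longlongrightarrow> 0) (at_right 0)"
  proof -
    have "((\<lambda>y::real. poly ([:0,1:] * P) (inverse y) * exp (- inverse y)) \<longlongrightarrow> 0) (at_right 0)"
      by (rule filterlim_compose[OF poly_times_exp_neg_tendsto_0 filterlim_inverse_at_top_right])
    then show ?thesis
      by (rule Lim_transform_eventually)
         (auto simp: eventually_at_filter flat_def field_simps)
  qed
  moreover have "((\<lambda>y. flat P y / y) \<longlongrightarrow> 0) (at_left 0)"
    by (rule Lim_transform_eventually[of "\<lambda>_. 0"]) (auto simp: eventually_at_filter flat_def)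
  ultimately have "((\<lambda>y. flat P y / y) \<longlongrightarrow> 0) (at 0)"
    by (simp add: filterlim_at_split)
  then show ?thesis using equal by (simp add: has_field_derivative_iff flat_def)
qed

definition bump1 :: "real \<Rightarrow> real" where "bump1 = flat 1"

lemma bump1_nonneg [simp]: "0 \<le> bump1 t" and bump1_pos_iff [simp]: "0 < bump1 t \<longleftrightarrow> 0 < t"
  and bump1_eq_0_iff [simp]: "bump1 t = 0 \<longleftrightarrow> t \<le> 0"
  by (auto simp: bump1_def flat_def)

lemma smooth_bump1: "smooth \<phi> \<Longrightarrow> smooth (\<lambda>x. bump1 (\<phi> x))"
  using Ck_compose[of "\<lambda>j. flat ((flat_step ^^ j) 1)" _ \<phi> 0] flat_has_derivative
  by (auto simp: smooth_def bump1_def)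

lemma smooth_norm_sq: "smooth (\<lambda>x::real^'n. (norm x)\<^sup>2)"
proof -
  have "(\<lambda>x::real^'n. (norm x)\<^sup>2) = (\<lambda>x. \<Sum>i\<in>UNIV. x $ i * x $ i)"
    by (auto simp: norm_vec_def L2_set_def power2_eq_square sum_nonneg)
  then show ?thesis by (auto intro!: smooth_sum smooth_mult)
qed

text \<open>The two bumps in the denominator never vanish together if \<open>a < b\<close>, so that the quotient is smooth; it is \<open>1\<close> where the second bump vanishes and \<open>0\<close> where the first one does. Since the function is radial around \<open>0\<close>, its translates share one bound for the gradient.\<close>

definition cutoff :: "real \<Rightarrow> real \<Rightarrow> real^'n \<Rightarrow> real" where
  "cutoff a b x = bump1 (b\<^sup>2 - (norm x)\<^sup>2) *
     inverse (bump1 (b\<^sup>2 - (norm x)\<^sup>2) + bump1 ((norm x)\<^sup>2 - a\<^sup>2))"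

context
  fixes a b :: real
  assumes ab: "0 \<le> a" "a < b"
begin

lemma cutoff_denominator_pos: "0 < bump1 (b\<^sup>2 - (norm x)\<^sup>2) + bump1 ((norm x)\<^sup>2 - a\<^sup>2)"
proof -
  have "a\<^sup>2 < b\<^sup>2" using ab by (intro power_strict_mono) auto
  then have "b\<^sup>2 - (norm x)\<^sup>2 > 0 \<or> (norm x)\<^sup>2 - a\<^sup>2 > 0" by linarith
  then show ?thesis by (smt (verit) bump1_nonneg bump1_pos_iff)
qed

lemma smooth_cutoff: "smooth (cutoff a b)"
  unfolding cutoff_def
  using cutoff_denominator_pos
  by (intro smooth_mult smooth_inverse smooth_add smooth_bump1 smooth_minus smooth_const smooth_norm_sq)
     (auto simp: less_le)

lemma cutoff_eq_1: "norm x \<le> a \<Longrightarrow> cutoff a b x = 1"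
  using cutoff_denominator_pos[of x] power_mono[of "norm x" a 2] bump1_eq_0_iff[of "(norm x)\<^sup>2 - a\<^sup>2"]
  by (auto simp: cutoff_def less_le simp del: bump1_eq_0_iff bump1_pos_iff)

lemma cutoff_eq_0: "b \<le> norm x \<Longrightarrow> cutoff a b x = 0"
  using ab power_mono[of b "norm x" 2] by (simp add: cutoff_def)

lemma cutoff_nonneg: "0 \<le> cutoff a b x" and cutoff_le_1: "cutoff a b x \<le> 1"
  using cutoff_denominator_pos[of x] by (auto simp: cutoff_def divide_inverse[symmetric])

end

section \<open>Test functions\<close>

lemma test_functions_iff:
  "\<phi> \<in> test_functions \<Omega> \<longleftrightarrow>
     smooth \<phi> \<and> compact (closure {x. \<phi> x \<noteq> 0}) \<and> closure {x. \<phi> x \<noteq> 0} \<subseteq> \<Omega>"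
  by (simp add: test_functions_def smooth_def)

lemma test_functionsI:
  assumes "smooth \<phi>" "compact K" "K \<subseteq> \<Omega>" "\<And>x. x \<notin> K \<Longrightarrow> \<phi> x = 0"
  shows "\<phi> \<in> test_functions \<Omega>"
proof -
  have "{x. \<phi> x \<noteq> 0} \<subseteq> K" using assms(4) by blast
  then have "closure {x. \<phi> x \<noteq> 0} \<subseteq> K" using assms(2) compact_imp_closed closure_minimal by blast
  moreover from this have "compact (closure {x. \<phi> x \<noteq> 0})"
    using assms(2) by (metis closed_closure compact_Int_closed inf.absorb_iff2)
  ultimately show ?thesis using assms by (auto simp: test_functions_iff)
qed

definition tsupp :: "(real^'n \<Rightarrow> real) \<Rightarrow> (real^'n) set" where
  "tsupp \<phi> = closure {x. \<phi> x \<noteq> 0}"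

lemma test_smooth: "\<phi> \<in> test_functions \<Omega> \<Longrightarrow> smooth \<phi>"
  and test_compact: "\<phi> \<in> test_functions \<Omega> \<Longrightarrow> compact (tsupp \<phi>)"
  and test_subset: "\<phi> \<in> test_functions \<Omega> \<Longrightarrow> tsupp \<phi> \<subseteq> \<Omega>"
  by (simp_all add: test_functions_iff tsupp_def)

lemma zero_outside_tsupp: "x \<notin> tsupp \<phi> \<Longrightarrow> \<phi> x = 0"
  using closure_subset[of "{x. \<phi> x \<noteq> 0}"] unfolding tsupp_def by auto

lemma partial_zero_outside_tsupp:
  assumes "x \<notin> tsupp \<phi>" shows "partial_deriv i \<phi> x = 0"
proof -
  have "((\<lambda>_. 0) has_derivative (\<lambda>_. 0)) (at x)" by (rule has_derivative_const)
  moreover have "open (- tsupp \<phi>)" by (simp add: tsupp_def open_Compl)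
  ultimately have "(\<phi> has_derivative (\<lambda>_. 0)) (at x)"
    by (rule has_derivative_transform_within_open[where s="- tsupp \<phi>"])
       (use assms in \<open>simp_all add: zero_outside_tsupp[of _ \<phi>]\<close>)
  then show ?thesis by (rule partial_deriv_eqI)
qed

lemma test_mono: "\<phi> \<in> test_functions \<Omega> \<Longrightarrow> \<Omega> \<subseteq> \<Omega>' \<Longrightarrow> \<phi> \<in> test_functions \<Omega>'"
  by (auto simp: test_functions_iff)

lemma test_mult_smooth:
  assumes "\<phi> \<in> test_functions \<Omega>" "smooth \<psi>"
  shows "(\<lambda>x. \<phi> x * \<psi> x) \<in> test_functions \<Omega>"
  using assms test_smooth[OF assms(1)] test_compact[OF assms(1)] test_subset[OF assms(1)]
  by (intro test_functionsI[of _ "tsupp \<phi>"] smooth_mult) (simp_all add: zero_outside_tsupp[of _ \<phi>])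

lemma test_partial:
  assumes "\<phi> \<in> test_functions \<Omega>"
  shows "partial_deriv i \<phi> \<in> test_functions \<Omega>"
  using test_smooth[OF assms(1)] test_compact[OF assms(1)] test_subset[OF assms(1)]
  by (intro test_functionsI[of _ "tsupp \<phi>"] smooth_partial) (simp_all add: partial_zero_outside_tsupp[of _ \<phi>])

lemma test_shift:
  assumes "\<phi> \<in> test_functions UNIV"
  shows "(\<lambda>x. \<phi> (x + a)) \<in> test_functions UNIV"
proof (rule test_functionsI[of _ "(\<lambda>x. - a + x) ` tsupp \<phi>"])
  show "compact ((\<lambda>x. - a + x) ` tsupp \<phi>)"
    using test_compact[OF assms] by (rule compact_translation)
  show "\<phi> (x + a) = 0" if "x \<notin> (\<lambda>x. - a + x) ` tsupp \<phi>" for x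
  proof (rule zero_outside_tsupp)
    show "x + a \<notin> tsupp \<phi>"
    proof
      assume "x + a \<in> tsupp \<phi>"
      then have "- a + (x + a) \<in> (\<lambda>x. - a + x) ` tsupp \<phi>" by (rule imageI)
      with that show False by simp
    qed
  qed
qed (simp_all add: smooth_shift test_smooth[OF assms])

lemma test_cont: "\<phi> \<in> test_functions \<Omega> \<Longrightarrow> continuous_on A \<phi>"
  using smooth_continuous[OF test_smooth] continuous_on_subset by blast

lemma test_bounded:
  assumes "\<phi> \<in> test_functions \<Omega>" obtains B where "0 < B" "\<And>x. \<bar>\<phi> x\<bar> \<le> B"
proof -
  have "bounded (\<phi> ` tsupp \<phi>)"
    by (intro compact_imp_bounded compact_continuous_image test_cont[OF assms] test_compact[OF assms])
  then obtain B where B: "0 < B" "\<forall>x\<in>tsupp \<phi>. \<bar>\<phi> x\<bar> \<le> B" by (auto simp: bounded_pos)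
  have "\<bar>\<phi> x\<bar> \<le> B" for x
    using B zero_outside_tsupp[of x \<phi>] by (cases "x \<in> tsupp \<phi>") simp_all
  then show ?thesis using that B(1) by blast
qed

lemma test_borel [measurable_dest]: "\<phi> \<in> test_functions \<Omega> \<Longrightarrow> \<phi> \<in> borel_measurable borel"
  using test_cont borel_measurable_continuous_onI by blast

definition grad :: "(real^'n \<Rightarrow> real) \<Rightarrow> real^'n \<Rightarrow> real^'n" where
  "grad \<phi> x = (\<chi> i. partial_deriv i \<phi> x)"

lemma has_derivative_grad: "smooth \<phi> \<Longrightarrow> (\<phi> has_derivative (\<lambda>v. grad \<phi> x \<bullet> v)) (at x)"
  using has_derivative_partial[OF smooth_differentiable, of \<phi> x]
  by (simp add: inner_vec_def grad_def mult.commute)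

lemma test_grad_bounded:
  assumes "\<phi> \<in> test_functions \<Omega>" obtains B where "0 < B" "\<And>x. norm (grad \<phi> x) \<le> B"
proof -
  have "\<exists>B. \<forall>x. \<bar>partial_deriv i \<phi> x\<bar> \<le> B" for i
    using test_bounded[OF test_partial[OF assms]] by metis
  then obtain B where B: "\<And>i x. \<bar>partial_deriv i \<phi> x\<bar> \<le> B i" by metis
  have "norm (grad \<phi> x) \<le> (\<Sum>i\<in>UNIV. B i)" for x
    using norm_le_l1_cart[of "grad \<phi> x"] sum_mono[of UNIV "\<lambda>i. \<bar>partial_deriv i \<phi> x\<bar>" B] B
    by (simp add: grad_def)
  then have "norm (grad \<phi> x) \<le> max 1 (\<Sum>i\<in>UNIV. B i)" for x by (simp add: max.coboundedI2)
  then show ?thesis using that[of "max 1 (\<Sum>i\<in>UNIV. B i)"] by simp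
qed

lemma test_lipschitz:
  fixes \<phi> :: "real^'n \<Rightarrow> real"
  assumes "\<phi> \<in> test_functions \<Omega>" obtains B where "0 < B" "\<And>x y. \<bar>\<phi> x - \<phi> y\<bar> \<le> B * norm (x - y)"
proof -
  obtain B where B: "0 < B" "\<And>x. norm (grad \<phi> x) \<le> B" using test_grad_bounded[OF assms] by blast
  have "norm (\<phi> x - \<phi> y) \<le> B * norm (x - y)" for x y
  proof (rule differentiable_bound[of UNIV \<phi> "\<lambda>x v. grad \<phi> x \<bullet> v" B x y])
    show "(\<phi> has_derivative (\<lambda>v. grad \<phi> x \<bullet> v)) (at x within UNIV)" for x
      using has_derivative_grad[OF test_smooth[OF assms]] by simp
    show "onorm (\<lambda>v. grad \<phi> x \<bullet> v) \<le> B" for x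
    proof (rule onorm_le)
      fix v show "norm (grad \<phi> x \<bullet> v) \<le> B * norm v"
        using Cauchy_Schwarz_ineq2[of "grad \<phi> x" v] B(2)[of x] mult_right_mono[of "norm (grad \<phi> x)" B "norm v"] by simp
    qed
  qed auto
  then show ?thesis using B that by auto
qed

lemma grad_borel [measurable]: "smooth \<phi> \<Longrightarrow> grad \<phi> \<in> borel_measurable borel"
  by (rule borel_measurable_continuous_onI)
     (auto simp: grad_def intro!: continuous_on_vec_lambda smooth_continuous smooth_partial)

lemma ball_cutoff_test:
  fixes z :: "real^'n"
  assumes "0 \<le> a" "a < b" "cball z b \<subseteq> \<Omega>"
  shows "(\<lambda>x. cutoff a b (x + (- z))) \<in> test_functions \<Omega>"
proof (rule test_functionsI[of _ "cball z b"])
  show "cutoff a b (x + - z) = 0" if "x \<notin> cball z b" for x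
    by (rule cutoff_eq_0) (use assms that in \<open>auto simp: dist_norm norm_minus_commute\<close>)
qed (use assms in \<open>simp_all add: smooth_shift[OF smooth_cutoff, of a b "- z", simplified]\<close>)

section \<open>Translations and bounded factors in integrals\<close>

lemma lebesgue_shift_measurable [measurable]: "(\<lambda>x. x + a) \<in> lebesgue \<rightarrow>\<^sub>M lebesgue"
  and distr_lebesgue_shift: "distr lebesgue lebesgue (\<lambda>x. x + a) = lebesgue" for a :: "'a::euclidean_space"
proof -
  have eq: "(\<lambda>x. a + (\<Sum>j\<in>Basis. (1 * (x \<bullet> j)) *\<^sub>R j)) = (\<lambda>x. x + a)"
    by (simp add: euclidean_representation add.commute)
  show "(\<lambda>x. x + a) \<in> lebesgue \<rightarrow>\<^sub>M lebesgue"
    using lebesgue_affine_measurable[of "\<lambda>_. 1" a] unfolding eq by simp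
  show "distr lebesgue lebesgue (\<lambda>x. x + a) = lebesgue"
    using lebesgue_affine_euclidean[of "\<lambda>_. 1" a] unfolding eq by (simp add: density_1)
qed

lemma borel_measurable_shift:
  "f \<in> borel_measurable lebesgue \<Longrightarrow> (\<lambda>x. f (x + a)) \<in> borel_measurable lebesgue"
  by (rule measurable_compose[OF lebesgue_shift_measurable])

lemma integrable_shift:
  fixes f :: "'a::euclidean_space \<Rightarrow> 'b::{banach, second_countable_topology}"
  shows "integrable lebesgue f \<Longrightarrow> integrable lebesgue (\<lambda>x. f (x + a))"
  using integrable_distr[OF lebesgue_shift_measurable, of a f] distr_lebesgue_shift[of a] by simp

lemma integral_shift:
  fixes f :: "'a::euclidean_space \<Rightarrow> 'b::{banach, second_countable_topology}"
  shows "f \<in> borel_measurable lebesgue \<Longrightarrow> (\<integral>x. f (x + a) \<partial>lebesgue) = (\<integral>x. f x \<partial>lebesgue)"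
  using integral_distr[OF lebesgue_shift_measurable, of f a] distr_lebesgue_shift[of a] by simp

lemma AE_shift: "(AE x in lebesgue. P x) \<Longrightarrow> (AE x in lebesgue. P (x + a))"
  for a :: "'a::euclidean_space"
  by (rule AE_distrD[OF lebesgue_shift_measurable[of a]]) (simp only: distr_lebesgue_shift)

lemma integrable_bounded_scaleR:
  fixes f :: "'a \<Rightarrow> 'b::{banach, second_countable_topology}"
  assumes "integrable M f" "g \<in> borel_measurable M" "\<And>x. \<bar>g x\<bar> \<le> B"
  shows "integrable M (\<lambda>x. g x *\<^sub>R f x)"
proof (rule Bochner_Integration.integrable_bound)
  show "integrable M (\<lambda>x. B * norm (f x))" using assms by simp
  have "\<bar>g x\<bar> * norm (f x) \<le> \<bar>B\<bar> * norm (f x)" for x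
    using assms(3)[of x] by (intro mult_right_mono) auto
  then show "AE x in M. norm (g x *\<^sub>R f x) \<le> norm (B * norm (f x))" by (simp add: abs_mult)
qed (use assms in auto)

lemma integrable_bounded_mult:
  fixes f :: "'a \<Rightarrow> real"
  assumes "integrable M f" "g \<in> borel_measurable M" "\<And>x. \<bar>g x\<bar> \<le> B"
  shows "integrable M (\<lambda>x. f x * g x)"
  using integrable_bounded_scaleR[OF assms] by (simp add: mult.commute)

lemma test_lebesgue: "\<phi> \<in> test_functions \<Omega> \<Longrightarrow> \<phi> \<in> borel_measurable lebesgue"
  by (rule measurable_completion) (simp add: test_borel)

lemma integrable_mult_test:
  fixes f :: "real^'n \<Rightarrow> real"
  assumes "integrable lebesgue f" "\<phi> \<in> test_functions \<Omega>"
  shows "integrable lebesgue (\<lambda>x. f x * \<phi> x)"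
  by (rule test_bounded[OF assms(2)])
     (rule integrable_bounded_mult[OF assms(1) test_lebesgue[OF assms(2)]])

section \<open>The fundamental lemma of the calculus of variations\<close>

text \<open>A smooth function that is positive exactly on an open box.\<close>

definition box_bump :: "real^'n \<Rightarrow> real^'n \<Rightarrow> real^'n \<Rightarrow> real" where
  "box_bump a c x = (\<Prod>i\<in>UNIV. bump1 (x $ i - a $ i) * bump1 (c $ i - x $ i))"

lemma box_bump_nonneg: "0 \<le> box_bump a c x"
  by (simp add: box_bump_def prod_nonneg)

lemma box_bump_eq_0_iff: "box_bump a c x = 0 \<longleftrightarrow> x \<notin> box a c"
  by (auto simp: box_bump_def mem_box_cart not_less)

lemma smooth_box_bump: "smooth (box_bump a c)"
  unfolding box_bump_def
  by (intro smooth_prod smooth_mult smooth_bump1 smooth_minus smooth_nth smooth_const) auto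

text \<open>If \<open>b\<close> is smooth, nonnegative, and positive exactly on a box, then the test functions \<open>k b / (1 + k b)\<close> tend to the indicator of the box. By dominated convergence the integral of \<open>W\<close> over every box vanishes, and Lebesgue's differentiation theorem gives \<open>W = 0\<close>.\<close>

lemma AE_zero_if_orthogonal_to_test_functions:
  fixes W :: "real^'n \<Rightarrow> real"
  assumes W: "integrable lebesgue W"
    and orth: "\<And>\<psi>. \<psi> \<in> test_functions UNIV \<Longrightarrow> (\<integral>x. W x * \<psi> x \<partial>lebesgue) = 0"
  shows "AE x in lebesgue. W x = 0"
proof -
  have int: "W integrable_on cbox a c" "integral (cbox a c) W = 0" for a c
  proof -
    let ?b = "box_bump a c"
    define \<psi> where "\<psi> k x = real k * ?b x * inverse (1 + real k * ?b x)" for k x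
    have pos: "1 + real k * ?b x > 0" for k x
      using box_bump_nonneg[of a c x] by (simp add: add_pos_nonneg)
    have sm: "smooth (\<psi> k)" for k
      unfolding \<psi>_def using pos
      by (intro smooth_mult smooth_inverse smooth_add smooth_const smooth_box_bump) (auto simp: less_le)
    have test: "\<psi> k \<in> test_functions UNIV" for k
    proof (rule test_functionsI[of _ "cbox a c"])
      show "\<psi> k x = 0" if "x \<notin> cbox a c" for x
        using that box_subset_cbox[of a c] by (auto simp: \<psi>_def box_bump_eq_0_iff)
    qed (use sm in auto)
    have "(\<lambda>k. \<integral>x. W x * \<psi> k x \<partial>lebesgue) \<longlonglongrightarrow> (\<integral>x. W x * indicator (box a c) x \<partial>lebesgue)"
    proof (rule integral_dominated_convergence)
      show "(\<lambda>x. W x * indicator (box a c) x) \<in> borel_measurable lebesgue"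
        using borel_measurable_integrable[OF W] by (intro borel_measurable_times borel_measurable_indicator) auto
      show "(\<lambda>x. W x * \<psi> k x) \<in> borel_measurable lebesgue" for k
        by (rule borel_measurable_integrable) (rule integrable_mult_test[OF W test])
      show "integrable lebesgue (\<lambda>x. norm (W x))" using W by simp
      have "\<bar>\<psi> k x\<bar> \<le> 1" for k x
      proof -
        have "\<psi> k x = (real k * ?b x) / (1 + real k * ?b x)" by (simp add: \<psi>_def divide_inverse)
        then show ?thesis using pos[of k x] box_bump_nonneg[of a c x] by (simp add: abs_mult)
      qed
      then show "AE x in lebesgue. norm (W x * \<psi> k x) \<le> norm (W x)" for k
        by (simp add: abs_mult mult_left_le)
      have "(\<lambda>k. \<psi> k x) \<longlonglongrightarrow> indicator (box a c) x" for x
      proof (cases "x \<in> box a c")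
        case True
        then have b: "?b x > 0" using box_bump_nonneg[of a c x] box_bump_eq_0_iff[of a c x] by linarith
        have "filterlim (\<lambda>k. 1 + real k * ?b x) at_top sequentially"
          by (intro filterlim_tendsto_add_at_top[OF tendsto_const]
              filterlim_at_top_mult_tendsto_pos[OF tendsto_const b] filterlim_real_sequentially)
        then have "(\<lambda>k. 1 - inverse (1 + real k * ?b x)) \<longlonglongrightarrow> 1 - 0"
          by (intro tendsto_intros tendsto_inverse_0_at_top)
        moreover have "1 - inverse (1 + real k * ?b x) = \<psi> k x" for k
          using pos[of k x] by (simp add: \<psi>_def field_simps)
        ultimately show ?thesis using True by simp
      qed (simp add: \<psi>_def box_bump_eq_0_iff[THEN iffD2])
      then show "AE x in lebesgue. (\<lambda>k. W x * \<psi> k x) \<longlonglongrightarrow> W x * indicator (box a c) x"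
        by (intro AE_I2 tendsto_mult tendsto_const)
    qed
    then have 0: "(\<integral>x. W x * indicator (box a c) x \<partial>lebesgue) = 0"
      unfolding orth[OF test] by (rule LIMSEQ_unique[OF _ tendsto_const])
    have si: "set_integrable lebesgue S W" if "S \<in> sets lebesgue" for S
      unfolding set_integrable_def
      by (rule integrable_bounded_scaleR[OF W, of _ 1]) (use that in \<open>auto simp: indicator_def\<close>)
    show "W integrable_on cbox a c"
      by (rule set_lebesgue_integral_eq_integral(1)) (rule si, simp)
    have "integral (box a c) W = 0"
      using set_lebesgue_integral_eq_integral(2)[OF si[of "box a c"]] 0
      by (simp add: set_lebesgue_integral_def mult.commute)
    then show "integral (cbox a c) W = 0" by (simp add: integral_open_interval)
  qed
  obtain N where N: "negligible N"
    "\<And>x e. x \<notin> N \<Longrightarrow> 0 < e \<Longrightarrow> \<exists>d>0. \<forall>h. 0 < h \<and> h < d \<longrightarrow>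
        norm (integral (cbox x (x + h *\<^sub>R One)) W /\<^sub>R h ^ DIM(real^'n) - W x) < e"
    using integrable_ccontinuous_explicit[OF int(1)] by metis
  have "W x = 0" if xN: "x \<notin> N" for x
  proof (rule ccontr)
    assume "W x \<noteq> 0"
    then obtain d where "d > 0" and d: "\<And>h. 0 < h \<and> h < d \<Longrightarrow>
        norm (integral (cbox x (x + h *\<^sub>R One)) W /\<^sub>R h ^ DIM(real^'n) - W x) < \<bar>W x\<bar>"
      using N(2)[OF xN, of "\<bar>W x\<bar>"] by auto
    then show False using d[of "d/2"] int(2) by simp
  qed
  then show ?thesis using N(1)
    by (intro AE_I'[of N]) (auto simp: negligible_iff_null_sets)
qed

section \<open>Lebesgue spaces\<close>

lemma Lp_UNIV_iff:
  "v \<in> Lp m UNIV \<longleftrightarrow> v \<in> borel_measurable lebesgue \<and> integrable lebesgue (\<lambda>x. norm (v x) powr m)"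
  by (simp add: Lp_def set_borel_measurable_def set_integrable_def)

lemma Lp_subset:
  assumes "v \<in> Lp m A" "B \<subseteq> A" "B \<in> sets lebesgue"
  shows "v \<in> Lp m B"
proof -
  have "(\<lambda>x. indicator B x *\<^sub>R (indicator A x *\<^sub>R v x)) \<in> borel_measurable lebesgue"
    by (rule borel_measurable_scaleR[OF borel_measurable_indicator[OF assms(3)]])
       (use assms(1) in \<open>simp add: Lp_def set_borel_measurable_def\<close>)
  moreover have "(\<lambda>x. indicator B x *\<^sub>R (indicator A x *\<^sub>R v x)) = (\<lambda>x. indicator B x *\<^sub>R v x)"
    by (rule ext) (use assms(2) in \<open>auto split: split_indicator\<close>)
  moreover have "set_integrable lebesgue B (\<lambda>x. norm (v x) powr m)"
    by (rule set_integrable_subset[of lebesgue A]) (use assms in \<open>simp_all add: Lp_def\<close>)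
  ultimately show ?thesis by (simp only: Lp_def set_borel_measurable_def mem_Collect_eq simp_thms)
qed

lemma Lp_restrict_iff:
  "v \<in> Lp m A \<longleftrightarrow> (\<lambda>x. indicator A x *\<^sub>R v x) \<in> Lp m UNIV"
proof -
  have "(\<lambda>x. norm (indicator A x *\<^sub>R v x) powr m) = (\<lambda>x. indicator A x *\<^sub>R norm (v x) powr m)"
    by (auto simp: indicator_def)
  then show ?thesis by (simp add: Lp_UNIV_iff) (simp add: Lp_def set_borel_measurable_def set_integrable_def)
qed

lemma Lp_bound:
  fixes v :: "real^'n \<Rightarrow> 'a::euclidean_space" and w :: "real^'n \<Rightarrow> 'b::euclidean_space"
  assumes "v \<in> Lp m UNIV" "w \<in> borel_measurable lebesgue" "\<And>x. norm (w x) \<le> B * norm (v x)" "0 \<le> m" "0 \<le> B"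
  shows "w \<in> Lp m UNIV"
  unfolding Lp_UNIV_iff
proof (intro conjI)
  show "integrable lebesgue (\<lambda>x. norm (w x) powr m)"
  proof (rule Bochner_Integration.integrable_bound)
    show "integrable lebesgue (\<lambda>x. B powr m * norm (v x) powr m)"
      using assms(1) by (simp add: Lp_UNIV_iff)
    show "AE x in lebesgue. norm (norm (w x) powr m) \<le> norm (B powr m * norm (v x) powr m)"
      using powr_mono2[OF assms(4) norm_ge_zero assms(3)] assms(5) by (simp add: powr_mult)
  qed (use assms(2) in simp)
qed (use assms(2) in simp)

lemma powr_add_le:
  fixes a b m :: real
  assumes "0 \<le> a" "0 \<le> b" "0 \<le> m"
  shows "(a + b) powr m \<le> 2 powr m * (a powr m + b powr m)"
proof -
  have "(a + b) powr m \<le> (2 * max a b) powr m" using assms by (intro powr_mono2) auto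
  also have "\<dots> = 2 powr m * max a b powr m" using assms by (simp add: powr_mult)
  also have "\<dots> \<le> 2 powr m * (a powr m + b powr m)" by (intro mult_left_mono) (auto simp: max_def)
  finally show ?thesis .
qed

lemma Lp_add:
  assumes "v \<in> Lp m UNIV" "w \<in> Lp m UNIV" "0 \<le> m"
  shows "(\<lambda>x. v x + w x) \<in> Lp m UNIV"
  unfolding Lp_UNIV_iff
proof (intro conjI)
  show meas: "(\<lambda>x. v x + w x) \<in> borel_measurable lebesgue"
    by (rule borel_measurable_add) (use assms in \<open>simp_all add: Lp_UNIV_iff\<close>)
  show "integrable lebesgue (\<lambda>x. norm (v x + w x) powr m)"
  proof (rule Bochner_Integration.integrable_bound)
    show "integrable lebesgue (\<lambda>x. 2 powr m * (norm (v x) powr m + norm (w x) powr m))"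
      using assms by (simp add: Lp_UNIV_iff)
    have "norm (v x + w x) powr m \<le> 2 powr m * (norm (v x) powr m + norm (w x) powr m)" for x
      using powr_mono2[OF assms(3) norm_ge_zero norm_triangle_ineq[of "v x" "w x"]]
        powr_add_le[of "norm (v x)" "norm (w x)" m] assms(3) by simp
    then show "AE x in lebesgue. norm (norm (v x + w x) powr m) \<le> norm (2 powr m * (norm (v x) powr m + norm (w x) powr m))"
      by simp
  qed (use meas in simp)
qed

lemma Lp_scaleR:
  assumes "v \<in> Lp m UNIV" "g \<in> borel_measurable lebesgue" "\<And>x. \<bar>g x\<bar> \<le> B" "0 \<le> m"
  shows "(\<lambda>x. g x *\<^sub>R v x) \<in> Lp m UNIV"
proof (rule Lp_bound[OF assms(1) _ _ assms(4)])
  show "(\<lambda>x. g x *\<^sub>R v x) \<in> borel_measurable lebesgue"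
    by (rule borel_measurable_scaleR) (use assms in \<open>simp_all add: Lp_UNIV_iff\<close>)
  show "norm (g x *\<^sub>R v x) \<le> B * norm (v x)" for x
    using assms(3)[of x] by (simp add: mult_right_mono)
  show "0 \<le> B" using assms(3)[of undefined] by linarith
qed

lemma Lp_diff:
  assumes "v \<in> Lp m UNIV" "w \<in> Lp m UNIV" "0 \<le> m"
  shows "(\<lambda>x. v x - w x) \<in> Lp m UNIV"
  using Lp_add[OF assms(1) Lp_scaleR[OF assms(2), of "\<lambda>_. -1" 1] assms(3)] assms(3) by simp

lemma Lp_shift: "v \<in> Lp m UNIV \<Longrightarrow> (\<lambda>x. v (x + a)) \<in> Lp m UNIV"
  unfolding Lp_UNIV_iff by (auto intro: borel_measurable_shift integrable_shift)

lemma compact_in_sets_lebesgue: "compact K \<Longrightarrow> K \<in> sets lebesgue" for K :: "(real^'n) set"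
  by (simp add: borel_compact)

lemma tsupp_indicator: "\<zeta> x *\<^sub>R (indicator (tsupp \<zeta>) x *\<^sub>R v) = \<zeta> x *\<^sub>R v"
  for v :: "'a::real_vector"
  using zero_outside_tsupp[of x \<zeta>] by (auto simp: indicator_def)

lemma test_mult_Lp:
  assumes "v \<in> Lp_loc m \<Omega>" "\<zeta> \<in> test_functions \<Omega>" "0 \<le> m"
  shows "(\<lambda>x. \<zeta> x *\<^sub>R v x) \<in> Lp m UNIV"
proof -
  obtain B where B: "\<And>x. \<bar>\<zeta> x\<bar> \<le> B" using test_bounded[OF assms(2)] by blast
  have "v \<in> Lp m (tsupp \<zeta>)"
    using assms test_compact[OF assms(2)] test_subset[OF assms(2)] by (simp add: Lp_loc_def)
  then have "(\<lambda>x. \<zeta> x *\<^sub>R (indicator (tsupp \<zeta>) x *\<^sub>R v x)) \<in> Lp m UNIV"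
    unfolding Lp_restrict_iff[of v]
    by (rule Lp_scaleR[OF _ test_lebesgue[OF assms(2)] B assms(3)])
  then show ?thesis by (simp only: tsupp_indicator)
qed

lemma Lp_1_integrable: "v \<in> Lp 1 UNIV \<longleftrightarrow> integrable lebesgue v"
  by (auto simp: Lp_UNIV_iff integrable_norm_iff intro: borel_measurable_integrable)

text \<open>A finite sum of cutoff functions of balls. The lower bound \<open>1\<close> on \<open>K\<close> suffices, as the function is used to pass to a product and to divide by it on \<open>K\<close> afterwards.\<close>

lemma exists_test_function_ge_1:
  fixes K :: "(real^'n) set"
  assumes "compact K" "open \<Omega>" "K \<subseteq> \<Omega>"
  obtains \<zeta> where "\<zeta> \<in> test_functions \<Omega>" "\<And>x. 0 \<le> \<zeta> x" "\<And>x. x \<in> K \<Longrightarrow> 1 \<le> \<zeta> x"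
proof -
  have "\<exists>r>0. cball x (2*r) \<subseteq> \<Omega>" if xK: "x \<in> K" for x
  proof -
    obtain e where "e > 0" "cball x e \<subseteq> \<Omega>" using assms(2,3) xK unfolding open_contains_cball by blast
    then show ?thesis by (intro exI[of _ "e/2"]) simp
  qed
  then obtain r where r: "\<And>x. x \<in> K \<Longrightarrow> 0 < r x \<and> cball x (2 * r x) \<subseteq> \<Omega>" by metis
  have "K \<subseteq> (\<Union>x\<in>K. ball x (r x))" using r by force
  then obtain C where C: "C \<subseteq> K" "finite C" "K \<subseteq> (\<Union>x\<in>C. ball x (r x))"
    using compactE_image[OF assms(1), of K "\<lambda>x. ball x (r x)"] by auto
  let ?c = "\<lambda>z x. cutoff (r z) (2 * r z) (x + (- z))"
  have zero: "?c z x = 0" if "z \<in> C" "x \<notin> (\<Union>z\<in>C. cball z (2 * r z))" for z x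
  proof (rule cutoff_eq_0)
    have "x \<notin> cball z (2 * r z)" using that by blast
    then show "2 * r z \<le> norm (x + - z)" by (simp add: dist_norm norm_minus_commute)
  qed (use r C that in \<open>auto simp: less_imp_le\<close>)
  show ?thesis
  proof (rule that[of "\<lambda>x. \<Sum>z\<in>C. ?c z x"])
    show "(\<lambda>x. \<Sum>z\<in>C. ?c z x) \<in> test_functions \<Omega>"
    proof (rule test_functionsI[of _ "\<Union>z\<in>C. cball z (2 * r z)"])
      have "smooth (?c z)" if "z \<in> C" for z
        using that C r by (intro smooth_shift smooth_cutoff) (auto simp: less_imp_le)
      then show "smooth (\<lambda>x. \<Sum>z\<in>C. ?c z x)" using C by (intro smooth_sum) auto
    qed (use C r zero in auto)
    have nn: "0 \<le> ?c z x" if "z \<in> C" for z x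
      using that C r by (intro cutoff_nonneg) (auto simp: less_imp_le)
    then show "0 \<le> (\<Sum>z\<in>C. ?c z x)" for x by (rule sum_nonneg)
    show "1 \<le> (\<Sum>z\<in>C. ?c z x)" if xK: "x \<in> K" for x
    proof -
      obtain z where z: "z \<in> C" "x \<in> ball z (r z)" using C xK by blast
      then have "?c z x = 1"
        using C r[of z] by (intro cutoff_eq_1) (auto simp: dist_norm norm_minus_commute less_imp_le)
      then show ?thesis using member_le_sum[of z C "\<lambda>z. ?c z x"] z C nn by auto
    qed
  qed
qed

lemma Lp_divide_test:
  assumes "(\<lambda>x. \<zeta> x *\<^sub>R v x) \<in> Lp m UNIV" "\<zeta> \<in> borel_measurable lebesgue" "\<And>x. x \<in> K \<Longrightarrow> 1 \<le> \<zeta> x" "K \<in> sets lebesgue" "0 \<le> m"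
  shows "v \<in> Lp m K"
proof -
  have "(\<lambda>x. (indicator K x / \<zeta> x) *\<^sub>R (\<zeta> x *\<^sub>R v x)) \<in> Lp m UNIV"
  proof (rule Lp_scaleR[OF assms(1), where B=1])
    show "\<bar>indicator K x / \<zeta> x\<bar> \<le> 1" for x
      using assms(3)[of x] by (cases "x \<in> K") (auto simp: divide_le_eq_1)
  qed (use assms in \<open>auto intro: borel_measurable_divide borel_measurable_indicator\<close>)
  moreover have "(indicator K x / \<zeta> x) *\<^sub>R (\<zeta> x *\<^sub>R v x) = indicator K x *\<^sub>R v x" for x
    using assms(3)[of x] by (auto simp: indicator_def)
  ultimately show ?thesis unfolding Lp_restrict_iff[of v] by (simp only:)
qed

lemma Lp_AE_cong:
  assumes "v \<in> Lp m K" "AE x in lebesgue. x \<in> K \<longrightarrow> w x = v x"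
  shows "w \<in> Lp m K"
proof -
  have ae: "AE x in lebesgue. indicator K x *\<^sub>R v x = indicator K x *\<^sub>R w x"
    using assms(2) by eventually_elim (auto simp: indicator_def)
  have m: "(\<lambda>x. indicator K x *\<^sub>R v x) \<in> borel_measurable lebesgue"
    and i: "integrable lebesgue (\<lambda>x. norm (indicator K x *\<^sub>R v x) powr m)"
    using assms(1) unfolding Lp_restrict_iff[of v] Lp_UNIV_iff by auto
  have m': "(\<lambda>x. indicator K x *\<^sub>R w x) \<in> borel_measurable lebesgue"
    by (rule borel_measurable_AE[OF m ae])
  moreover have "integrable lebesgue (\<lambda>x. norm (indicator K x *\<^sub>R w x) powr m)"
    by (rule integrable_cong_AE_imp[OF i]) (use m' ae in \<open>auto simp del: norm_scaleR elim!: eventually_mono\<close>)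
  ultimately show ?thesis unfolding Lp_restrict_iff[of w] Lp_UNIV_iff by auto
qed

section \<open>Weak gradients of integrable functions on the whole space\<close>

text \<open>Weak gradients of integrable functions on the whole space. In contrast to \<open>weak_gradient\<close>, this notion is invariant under translations.\<close>

definition wgrad :: "(real^'n \<Rightarrow> real) \<Rightarrow> (real^'n \<Rightarrow> real^'n) \<Rightarrow> bool" where
  "wgrad v Dv \<longleftrightarrow> integrable lebesgue v \<and> integrable lebesgue Dv \<and>
     (\<forall>\<psi>\<in>test_functions UNIV. \<forall>i.
        (\<integral>x. v x * partial_deriv i \<psi> x \<partial>lebesgue) = - (\<integral>x. Dv x $ i * \<psi> x \<partial>lebesgue))"

lemma set_integral_eq_integral:
  fixes f :: "'a \<Rightarrow> 'b::{banach, second_countable_topology}"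
  assumes "\<And>x. x \<notin> A \<Longrightarrow> f x = 0"
  shows "(LINT x:A|M. f x) = (\<integral>x. f x \<partial>M)"
  unfolding set_lebesgue_integral_def
  by (rule Bochner_Integration.integral_cong) (use assms in \<open>auto simp: indicator_def\<close>)

lemma integrable_vec_nth: "integrable M f \<Longrightarrow> integrable M (\<lambda>x. f x $ i)" for f :: "'a \<Rightarrow> real^'n"
  using integrable_inner_left[of "axis i 1" M f] by (simp add: inner_axis)

lemma test_zero_outside: "\<psi> \<in> test_functions \<Omega> \<Longrightarrow> x \<notin> \<Omega> \<Longrightarrow> \<psi> x = 0"
  using test_subset[of \<psi> \<Omega>] zero_outside_tsupp[of x \<psi>] by blast

lemma wgrad_imp_weak_gradient:
  fixes v :: "real^'n \<Rightarrow> real"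
  assumes "wgrad v Dv"
  shows "weak_gradient \<Omega> v Dv"
proof -
  have loc: "w \<in> Lp_loc 1 \<Omega>" if "integrable lebesgue w" for w :: "real^'n \<Rightarrow> 'b::euclidean_space"
    using that Lp_subset[of w 1 UNIV] by (auto simp: Lp_loc_def Lp_1_integrable compact_in_sets_lebesgue)
  have "(LINT x:\<Omega>|lebesgue. v x * partial_deriv i \<phi> x) = - (LINT x:\<Omega>|lebesgue. Dv x $ i * \<phi> x)"
    if t: "\<phi> \<in> test_functions \<Omega>" for \<phi> i
  proof -
    have "(LINT x:\<Omega>|lebesgue. v x * partial_deriv i \<phi> x) = (\<integral>x. v x * partial_deriv i \<phi> x \<partial>lebesgue)"
      by (rule set_integral_eq_integral) (simp add: test_zero_outside[OF test_partial[OF t]])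
    also have "\<dots> = - (\<integral>x. Dv x $ i * \<phi> x \<partial>lebesgue)"
      using assms test_mono[OF t subset_UNIV] by (simp add: wgrad_def)
    also have "(\<integral>x. Dv x $ i * \<phi> x \<partial>lebesgue) = (LINT x:\<Omega>|lebesgue. Dv x $ i * \<phi> x)"
      by (rule set_integral_eq_integral[symmetric]) (simp add: test_zero_outside[OF t])
    finally show ?thesis .
  qed
  then show ?thesis using assms loc[of v] loc[of Dv] by (simp add: weak_gradient_def wgrad_def)
qed

lemma integrable_test_mult_loc:
  assumes "v \<in> Lp_loc 1 \<Omega>" "\<zeta> \<in> test_functions \<Omega>"
  shows "integrable lebesgue (\<lambda>x. \<zeta> x *\<^sub>R v x)"
  using test_mult_Lp[OF assms] by (simp add: Lp_1_integrable)

lemma grad_test_nth: "grad \<zeta> x $ i = partial_deriv i \<zeta> x"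
  by (simp add: grad_def)

lemma integrable_mult_grad:
  assumes "v \<in> Lp_loc 1 \<Omega>" "\<zeta> \<in> test_functions \<Omega>"
  shows "integrable lebesgue (\<lambda>x. v x *\<^sub>R grad \<zeta> x)"
proof -
  have "(\<lambda>x. v x *\<^sub>R grad \<zeta> x) = (\<lambda>x. \<Sum>i\<in>UNIV. (partial_deriv i \<zeta> x *\<^sub>R v x) *\<^sub>R axis i 1)"
  proof
    fix x
    have "(\<Sum>i\<in>UNIV. (partial_deriv i \<zeta> x * v x) *\<^sub>R axis i 1) $ j = v x * partial_deriv j \<zeta> x" for j
      by (simp add: axis_def if_distrib cong: if_cong)
    then show "v x *\<^sub>R grad \<zeta> x = (\<Sum>i\<in>UNIV. (partial_deriv i \<zeta> x *\<^sub>R v x) *\<^sub>R axis i 1)"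
      by (simp add: vec_eq_iff grad_test_nth)
  qed
  moreover have "integrable lebesgue (\<lambda>x. (partial_deriv i \<zeta> x *\<^sub>R v x) *\<^sub>R axis i (1::real))" for i
    by (rule integrable_scaleR_left) (rule integrable_test_mult_loc[OF assms(1) test_partial[OF assms(2)]])
  ultimately show ?thesis by simp
qed

text \<open>The product rule, which at the same time passes from a domain to the whole space: for a test function \<open>\<psi>\<close> of the whole space, \<open>\<zeta> \<psi>\<close> is a test function of the domain.\<close>

lemma wgrad_test_mult:
  fixes u :: "real^'n \<Rightarrow> real"
  assumes wg: "weak_gradient \<Omega> u Du" and \<zeta>: "\<zeta> \<in> test_functions \<Omega>"
  shows "wgrad (\<lambda>x. \<zeta> x * u x) (\<lambda>x. \<zeta> x *\<^sub>R Du x + u x *\<^sub>R grad \<zeta> x)"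
  unfolding wgrad_def
proof (intro conjI ballI allI)
  have u: "u \<in> Lp_loc 1 \<Omega>" and Du: "Du \<in> Lp_loc 1 \<Omega>"
    and w: "\<And>\<phi> i. \<phi> \<in> test_functions \<Omega> \<Longrightarrow>
       (LINT x:\<Omega>|lebesgue. u x * partial_deriv i \<phi> x) = - (LINT x:\<Omega>|lebesgue. Du x $ i * \<phi> x)"
    using wg by (auto simp: weak_gradient_def)
  note iu = integrable_test_mult_loc[OF u]
  show "integrable lebesgue (\<lambda>x. \<zeta> x * u x)" using iu[OF \<zeta>] by simp
  have iDu: "integrable lebesgue (\<lambda>x. \<zeta> x *\<^sub>R Du x)" by (rule integrable_test_mult_loc[OF Du \<zeta>])
  show "integrable lebesgue (\<lambda>x. \<zeta> x *\<^sub>R Du x + u x *\<^sub>R grad \<zeta> x)"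
    by (intro Bochner_Integration.integrable_add iDu integrable_mult_grad[OF u \<zeta>])
  fix \<psi> :: "real^'n \<Rightarrow> real" and i assume \<psi>: "\<psi> \<in> test_functions UNIV"
  have t: "(\<lambda>x. \<zeta> x * \<psi> x) \<in> test_functions \<Omega>" by (rule test_mult_smooth[OF \<zeta> test_smooth[OF \<psi>]])
  have t1: "(\<lambda>x. \<zeta> x * partial_deriv i \<psi> x) \<in> test_functions \<Omega>"
    by (rule test_mult_smooth[OF \<zeta> smooth_partial[OF test_smooth[OF \<psi>]]])
  have t2: "(\<lambda>x. partial_deriv i \<zeta> x * \<psi> x) \<in> test_functions \<Omega>"
    by (rule test_mult_smooth[OF test_partial[OF \<zeta>] test_smooth[OF \<psi>]])
  have pd: "partial_deriv i (\<lambda>x. \<zeta> x * \<psi> x) x = \<zeta> x * partial_deriv i \<psi> x + partial_deriv i \<zeta> x * \<psi> x" for x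
    by (intro partial_deriv_mult smooth_differentiable test_smooth[OF \<zeta>] test_smooth[OF \<psi>])
  have i1: "integrable lebesgue (\<lambda>x. u x * (\<zeta> x * partial_deriv i \<psi> x))"
    using iu[OF t1] by (simp add: mult.commute)
  have i2: "integrable lebesgue (\<lambda>x. u x * (partial_deriv i \<zeta> x * \<psi> x))"
    using iu[OF t2] by (simp add: mult.commute)
  have i3: "integrable lebesgue (\<lambda>x. Du x $ i * (\<zeta> x * \<psi> x))"
    using integrable_vec_nth[OF integrable_test_mult_loc[OF Du t], of i] by (simp add: mult.commute)
  have "(\<integral>x. u x * (\<zeta> x * partial_deriv i \<psi> x) \<partial>lebesgue) + (\<integral>x. u x * (partial_deriv i \<zeta> x * \<psi> x) \<partial>lebesgue)
     = (\<integral>x. u x * partial_deriv i (\<lambda>x. \<zeta> x * \<psi> x) x \<partial>lebesgue)"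
    by (subst Bochner_Integration.integral_add[OF i1 i2, symmetric]) (simp add: pd distrib_left)
  also have "\<dots> = (LINT x:\<Omega>|lebesgue. u x * partial_deriv i (\<lambda>x. \<zeta> x * \<psi> x) x)"
    by (rule set_integral_eq_integral[symmetric]) (simp add: test_zero_outside[OF test_partial[OF t]])
  also have "\<dots> = - (LINT x:\<Omega>|lebesgue. Du x $ i * (\<zeta> x * \<psi> x))" by (rule w[OF t])
  also have "(LINT x:\<Omega>|lebesgue. Du x $ i * (\<zeta> x * \<psi> x)) = (\<integral>x. Du x $ i * (\<zeta> x * \<psi> x) \<partial>lebesgue)"
    by (rule set_integral_eq_integral) (simp add: test_zero_outside[OF \<zeta>])
  finally have "(\<integral>x. u x * (\<zeta> x * partial_deriv i \<psi> x) \<partial>lebesgue)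
     = - ((\<integral>x. Du x $ i * (\<zeta> x * \<psi> x) \<partial>lebesgue) + (\<integral>x. u x * (partial_deriv i \<zeta> x * \<psi> x) \<partial>lebesgue))"
    by linarith
  also have "\<dots> = - (\<integral>x. Du x $ i * (\<zeta> x * \<psi> x) + u x * (partial_deriv i \<zeta> x * \<psi> x) \<partial>lebesgue)"
    by (simp only: Bochner_Integration.integral_add[OF i3 i2])
  finally show "(\<integral>x. \<zeta> x * u x * partial_deriv i \<psi> x \<partial>lebesgue) =
       - (\<integral>x. (\<zeta> x *\<^sub>R Du x + u x *\<^sub>R grad \<zeta> x) $ i * \<psi> x \<partial>lebesgue)"
    by (simp add: grad_test_nth algebra_simps)
qed

lemma wgrad_diff:
  fixes v :: "real^'n \<Rightarrow> real"
  assumes "wgrad v Dv" "wgrad w Dw"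
  shows "wgrad (\<lambda>x. v x - w x) (\<lambda>x. Dv x - Dw x)"
  unfolding wgrad_def
proof (intro conjI ballI allI)
  fix \<psi> :: "real^'n \<Rightarrow> real" and i assume \<psi>: "\<psi> \<in> test_functions UNIV"
  have i: "integrable lebesgue v" "integrable lebesgue w" "integrable lebesgue Dv" "integrable lebesgue Dw"
    using assms by (auto simp: wgrad_def)
  note int = integrable_mult_test[OF i(1) test_partial[OF \<psi>]] integrable_mult_test[OF i(2) test_partial[OF \<psi>]]
    integrable_mult_test[OF integrable_vec_nth[OF i(3)] \<psi>] integrable_mult_test[OF integrable_vec_nth[OF i(4)] \<psi>]
  show "(\<integral>x. (v x - w x) * partial_deriv i \<psi> x \<partial>lebesgue) = - (\<integral>x. (Dv x - Dw x) $ i * \<psi> x \<partial>lebesgue)"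
    using assms \<psi> by (simp add: left_diff_distrib int wgrad_def)
qed (use assms in \<open>auto simp: wgrad_def\<close>)

lemma wgrad_shift:
  fixes v :: "real^'n \<Rightarrow> real"
  assumes "wgrad v Dv"
  shows "wgrad (\<lambda>x. v (x + a)) (\<lambda>x. Dv (x + a))"
  unfolding wgrad_def
proof (intro conjI ballI allI)
  have iv: "integrable lebesgue v" and iD: "integrable lebesgue Dv" using assms by (auto simp: wgrad_def)
  show "integrable lebesgue (\<lambda>x. v (x + a))" "integrable lebesgue (\<lambda>x. Dv (x + a))"
    using iv iD by (simp_all add: integrable_shift)
  fix \<psi> :: "real^'n \<Rightarrow> real" and i assume \<psi>: "\<psi> \<in> test_functions UNIV"
  let ?\<psi> = "\<lambda>x. \<psi> (x + - a)"
  have t: "?\<psi> \<in> test_functions UNIV" by (rule test_shift[OF \<psi>])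
  have pd: "partial_deriv i ?\<psi> x = partial_deriv i \<psi> (x + - a)" for x
    by (rule partial_deriv_shift) (rule smooth_differentiable[OF test_smooth[OF \<psi>]])
  have "(\<integral>x. v (x + a) * partial_deriv i \<psi> x \<partial>lebesgue) = (\<integral>x. v (x + a) * partial_deriv i ?\<psi> (x + a) \<partial>lebesgue)"
    unfolding pd by simp
  also have "\<dots> = (\<integral>x. v x * partial_deriv i ?\<psi> x \<partial>lebesgue)"
    by (rule integral_shift[of "\<lambda>x. v x * partial_deriv i ?\<psi> x"])
       (rule borel_measurable_integrable[OF integrable_mult_test[OF iv test_partial[OF t]]])
  also have "\<dots> = - (\<integral>x. Dv x $ i * ?\<psi> x \<partial>lebesgue)" using assms t by (simp add: wgrad_def)
  also have "(\<integral>x. Dv x $ i * ?\<psi> x \<partial>lebesgue) = (\<integral>x. Dv (x + a) $ i * ?\<psi> (x + a) \<partial>lebesgue)"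
    by (rule integral_shift[of "\<lambda>x. Dv x $ i * ?\<psi> x", symmetric])
       (rule borel_measurable_integrable[OF integrable_mult_test[OF integrable_vec_nth[OF iD] t]])
  finally show "(\<integral>x. v (x + a) * partial_deriv i \<psi> x \<partial>lebesgue) = - (\<integral>x. Dv (x + a) $ i * \<psi> x \<partial>lebesgue)"
    by simp
qed

lemma wgrad_unique:
  fixes v :: "real^'n \<Rightarrow> real"
  assumes "wgrad v D" "wgrad v D'"
  shows "AE x in lebesgue. D x = D' x"
proof -
  have i: "integrable lebesgue D" "integrable lebesgue D'" using assms by (auto simp: wgrad_def)
  have "AE x in lebesgue. D x $ j - D' x $ j = 0" for j
  proof (rule AE_zero_if_orthogonal_to_test_functions)
    show "integrable lebesgue (\<lambda>x. D x $ j - D' x $ j)"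
      using i by (intro Bochner_Integration.integrable_diff integrable_vec_nth)
    fix \<psi> :: "real^'n \<Rightarrow> real" assume \<psi>: "\<psi> \<in> test_functions UNIV"
    have "(\<integral>x. v x * partial_deriv j \<psi> x \<partial>lebesgue) = - (\<integral>x. E x $ j * \<psi> x \<partial>lebesgue)"
      if "wgrad v E" for E
      using that \<psi> by (simp add: wgrad_def)
    from this[OF assms(1)] this[OF assms(2)]
    have "(\<integral>x. D x $ j * \<psi> x \<partial>lebesgue) = (\<integral>x. D' x $ j * \<psi> x \<partial>lebesgue)"
      by linarith
    then show "(\<integral>x. (D x $ j - D' x $ j) * \<psi> x \<partial>lebesgue) = 0"
      by (simp add: left_diff_distrib integrable_mult_test[OF integrable_vec_nth[OF i(1)] \<psi>]
          integrable_mult_test[OF integrable_vec_nth[OF i(2)] \<psi>])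
  qed
  then have "AE x in lebesgue. \<forall>j\<in>UNIV. D x $ j - D' x $ j = 0" by (intro AE_finite_allI) auto
  then show ?thesis by eventually_elim (simp add: vec_eq_iff)
qed

lemma weak_gradient_unique:
  assumes "weak_gradient \<Omega> u D" "weak_gradient \<Omega> u D'" "open \<Omega>" "compact K" "K \<subseteq> \<Omega>"
  shows "AE x in lebesgue. x \<in> K \<longrightarrow> D x = D' x"
proof -
  obtain \<zeta> where \<zeta>: "\<zeta> \<in> test_functions \<Omega>" "\<And>x. x \<in> K \<Longrightarrow> 1 \<le> \<zeta> x"
    using exists_test_function_ge_1[OF assms(4,3,5)] by metis
  have "AE x in lebesgue. \<zeta> x *\<^sub>R D x + u x *\<^sub>R grad \<zeta> x = \<zeta> x *\<^sub>R D' x + u x *\<^sub>R grad \<zeta> x"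
    by (rule wgrad_unique[OF wgrad_test_mult[OF assms(1) \<zeta>(1)] wgrad_test_mult[OF assms(2) \<zeta>(1)]])
  then show ?thesis
    by eventually_elim (use \<zeta>(2) in force)
qed

text \<open>Membership in \<open>W1_loc\<close> only provides some weak gradient with the right integrability; by uniqueness every weak gradient has it.\<close>

lemma W1_loc_weak_gradient:
  assumes "u \<in> W1_loc m \<Omega>" "weak_gradient \<Omega> u Du" "open \<Omega>"
  shows "Du \<in> Lp_loc m \<Omega>"
  unfolding Lp_loc_def
proof (intro CollectI allI impI)
  fix K assume K: "compact K \<and> K \<subseteq> \<Omega>"
  obtain D where D: "D \<in> Lp_loc m \<Omega>" "weak_gradient \<Omega> u D" using assms(1) by (auto simp: W1_loc_def)
  have ae: "AE x in lebesgue. x \<in> K \<longrightarrow> Du x = D x"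
    using weak_gradient_unique[OF assms(2) D(2) assms(3)] K by blast
  show "Du \<in> Lp m K"
    by (rule Lp_AE_cong[OF _ ae]) (use D(1) K in \<open>simp add: Lp_loc_def\<close>)
qed

section \<open>Absolute continuity on lines and difference quotients\<close>

lemma grad_continuous: "smooth \<psi> \<Longrightarrow> continuous_on UNIV (grad \<psi>)"
  unfolding grad_def by (rule continuous_on_vec_lambda) (rule smooth_continuous[OF smooth_partial])

lemma smooth_line_integral:
  assumes "smooth \<psi>"
  shows "(\<integral>t. indicator {0..1} t * (grad \<psi> (y + t *\<^sub>R k) \<bullet> k) \<partial>lborel) = \<psi> (y + k) - \<psi> y"
proof -
  have "(\<integral>t. (grad \<psi> (y + t *\<^sub>R k) \<bullet> k) * indicator {0..1} t \<partial>lborel) = \<psi> (y + 1 *\<^sub>R k) - \<psi> (y + 0 *\<^sub>R k)"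
  proof (rule integral_FTC_Icc_real)
    fix t :: real
    have "((\<lambda>t. \<psi> (y + t *\<^sub>R k)) has_derivative (\<lambda>s. grad \<psi> (y + t *\<^sub>R k) \<bullet> (s *\<^sub>R k))) (at t)"
    proof (rule has_derivative_compose[where g=\<psi> and f="\<lambda>t. y + t *\<^sub>R k"])
      show "((\<lambda>t. y + t *\<^sub>R k) has_derivative (\<lambda>s. s *\<^sub>R k)) (at t)"
        by (auto intro!: derivative_eq_intros)
    qed (rule has_derivative_grad[OF assms])
    then show "DERIV (\<lambda>t. \<psi> (y + t *\<^sub>R k)) t :> grad \<psi> (y + t *\<^sub>R k) \<bullet> k"
      by (simp add: has_field_derivative_def mult_commute_abs)
    have "continuous_on UNIV (\<lambda>t. grad \<psi> (y + t *\<^sub>R k) \<bullet> k)"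
      by (intro continuous_intros continuous_on_compose2[OF grad_continuous[OF assms]]) auto
    then show "isCont (\<lambda>t. grad \<psi> (y + t *\<^sub>R k) \<bullet> k) t" by (simp add: continuous_on_eq_continuous_at)
  qed simp
  then show ?thesis by (simp add: mult.commute)
qed

lemma lborel_integrable_shift:
  fixes f :: "'a::euclidean_space \<Rightarrow> real"
  assumes "integrable lborel f" shows "integrable lborel (\<lambda>x. f (x + a))"
  using integrable_distr[of "(+) a" lborel borel f] assms lborel_distr_plus[of a] by (simp add: add.commute)

lemma lborel_integral_shift:
  fixes f :: "'a::euclidean_space \<Rightarrow> real"
  assumes "f \<in> borel_measurable borel" shows "(\<integral>x. f (x + a) \<partial>lborel) = (\<integral>x. f x \<partial>lborel)"
  using integral_distr[of "(+) a" lborel borel f] assms lborel_distr_plus[of a] by (simp add: add.commute)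

lemma lborel_nn_integral_shift:
  fixes f :: "'a::euclidean_space \<Rightarrow> ennreal"
  assumes "f \<in> borel_measurable borel" shows "(\<integral>\<^sup>+x. f (x + a) \<partial>lborel) = (\<integral>\<^sup>+x. f x \<partial>lborel)"
  using nn_integral_distr[of "(+) a" lborel borel f] assms lborel_distr_plus[of a] by (simp add: add.commute)

text \<open>Measurability in both variables jointly is the reason for working with Borel functions here.\<close>

lemma integrable_translates:
  fixes g :: "real^'n \<Rightarrow> real"
  assumes "integrable lborel g"
  shows "integrable (lborel \<Otimes>\<^sub>M lborel) (\<lambda>(t::real, x). indicator {0..1} t * g (x + t *\<^sub>R k))"
proof -
  have [measurable]: "g \<in> borel_measurable borel" using borel_measurable_integrable[OF assms] by simp
  show ?thesis
  proof (rule lborel_pair.Fubini_integrable)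
    show "(\<lambda>(t::real, x). indicator {0..1} t * g (x + t *\<^sub>R k)) \<in> borel_measurable (lborel \<Otimes>\<^sub>M lborel)"
      by measurable
    have "(\<integral>x. norm (indicator {0..1} t * g (x + t *\<^sub>R k)) \<partial>lborel) = indicator {0..1} t * (\<integral>x. norm (g x) \<partial>lborel)" for t :: real
      using lborel_integral_shift[of "\<lambda>x. norm (g x)" "t *\<^sub>R k"] by (simp add: abs_mult)
    then show "integrable lborel (\<lambda>t::real. \<integral>x. norm (case (t, x) of (t, x) \<Rightarrow> indicator {0..1} t * g (x + t *\<^sub>R k)) \<partial>lborel)"
      by simp
    show "AE t::real in lborel. integrable lborel (\<lambda>x. case (t, x) of (t, x) \<Rightarrow> indicator {0..1} t * g (x + t *\<^sub>R k))"
      using lborel_integrable_shift[OF assms] by simp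
  qed
qed

text \<open>Both sides have the same integral against every test function \<open>\<psi>\<close>. Fubini's theorem moves the shift by \<open>t h\<close> from \<open>g\<close> to \<open>\<psi>\<close>, the weak derivative then falls on the shifted \<open>\<psi>\<close>, and a second use of Fubini's theorem integrates the derivative of \<open>\<psi>\<close> along the segment.\<close>

lemma weak_directional_ftc:
  fixes U g :: "real^'n \<Rightarrow> real"
  assumes U: "integrable lborel U" and g: "integrable lborel g"
    and weak: "\<And>\<psi>. \<psi> \<in> test_functions UNIV \<Longrightarrow>
        (\<integral>x. U x * (grad \<psi> x \<bullet> h) \<partial>lborel) = - (\<integral>x. g x * \<psi> x \<partial>lborel)"
  shows "AE x in lborel. U (x + h) - U x = (\<integral>t. indicator {0..1} t * g (x + t *\<^sub>R h) \<partial>lborel)"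
proof -
  define S where "S x = (\<integral>t. indicator {0..1} t * g (x + t *\<^sub>R h) \<partial>lborel)" for x
  have Ub [measurable]: "U \<in> borel_measurable borel" and gb [measurable]: "g \<in> borel_measurable borel"
    using borel_measurable_integrable[OF U] borel_measurable_integrable[OF g] by simp_all
  note tg = integrable_translates[OF g, of h]
  have S: "integrable lborel S"
    unfolding S_def using lborel_pair.integrable_snd[OF tg] by simp
  have Uh: "integrable lborel (\<lambda>x. U (x + h))" by (rule lborel_integrable_shift[OF U])
  define W where "W x = U (x + h) - U x - S x" for x
  have W: "integrable lborel W" unfolding W_def by (intro Bochner_Integration.integrable_diff Uh U S)
  have orth: "(\<integral>x. W x * \<psi> x \<partial>lborel) = 0" if \<psi>: "\<psi> \<in> test_functions UNIV" for \<psi>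
  proof -
    have [measurable]: "\<psi> \<in> borel_measurable borel" by (rule test_borel[OF \<psi>])
    have [measurable]: "grad \<psi> \<in> borel_measurable borel" by (rule grad_borel[OF test_smooth[OF \<psi>]])
    obtain B where B: "\<And>x. \<bar>\<psi> x\<bar> \<le> B" using test_bounded[OF \<psi>] by blast
    obtain B' where B': "\<And>x. norm (grad \<psi> x) \<le> B'" using test_grad_bounded[OF \<psi>] by blast
    have i\<psi>: "integrable lborel (\<lambda>x. f x * \<psi> x)" if "integrable lborel f" for f
      by (rule integrable_bounded_mult[OF that _ B]) simp
    have K: "integrable (lborel \<Otimes>\<^sub>M lborel) (\<lambda>(t::real, x). indicator {0..1} t * g (x + t *\<^sub>R h) * \<psi> x)"
      using integrable_bounded_mult[OF tg, of "\<lambda>(t, x). \<psi> x" B] B by (simp add: case_prod_unfold)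
    have L: "integrable (lborel \<Otimes>\<^sub>M lborel) (\<lambda>(t::real, x). indicator {0..1} t * U x * (grad \<psi> (x + t *\<^sub>R (- h)) \<bullet> h))"
    proof -
      have "\<bar>grad \<psi> (x + t *\<^sub>R (- h)) \<bullet> h\<bar> \<le> B' * norm h" for x t
        using Cauchy_Schwarz_ineq2[of "grad \<psi> (x + t *\<^sub>R (- h))" h]
          mult_right_mono[OF B'[of "x + t *\<^sub>R (- h)"], of "norm h"] by simp
      then show ?thesis
        using integrable_bounded_mult[OF integrable_translates[OF U, of 0], of "\<lambda>(t, x). grad \<psi> (x + t *\<^sub>R (- h)) \<bullet> h" "B' * norm h"]
        by (simp add: case_prod_unfold)
    qed
    have "(\<integral>x. S x * \<psi> x \<partial>lborel) = (\<integral>x. (\<integral>t. indicator {0..1} t * g (x + t *\<^sub>R h) * \<psi> x \<partial>lborel) \<partial>lborel)"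
      unfolding S_def by simp
    also have "\<dots> = (\<integral>t. (\<integral>x. indicator {0..1} t * g (x + t *\<^sub>R h) * \<psi> x \<partial>lborel) \<partial>lborel)"
      by (rule lborel_pair.Fubini_integral[OF K])
    also have "\<dots> = (\<integral>t. (\<integral>x. - (indicator {0..1} t * U x * (grad \<psi> (x + t *\<^sub>R (- h)) \<bullet> h)) \<partial>lborel) \<partial>lborel)"
    proof (rule Bochner_Integration.integral_cong[OF refl])
      fix t :: real
      let ?\<psi> = "\<lambda>x. \<psi> (x + - (t *\<^sub>R h))"
      have gr: "grad ?\<psi> x = grad \<psi> (x + t *\<^sub>R (- h))" for x
        by (simp only: grad_def partial_deriv_shift[OF smooth_differentiable[OF test_smooth[OF \<psi>]]]) simp
      have "(\<integral>x. g (x + t *\<^sub>R h) * \<psi> x \<partial>lborel) = (\<integral>x. g (x + t *\<^sub>R h) * ?\<psi> (x + t *\<^sub>R h) \<partial>lborel)"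
        by simp
      also have "\<dots> = (\<integral>x. g x * ?\<psi> x \<partial>lborel)"
        by (rule lborel_integral_shift[of "\<lambda>x. g x * ?\<psi> x"]) measurable
      also have "\<dots> = - (\<integral>x. U x * (grad \<psi> (x + t *\<^sub>R (- h)) \<bullet> h) \<partial>lborel)"
        using weak[OF test_shift[OF \<psi>, of "- (t *\<^sub>R h)"]] unfolding gr by simp
      finally show "(\<integral>x. indicator {0..1} t * g (x + t *\<^sub>R h) * \<psi> x \<partial>lborel) =
         (\<integral>x. - (indicator {0..1} t * U x * (grad \<psi> (x + t *\<^sub>R (- h)) \<bullet> h)) \<partial>lborel)"
        by (simp add: mult.assoc)
    qed
    also have "\<dots> = - (\<integral>t. (\<integral>x. indicator {0..1} t * U x * (grad \<psi> (x + t *\<^sub>R (- h)) \<bullet> h) \<partial>lborel) \<partial>lborel)"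
      by simp
    also have "\<dots> = - (\<integral>x. (\<integral>t. indicator {0..1} t * U x * (grad \<psi> (x + t *\<^sub>R (- h)) \<bullet> h) \<partial>lborel) \<partial>lborel)"
      by (subst lborel_pair.Fubini_integral[OF L]) simp
    also have "\<dots> = - (\<integral>x. U x * (\<psi> x - \<psi> (x + - h)) \<partial>lborel)"
    proof -
      have "(\<integral>t. indicator {0..1} t * U x * (grad \<psi> (x + t *\<^sub>R (- h)) \<bullet> h) \<partial>lborel) = U x * (\<psi> x - \<psi> (x + - h))" for x
      proof -
        have "(\<integral>t. indicator {0..1} t * U x * (grad \<psi> (x + t *\<^sub>R (- h)) \<bullet> h) \<partial>lborel)
          = (\<integral>t. - U x * (indicator {0..1} t * (grad \<psi> (x + t *\<^sub>R (- h)) \<bullet> (- h))) \<partial>lborel)"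
          by (simp add: mult_ac)
        also have "\<dots> = - U x * (\<integral>t. indicator {0..1} t * (grad \<psi> (x + t *\<^sub>R (- h)) \<bullet> (- h)) \<partial>lborel)"
          by (rule integral_mult_right_zero)
        also have "\<dots> = - U x * (\<psi> (x + - h) - \<psi> x)"
          by (simp only: smooth_line_integral[OF test_smooth[OF \<psi>]])
        finally show ?thesis by (simp add: algebra_simps)
      qed
      then show ?thesis by simp
    qed
    also have "\<dots> = (\<integral>x. U x * \<psi> (x + - h) \<partial>lborel) - (\<integral>x. U x * \<psi> x \<partial>lborel)"
    proof -
      have "integrable lborel (\<lambda>x. U x * \<psi> (x + - h))" by (rule integrable_bounded_mult[OF U _ B]) measurable
      then show ?thesis using i\<psi>[OF U] by (simp add: right_diff_distrib)
    qed
    also have "(\<integral>x. U x * \<psi> (x + - h) \<partial>lborel) = (\<integral>x. U (x + h) * \<psi> x \<partial>lborel)"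
    proof -
      have "(\<integral>x. U (x + h) * \<psi> (x + h + - h) \<partial>lborel) = (\<integral>x. U x * \<psi> (x + - h) \<partial>lborel)"
        by (rule lborel_integral_shift[of "\<lambda>x. U x * \<psi> (x + - h)"]) measurable
      then show ?thesis by simp
    qed
    finally show ?thesis
      using i\<psi>[OF Uh] i\<psi>[OF U] i\<psi>[OF S] by (simp add: W_def left_diff_distrib)
  qed
  have Wb: "W \<in> borel_measurable borel" using borel_measurable_integrable[OF W] by simp
  have "AE x in lebesgue. W x = 0"
  proof (rule AE_zero_if_orthogonal_to_test_functions)
    show "integrable lebesgue W" using W Wb by (simp add: integrable_completion)
    show "(\<integral>x. W x * \<psi> x \<partial>lebesgue) = 0" if "\<psi> \<in> test_functions UNIV" for \<psi>
      using orth[OF that] Wb test_borel[OF that] by (subst integral_completion) simp_all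
  qed
  then have "AE x in lborel. W x = 0" by (simp only: AE_completion_iff)
  then show ?thesis by eventually_elim (simp add: W_def S_def)
qed

text \<open>A convex power lies above its tangent at \<open>c\<close>; this is Young's inequality for \<open>s\<close> and \<open>c powr (q-1)\<close>.\<close>

lemma powr_tangent_le:
  fixes s c q :: real
  assumes "1 < q" "0 \<le> s" "0 \<le> c"
  shows "c powr q + q * c powr (q - 1) * (s - c) \<le> s powr q"
proof -
  define p where "p = q / (q - 1)"
  have p: "1 < p" "1/q + 1/p = 1" "(q - 1) * p = q" using assms by (auto simp: p_def field_simps)
  have "s * c powr (q - 1) \<le> s powr q / q + (c powr (q - 1)) powr p / p"
    using assms p by (intro Youngs_inequality) auto
  also have "(c powr (q - 1)) powr p = c powr q" using p by (simp add: powr_powr)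
  finally have "q * (s * c powr (q - 1)) \<le> q * (s powr q / q + c powr q / p)"
    using assms by (intro mult_left_mono) auto
  also have "\<dots> = s powr q + (q - 1) * c powr q"
    using assms by (simp add: p_def field_simps)
  finally have "q * (s * c powr (q - 1)) \<le> s powr q + (q - 1) * c powr q" .
  moreover have "c powr q = c powr (q - 1) * c"
    using assms powr_add[of c "q - 1" 1] by (cases "c = 0") auto
  ultimately show ?thesis by (simp add: algebra_simps)
qed

text \<open>Integration of the tangent inequality at \<open>c = \<integral> |f|\<close>, whose linear part has integral \<open>0\<close>. The right-hand side may be infinite.\<close>

lemma jensen_unit_interval:
  fixes f :: "real \<Rightarrow> real"
  assumes [measurable]: "f \<in> borel_measurable borel" and q: "1 < q"
  shows "ennreal (\<bar>\<integral>t. indicator {0..1} t * f t \<partial>lborel\<bar> powr q) \<le> (\<integral>\<^sup>+t. ennreal (indicator {0..1} t * \<bar>f t\<bar> powr q) \<partial>lborel)"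
proof (cases "integrable lborel (\<lambda>t. indicator {0..1} t * f t) \<and> integrable lborel (\<lambda>t. indicator {0..1} t * \<bar>f t\<bar> powr q)")
  case True
  then have i: "integrable lborel (\<lambda>t. indicator {0..1} t * f t)" "integrable lborel (\<lambda>t. indicator {0..1} t * \<bar>f t\<bar> powr q)"
    by auto
  have ia: "integrable lborel (\<lambda>t. indicator {0..1} t * \<bar>f t\<bar>)" using integrable_abs[OF i(1)] by (simp add: abs_mult)
  define c where "c = (\<integral>t. indicator {0..1} t * \<bar>f t\<bar> \<partial>lborel)"
  have c: "0 \<le> c" unfolding c_def by (intro integral_nonneg_AE) simp
  have i1: "integrable lborel (indicator {0..1::real} :: real \<Rightarrow> real)" by simp
  have m1: "(\<integral>t. indicator {0..1::real} t \<partial>lborel) = (1::real)" by simp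
  have i2: "integrable lborel (\<lambda>t. (c powr q - q * c powr (q - 1) * c) * indicator {0..1} t + q * c powr (q - 1) * (indicator {0..1} t * \<bar>f t\<bar>))"
    by (intro Bochner_Integration.integrable_add integrable_mult_right ia i1)
  have "\<bar>\<integral>t. indicator {0..1} t * f t \<partial>lborel\<bar> \<le> c"
    using integral_abs_bound[of lborel "\<lambda>t. indicator {0..1} t * f t"] by (simp add: c_def abs_mult)
  then have "\<bar>\<integral>t. indicator {0..1} t * f t \<partial>lborel\<bar> powr q \<le> c powr q"
    using q by (intro powr_mono2) auto
  also have "c powr q = (c powr q - q * c powr (q - 1) * c) * (\<integral>t. indicator {0..1::real} t \<partial>lborel) + q * c powr (q - 1) * c"
    by (simp add: content_real)
  also have "\<dots> = (\<integral>t. (c powr q - q * c powr (q - 1) * c) * indicator {0..1} t + q * c powr (q - 1) * (indicator {0..1} t * \<bar>f t\<bar>) \<partial>lborel)"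
    using ia i1 by (subst Bochner_Integration.integral_add) (simp_all add: c_def)
  also have "\<dots> \<le> (\<integral>t. indicator {0..1} t * \<bar>f t\<bar> powr q \<partial>lborel)"
  proof (rule integral_mono[OF i2 i(2)])
    fix t
    show "(c powr q - q * c powr (q - 1) * c) * indicator {0..1} t + q * c powr (q - 1) * (indicator {0..1} t * \<bar>f t\<bar>)
      \<le> indicator {0..1} t * \<bar>f t\<bar> powr q"
      using powr_tangent_le[OF q abs_ge_zero c, of "f t"] by (auto simp: indicator_def algebra_simps)
  qed
  also have "ennreal (\<integral>t. indicator {0..1} t * \<bar>f t\<bar> powr q \<partial>lborel) = (\<integral>\<^sup>+t. ennreal (indicator {0..1} t * \<bar>f t\<bar> powr q) \<partial>lborel)"
    by (rule nn_integral_eq_integral[OF i(2), symmetric]) simp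
  finally show ?thesis by (simp add: ennreal_leI)
next
  case False
  show ?thesis
  proof (cases "integrable lborel (\<lambda>t. indicator {0..1} t * f t)")
    case True
    with False have "\<not> integrable lborel (\<lambda>t. indicator {0..1} t * \<bar>f t\<bar> powr q)" by simp
    then have "\<not> (\<integral>\<^sup>+t. ennreal (indicator {0..1} t * \<bar>f t\<bar> powr q) \<partial>lborel) < \<infinity>"
      by (rule contrapos_nn) (intro integrableI_nonneg, auto)
    then show ?thesis by (simp add: not_less top_unique)
  next
    case False
    then show ?thesis by (simp add: not_integrable_integral_eq)
  qed
qed

text \<open>Jensen's inequality for the line integral of \<open>g\<close>, followed by Tonelli's theorem: for each \<open>t\<close> in the unit interval the translate of the small ball by \<open>t h\<close> lies in the large one.\<close>

lemma difference_quotient_nn: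
  fixes U g :: "real^'n \<Rightarrow> real"
  assumes U: "integrable lborel U" and g: "integrable lborel g"
    and weak: "\<And>\<psi>. \<psi> \<in> test_functions UNIV \<Longrightarrow>
        (\<integral>x. U x * (grad \<psi> x \<bullet> h) \<partial>lborel) = - (\<integral>x. g x * \<psi> x \<partial>lborel)"
    and q: "1 < q"
  shows "(\<integral>\<^sup>+x. ennreal (indicator (ball z r) x * \<bar>U (x + h) - U x\<bar> powr q) \<partial>lborel)
     \<le> (\<integral>\<^sup>+x. ennreal (indicator (ball z (r + norm h)) x * \<bar>g x\<bar> powr q) \<partial>lborel)" (is "?L \<le> ?R")
proof -
  have [measurable]: "U \<in> borel_measurable borel" and [measurable]: "g \<in> borel_measurable borel"
    using borel_measurable_integrable[OF U] borel_measurable_integrable[OF g] by simp_all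
  have [measurable]: "ball z s \<in> sets borel" for s by simp
  let ?B = "\<lambda>x. indicator (ball z r) x :: real" and ?B' = "\<lambda>x. indicator (ball z (r + norm h)) x :: real"
  have "?L \<le> (\<integral>\<^sup>+x. (\<integral>\<^sup>+t. ennreal (?B x * (indicator {0..1} t * \<bar>g (x + t *\<^sub>R h)\<bar> powr q)) \<partial>lborel) \<partial>lborel)"
  proof (rule nn_integral_mono_AE)
    have ae: "AE x in lborel. U (x + h) - U x = (\<integral>t. indicator {0..1} t * g (x + t *\<^sub>R h) \<partial>lborel)"
      by (rule weak_directional_ftc[OF U g weak])
    show "AE x in lborel. ennreal (?B x * \<bar>U (x + h) - U x\<bar> powr q)
        \<le> (\<integral>\<^sup>+t. ennreal (?B x * (indicator {0..1} t * \<bar>g (x + t *\<^sub>R h)\<bar> powr q)) \<partial>lborel)"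
      using ae
    proof eventually_elim
      case (elim x)
      have "ennreal (\<bar>U (x + h) - U x\<bar> powr q) \<le> (\<integral>\<^sup>+t. ennreal (indicator {0..1} t * \<bar>g (x + t *\<^sub>R h)\<bar> powr q) \<partial>lborel)"
        unfolding elim by (rule jensen_unit_interval[OF _ q]) measurable
      then show ?case by (simp add: indicator_def)
    qed
  qed
  also have "\<dots> = (\<integral>\<^sup>+t. (\<integral>\<^sup>+x. ennreal (?B x * (indicator {0..1} t * \<bar>g (x + t *\<^sub>R h)\<bar> powr q)) \<partial>lborel) \<partial>lborel)"
  proof (rule lborel_pair.Fubini')
    have m: "(\<lambda>(t, x). g (x + t *\<^sub>R h)) \<in> borel_measurable (lborel \<Otimes>\<^sub>M lborel)" by measurable
    have "(\<lambda>(t, x). ?B x * (indicator {0..1::real} t * \<bar>g (x + t *\<^sub>R h)\<bar> powr q)) \<in> borel_measurable (lborel \<Otimes>\<^sub>M lborel)"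
      unfolding case_prod_unfold
      by (intro borel_measurable_times borel_measurable_indicator' powr_real_measurable borel_measurable_abs
          m[unfolded case_prod_unfold] borel_measurable_const) measurable
    then show "(\<lambda>(t, x). ennreal (?B x * (indicator {0..1} t * \<bar>g (x + t *\<^sub>R h)\<bar> powr q))) \<in> borel_measurable (lborel \<Otimes>\<^sub>M lborel)"
      by (simp add: case_prod_unfold measurable_compose[OF _ measurable_ennreal])
  qed
  also have "\<dots> \<le> (\<integral>\<^sup>+t. indicator {0..1::real} t * ?R \<partial>lborel)"
  proof (rule nn_integral_mono)
    fix t :: real
    have "(\<integral>\<^sup>+x. ennreal (?B x * (indicator {0..1} t * \<bar>g (x + t *\<^sub>R h)\<bar> powr q)) \<partial>lborel)
       \<le> (\<integral>\<^sup>+x. indicator {0..1} t * ennreal (?B' (x + t *\<^sub>R h) * \<bar>g (x + t *\<^sub>R h)\<bar> powr q) \<partial>lborel)"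
    proof (rule nn_integral_mono)
      fix x :: "real^'n"
      have "x + t *\<^sub>R h \<in> ball z (r + norm h)" if "x \<in> ball z r" "t \<in> {0..1}"
      proof -
        have "norm (x + t *\<^sub>R h - z) \<le> norm (x - z) + norm (t *\<^sub>R h)"
          using norm_triangle_ineq[of "x - z" "t *\<^sub>R h"] by (simp add: algebra_simps)
        moreover have "norm (t *\<^sub>R h) \<le> 1 * norm h" using that by (simp add: mult_left_le_one_le)
        ultimately show ?thesis using that by (simp add: dist_norm norm_minus_commute)
      qed
      then show "ennreal (?B x * (indicator {0..1} t * \<bar>g (x + t *\<^sub>R h)\<bar> powr q))
        \<le> indicator {0..1} t * ennreal (?B' (x + t *\<^sub>R h) * \<bar>g (x + t *\<^sub>R h)\<bar> powr q)"
        by (auto simp: indicator_def)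
    qed
    also have "\<dots> = indicator {0..1} t * (\<integral>\<^sup>+x. ennreal (?B' (x + t *\<^sub>R h) * \<bar>g (x + t *\<^sub>R h)\<bar> powr q) \<partial>lborel)"
      by (rule nn_integral_cmult) measurable
    also have "(\<integral>\<^sup>+x. ennreal (?B' (x + t *\<^sub>R h) * \<bar>g (x + t *\<^sub>R h)\<bar> powr q) \<partial>lborel) = ?R"
      by (rule lborel_nn_integral_shift[of "\<lambda>x. ennreal (?B' x * \<bar>g x\<bar> powr q)"]) measurable
    finally show "(\<integral>\<^sup>+x. ennreal (?B x * (indicator {0..1} t * \<bar>g (x + t *\<^sub>R h)\<bar> powr q)) \<partial>lborel) \<le> indicator {0..1} t * ?R" .
  qed
  also have "\<dots> = ?R" by (simp add: nn_integral_multc)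
  finally show ?thesis .
qed

lemma wgrad_directional:
  assumes "wgrad U G" "\<psi> \<in> test_functions UNIV"
  shows "(\<integral>x. U x * (grad \<psi> x \<bullet> h) \<partial>lebesgue) = - (\<integral>x. (G x \<bullet> h) * \<psi> x \<partial>lebesgue)"
proof -
  have i: "integrable lebesgue U" "integrable lebesgue G" using assms by (auto simp: wgrad_def)
  note i1 = integrable_mult_test[OF i(1) test_partial[OF assms(2)]]
  note i2 = integrable_mult_test[OF integrable_vec_nth[OF i(2)] assms(2)]
  have "(\<integral>x. U x * (grad \<psi> x \<bullet> h) \<partial>lebesgue) = (\<integral>x. (\<Sum>j\<in>UNIV. h $ j * (U x * partial_deriv j \<psi> x)) \<partial>lebesgue)"
    by (simp add: inner_vec_def grad_test_nth sum_distrib_left mult_ac)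
  also have "\<dots> = (\<Sum>j\<in>UNIV. h $ j * (\<integral>x. U x * partial_deriv j \<psi> x \<partial>lebesgue))"
    using i1 by (subst Bochner_Integration.integral_sum) simp_all
  also have "\<dots> = - (\<Sum>j\<in>UNIV. h $ j * (\<integral>x. G x $ j * \<psi> x \<partial>lebesgue))"
    using assms by (simp add: wgrad_def sum_negf)
  also have "(\<Sum>j\<in>UNIV. h $ j * (\<integral>x. G x $ j * \<psi> x \<partial>lebesgue)) = (\<integral>x. (\<Sum>j\<in>UNIV. h $ j * (G x $ j * \<psi> x)) \<partial>lebesgue)"
    using i2 by (subst Bochner_Integration.integral_sum) simp_all
  also have "\<dots> = (\<integral>x. (G x \<bullet> h) * \<psi> x \<partial>lebesgue)"
    by (simp add: inner_vec_def sum_distrib_left sum_distrib_right mult_ac)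
  finally show ?thesis .
qed

lemma borel_representative:
  fixes f :: "'a::euclidean_space \<Rightarrow> real"
  assumes "integrable lebesgue f"
  obtains f' where "f' \<in> borel_measurable borel" "integrable lborel f'" "AE x in lebesgue. f x = f' x"
proof -
  obtain f' where f': "f' \<in> borel_measurable lborel" "AE x in lborel. f x = f' x"
    using completion_ex_borel_measurable_real[OF borel_measurable_integrable[OF assms]] by blast
  have ae: "AE x in lebesgue. f x = f' x" using f'(2) by (rule AE_completion)
  have "integrable lebesgue f'"
    by (rule integrable_cong_AE_imp[OF assms _ ]) (use f'(1) ae in \<open>auto intro: measurable_completion elim: eventually_mono\<close>)
  then show ?thesis using that[of f'] f' ae by (simp add: integrable_completion)
qed

text \<open>The preceding bound for Borel representatives of \<open>U\<close> and of the directional derivative \<open>G \<bullet> h\<close>.\<close>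

theorem difference_quotient_bound:
  fixes U :: "real^'n \<Rightarrow> real"
  assumes wg: "wgrad U G" and q: "1 < q"
    and G: "set_integrable lebesgue (ball z (r + norm h)) (\<lambda>x. norm (G x) powr q)"
  shows "set_integrable lebesgue (ball z r) (\<lambda>x. \<bar>U (x + h) - U x\<bar> powr q)"
    and "(LINT x:ball z r|lebesgue. \<bar>U (x + h) - U x\<bar> powr q)
      \<le> norm h powr q * (LINT x:ball z (r + norm h)|lebesgue. norm (G x) powr q)"
proof -
  have iU: "integrable lebesgue U" and iG: "integrable lebesgue G" using wg by (auto simp: wgrad_def)
  have iGh: "integrable lebesgue (\<lambda>x. G x \<bullet> h)" using iG by (rule integrable_inner_left[rotated]) 
  obtain u where u: "u \<in> borel_measurable borel" "integrable lborel u" "AE x in lebesgue. U x = u x"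
    using borel_representative[OF iU] by blast
  obtain g where g: "g \<in> borel_measurable borel" "integrable lborel g" "AE x in lebesgue. G x \<bullet> h = g x"
    using borel_representative[OF iGh] by blast
  have weak: "(\<integral>x. u x * (grad \<psi> x \<bullet> h) \<partial>lborel) = - (\<integral>x. g x * \<psi> x \<partial>lborel)"
    if \<psi>: "\<psi> \<in> test_functions UNIV" for \<psi>
  proof -
    have [measurable]: "\<psi> \<in> borel_measurable borel" "grad \<psi> \<in> borel_measurable borel"
      by (rule test_borel[OF \<psi>], rule grad_borel[OF test_smooth[OF \<psi>]])
    have m1: "(\<lambda>x. u x * (grad \<psi> x \<bullet> h)) \<in> borel_measurable borel" and m2: "(\<lambda>x. g x * \<psi> x) \<in> borel_measurable borel"
      using u(1) g(1) by measurable
    have mg: "(\<lambda>x. grad \<psi> x \<bullet> h) \<in> borel_measurable lebesgue" by (rule measurable_completion) simp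
    have "(\<integral>x. u x * (grad \<psi> x \<bullet> h) \<partial>lborel) = (\<integral>x. u x * (grad \<psi> x \<bullet> h) \<partial>lebesgue)"
      using m1 by (simp add: integral_completion)
    also have "\<dots> = (\<integral>x. U x * (grad \<psi> x \<bullet> h) \<partial>lebesgue)"
    proof (rule integral_cong_AE)
      show "(\<lambda>x. u x * (grad \<psi> x \<bullet> h)) \<in> borel_measurable lebesgue" by (rule measurable_completion) (use m1 in simp)
      show "(\<lambda>x. U x * (grad \<psi> x \<bullet> h)) \<in> borel_measurable lebesgue"
        by (rule borel_measurable_times[OF borel_measurable_integrable[OF iU] mg])
    qed (use u(3) in \<open>auto elim: eventually_mono\<close>)
    also have "\<dots> = - (\<integral>x. (G x \<bullet> h) * \<psi> x \<partial>lebesgue)" by (rule wgrad_directional[OF wg \<psi>])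
    also have "(\<integral>x. (G x \<bullet> h) * \<psi> x \<partial>lebesgue) = (\<integral>x. g x * \<psi> x \<partial>lebesgue)"
    proof (rule integral_cong_AE)
      show "(\<lambda>x. g x * \<psi> x) \<in> borel_measurable lebesgue" by (rule measurable_completion) (use m2 in simp)
      show "(\<lambda>x. (G x \<bullet> h) * \<psi> x) \<in> borel_measurable lebesgue"
        by (rule borel_measurable_times[OF borel_measurable_integrable[OF iGh] test_lebesgue[OF \<psi>]])
    qed (use g(3) in \<open>auto elim: eventually_mono\<close>)
    also have "\<dots> = (\<integral>x. g x * \<psi> x \<partial>lborel)" using m2 by (simp add: integral_completion)
    finally show ?thesis .
  qed
  let ?B = "\<lambda>x. indicator (ball z r) x :: real" and ?B' = "\<lambda>x. indicator (ball z (r + norm h)) x :: real"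
  have iG': "integrable lebesgue (\<lambda>x. ?B' x * norm (G x) powr q)"
    using G by (simp add: set_integrable_def)
  have iG'': "integrable lebesgue (\<lambda>x. norm h powr q * (?B' x * norm (G x) powr q))"
    by (rule integrable_mult_right) (use iG' in simp)
  have "(\<integral>\<^sup>+x. ennreal (?B x * \<bar>U (x + h) - U x\<bar> powr q) \<partial>lebesgue) = (\<integral>\<^sup>+x. ennreal (?B x * \<bar>u (x + h) - u x\<bar> powr q) \<partial>lebesgue)"
    by (rule nn_integral_cong_AE) (use AE_shift[OF u(3), of h] u(3) in eventually_elim, simp)
  also have "\<dots> = (\<integral>\<^sup>+x. ennreal (?B x * \<bar>u (x + h) - u x\<bar> powr q) \<partial>lborel)"
    by (rule nn_integral_completion)
  also have "\<dots> \<le> (\<integral>\<^sup>+x. ennreal (?B' x * \<bar>g x\<bar> powr q) \<partial>lborel)"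
    by (rule difference_quotient_nn[OF u(2) g(2) weak q])
  also have "\<dots> = (\<integral>\<^sup>+x. ennreal (?B' x * \<bar>g x\<bar> powr q) \<partial>lebesgue)"
    by (rule nn_integral_completion[symmetric])
  also have "\<dots> \<le> (\<integral>\<^sup>+x. ennreal (norm h powr q * (?B' x * norm (G x) powr q)) \<partial>lebesgue)"
  proof (rule nn_integral_mono_AE)
    show "AE x in lebesgue. ennreal (?B' x * \<bar>g x\<bar> powr q) \<le> ennreal (norm h powr q * (?B' x * norm (G x) powr q))"
      using g(3)
    proof eventually_elim
      case (elim x)
      have "\<bar>g x\<bar> powr q \<le> (norm h * norm (G x)) powr q"
        using Cauchy_Schwarz_ineq2[of "G x" h] elim q by (intro powr_mono2) (auto simp: mult.commute)
      then show ?case by (auto simp: indicator_def powr_mult intro!: ennreal_leI)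
    qed
  qed
  also have "\<dots> = ennreal (\<integral>x. norm h powr q * (?B' x * norm (G x) powr q) \<partial>lebesgue)"
    by (rule nn_integral_eq_integral[OF iG'']) simp
  finally have nn: "(\<integral>\<^sup>+x. ennreal (?B x * \<bar>U (x + h) - U x\<bar> powr q) \<partial>lebesgue)
      \<le> ennreal (norm h powr q * (\<integral>x. ?B' x * norm (G x) powr q \<partial>lebesgue))" by simp
  have mU: "(\<lambda>x. ?B x * \<bar>U (x + h) - U x\<bar> powr q) \<in> borel_measurable lebesgue"
  proof -
    have "U \<in> borel_measurable lebesgue" using iU by (rule borel_measurable_integrable)
    then have "(\<lambda>x. U (x + h) - U x) \<in> borel_measurable lebesgue"
      by (intro borel_measurable_diff borel_measurable_shift)
    then have "(\<lambda>x. \<bar>U (x + h) - U x\<bar> powr q) \<in> borel_measurable lebesgue" by simp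
    then show ?thesis by (rule borel_measurable_times[OF borel_measurable_indicator, rotated]) simp
  qed
  have int: "integrable lebesgue (\<lambda>x. ?B x * \<bar>U (x + h) - U x\<bar> powr q)"
    by (rule integrableI_nonneg[OF mU]) (use le_less_trans[OF nn ennreal_less_top] in auto)
  then show "set_integrable lebesgue (ball z r) (\<lambda>x. \<bar>U (x + h) - U x\<bar> powr q)" by (simp add: set_integrable_def)
  have "ennreal (\<integral>x. ?B x * \<bar>U (x + h) - U x\<bar> powr q \<partial>lebesgue) \<le> ennreal (norm h powr q * (\<integral>x. ?B' x * norm (G x) powr q \<partial>lebesgue))"
    using nn nn_integral_eq_integral[OF int] by simp
  then show "(LINT x:ball z r|lebesgue. \<bar>U (x + h) - U x\<bar> powr q)
      \<le> norm h powr q * (LINT x:ball z (r + norm h)|lebesgue. norm (G x) powr q)"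
    by (subst (asm) ennreal_le_iff) (auto simp: set_lebesgue_integral_def intro!: mult_nonneg_nonneg integral_nonneg_AE)
qed

section \<open>Hoelder's inequality\<close>

text \<open>Young's inequality for the normalized functions; if a norm vanishes, so does the product almost everywhere.\<close>

lemma Holder_inequality_real:
  fixes f g :: "'a \<Rightarrow> real"
  assumes pq: "1 < p" "1 < q" "1/p + 1/q = 1"
    and f: "f \<in> borel_measurable M" "integrable M (\<lambda>x. \<bar>f x\<bar> powr p)"
    and g: "g \<in> borel_measurable M" "integrable M (\<lambda>x. \<bar>g x\<bar> powr q)"
  shows "integrable M (\<lambda>x. f x * g x)"
    and "(\<integral>x. \<bar>f x * g x\<bar> \<partial>M) \<le> (\<integral>x. \<bar>f x\<bar> powr p \<partial>M) powr (1/p) * (\<integral>x. \<bar>g x\<bar> powr q \<partial>M) powr (1/q)"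
proof -
  have young: "\<bar>f x * g x\<bar> \<le> \<bar>f x\<bar> powr p / p + \<bar>g x\<bar> powr q / q" for x
    using Youngs_inequality[OF pq, of "\<bar>f x\<bar>" "\<bar>g x\<bar>"] by (simp add: abs_mult)
  show int: "integrable M (\<lambda>x. f x * g x)"
  proof (rule Bochner_Integration.integrable_bound)
    show "integrable M (\<lambda>x. \<bar>f x\<bar> powr p / p + \<bar>g x\<bar> powr q / q)" using f g by simp
    show "AE x in M. norm (f x * g x) \<le> norm (\<bar>f x\<bar> powr p / p + \<bar>g x\<bar> powr q / q)"
      using order_trans[OF young abs_ge_self] by simp
  qed (use f g in measurable)
  define A B where "A = (\<integral>x. \<bar>f x\<bar> powr p \<partial>M)" and "B = (\<integral>x. \<bar>g x\<bar> powr q \<partial>M)"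
  have AB: "0 \<le> A" "0 \<le> B" by (auto simp: A_def B_def intro!: integral_nonneg_AE)
  show "(\<integral>x. \<bar>f x * g x\<bar> \<partial>M) \<le> A powr (1/p) * B powr (1/q)"
  proof (cases "A = 0 \<or> B = 0")
    case True
    have "AE x in M. \<bar>f x * g x\<bar> = 0"
      using True
    proof
      assume "A = 0"
      then have "AE x in M. \<bar>f x\<bar> powr p = 0"
        using integral_nonneg_eq_0_iff_AE[OF f(2)] by (simp add: A_def)
      then show ?thesis by eventually_elim simp
    next
      assume "B = 0"
      then have "AE x in M. \<bar>g x\<bar> powr q = 0"
        using integral_nonneg_eq_0_iff_AE[OF g(2)] by (simp add: B_def)
      then show ?thesis by eventually_elim simp
    qed
    then have "(\<integral>x. \<bar>f x * g x\<bar> \<partial>M) = 0" by (rule integral_eq_zero_AE)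
    then show ?thesis by simp
  next
    case False
    with AB have pos: "0 < A" "0 < B" by auto
    define a b where "a = A powr (1/p)" and "b = B powr (1/q)"
    have ab: "0 < a" "0 < b" using pos by (auto simp: a_def b_def)
    have pw: "a powr p = A" "b powr q = B" using pos pq by (auto simp: a_def b_def powr_powr)
    have "\<bar>f x * g x\<bar> \<le> a * b * ((\<bar>f x\<bar> powr p / A) / p + (\<bar>g x\<bar> powr q / B) / q)" for x
    proof -
      have "(\<bar>f x\<bar> / a) * (\<bar>g x\<bar> / b) \<le> (\<bar>f x\<bar> / a) powr p / p + (\<bar>g x\<bar> / b) powr q / q"
        using ab by (intro Youngs_inequality[OF pq]) auto
      also have "(\<bar>f x\<bar> / a) powr p = \<bar>f x\<bar> powr p / A" using ab by (simp add: powr_divide pw)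
      also have "(\<bar>g x\<bar> / b) powr q = \<bar>g x\<bar> powr q / B" using ab by (simp add: powr_divide pw)
      finally have "a * b * ((\<bar>f x\<bar> / a) * (\<bar>g x\<bar> / b)) \<le> a * b * ((\<bar>f x\<bar> powr p / A) / p + (\<bar>g x\<bar> powr q / B) / q)"
        using ab by (intro mult_left_mono) auto
      then show ?thesis using ab by (simp add: abs_mult)
    qed
    then have "(\<integral>x. \<bar>f x * g x\<bar> \<partial>M) \<le> (\<integral>x. a * b * ((\<bar>f x\<bar> powr p / A) / p + (\<bar>g x\<bar> powr q / B) / q) \<partial>M)"
      using int f g by (intro integral_mono) auto
    also have "\<dots> = a * b * ((A / A) / p + (B / B) / q)"
      using f g by (simp add: A_def B_def)
    also have "\<dots> = a * b" using pos pq by simp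
    finally show ?thesis by (simp add: a_def b_def)
  qed
qed

section \<open>The energy estimate\<close>

abbreviation shift_energy :: "real \<Rightarrow> (real^'n \<Rightarrow> real^'n) \<Rightarrow> real^'n \<Rightarrow> real \<Rightarrow> real^'n \<Rightarrow> real" where
  "shift_energy q Du z r h \<equiv> LINT x:ball z r|lebesgue. (norm (H (q/2) (Du (x + h)) - H (q/2) (Du x)))\<^sup>2"

lemma norm_H_powr_le: "0 < a \<Longrightarrow> 0 < s \<Longrightarrow> norm (H a \<xi>) powr s \<le> norm \<xi> powr (a * s)"
  by (simp add: norm_H powr_powr powr_mono2)

lemma Lp_H:
  fixes D :: "real^'n \<Rightarrow> real^'m"
  assumes "D \<in> Lp q UNIV" "0 < a" "0 < s" "a * s = q"
  shows "(\<lambda>x. H a (D x)) \<in> Lp s UNIV"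
proof -
  have m: "(\<lambda>x. H a (D x)) \<in> borel_measurable lebesgue"
    by (rule measurable_compose[OF _ H_borel]) (use assms in \<open>simp add: Lp_UNIV_iff\<close>)
  have "integrable lebesgue (\<lambda>x. norm (H a (D x)) powr s)"
  proof (rule Bochner_Integration.integrable_bound)
    show "integrable lebesgue (\<lambda>x. norm (D x) powr q)" using assms by (simp add: Lp_UNIV_iff)
    have "norm (H a (D x)) powr s \<le> norm (D x) powr q" for x
      using norm_H_powr_le[OF assms(2,3), of "D x"] assms(4) by simp
    then show "AE x in lebesgue. norm (norm (H a (D x)) powr s) \<le> norm (norm (D x) powr q)" by simp
  qed (use m in simp)
  with m show ?thesis by (simp add: Lp_UNIV_iff)
qed

lemma Lp_inner_integrable:
  assumes pq: "1 < p" "1 < q" "1/p + 1/q = 1"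
    and v: "v \<in> Lp p UNIV" and w: "w \<in> Lp q UNIV"
  shows "integrable lebesgue (\<lambda>x. v x \<bullet> w x)"
proof (rule Bochner_Integration.integrable_bound)
  show "integrable lebesgue (\<lambda>x. norm (v x) powr p / p + norm (w x) powr q / q)"
    using v w by (simp add: Lp_UNIV_iff)
  have "\<bar>v x \<bullet> w x\<bar> \<le> norm (v x) powr p / p + norm (w x) powr q / q" for x
    using Cauchy_Schwarz_ineq2[of "v x" "w x"] Youngs_inequality[OF pq, of "norm (v x)" "norm (w x)"] by simp
  then show "AE x in lebesgue. norm (v x \<bullet> w x) \<le> norm (norm (v x) powr p / p + norm (w x) powr q / q)"
    using abs_ge_self order_trans by fastforce
  show "(\<lambda>x. v x \<bullet> w x) \<in> borel_measurable lebesgue"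
    by (rule borel_measurable_inner) (use v w in \<open>simp_all add: Lp_UNIV_iff\<close>)
qed

lemma Lp_mult_grad:
  fixes u :: "real^'n \<Rightarrow> real"
  assumes "u \<in> Lp_loc q \<Omega>" "u \<in> Lp_loc 1 \<Omega>" "\<zeta> \<in> test_functions \<Omega>" "0 \<le> q"
  shows "(\<lambda>x. u x *\<^sub>R grad \<zeta> x) \<in> Lp q UNIV"
proof -
  obtain B where B: "0 < B" "\<And>x. norm (grad \<zeta> x) \<le> B" using test_grad_bounded[OF assms(3)] by blast
  have "u \<in> Lp q (tsupp \<zeta>)"
    using assms test_compact[OF assms(3)] test_subset[OF assms(3)] by (simp add: Lp_loc_def)
  then have "(\<lambda>x. indicator (tsupp \<zeta>) x *\<^sub>R u x) \<in> Lp q UNIV" unfolding Lp_restrict_iff[of u] .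
  then show ?thesis
  proof (rule Lp_bound[where B=B])
    show "(\<lambda>x. u x *\<^sub>R grad \<zeta> x) \<in> borel_measurable lebesgue"
      by (rule borel_measurable_integrable[OF integrable_mult_grad[OF assms(2,3)]])
    show "norm (u x *\<^sub>R grad \<zeta> x) \<le> B * norm (indicator (tsupp \<zeta>) x *\<^sub>R u x)" for x
    proof (cases "x \<in> tsupp \<zeta>")
      case True
      then show ?thesis using mult_right_mono[OF B(2)[of x], of "\<bar>u x\<bar>"] by (simp add: mult.commute)
    next
      case False
      then have "grad \<zeta> x = 0" by (simp add: vec_eq_iff grad_test_nth partial_zero_outside_tsupp[of x \<zeta>])
      then show ?thesis using False by simp
    qed
  qed (use assms(4) B in auto)
qed

lemma grad_shift: "smooth \<phi> \<Longrightarrow> grad (\<lambda>x. \<phi> (x + a)) x = grad \<phi> (x + a)"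
  by (simp add: vec_eq_iff grad_test_nth partial_deriv_shift smooth_differentiable)

lemma grad_mult:
  "smooth \<phi> \<Longrightarrow> smooth \<psi> \<Longrightarrow> grad (\<lambda>x. \<phi> x * \<psi> x) x = \<phi> x *\<^sub>R grad \<psi> x + \<psi> x *\<^sub>R grad \<phi> x"
  by (simp add: vec_eq_iff grad_test_nth partial_deriv_mult smooth_differentiable)

lemma grad_eq_0_if_locally_constant:
  assumes "open S" "x \<in> S" "\<And>y. y \<in> S \<Longrightarrow> \<phi> y = c"
  shows "grad \<phi> x = 0"
proof -
  have "((\<lambda>_. c) has_derivative (\<lambda>_. 0)) (at x)" by (rule has_derivative_const)
  then have "(\<phi> has_derivative (\<lambda>_. 0)) (at x)"
    by (rule has_derivative_transform_within_open[OF _ assms(1,2)]) (simp add: assms(3))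
  from partial_deriv_eqI[OF this] show ?thesis by (simp add: vec_eq_iff grad_test_nth)
qed

text \<open>The estimate under the integral, for one point: \<open>\<xi>\<close>, \<open>\<zeta>\<close> are the values of the gradient at \<open>x + h\<close> and \<open>x\<close>, \<open>\<eta>\<close> and \<open>g\<close> those of the cutoff function and its gradient, and \<open>d\<close> is the difference of the function. Monotonicity gives \<open>2/p\<close> times the square; since \<open>\<eta> \<le> \<eta> powr (2/p)\<close>, Young's inequality bounds the cross term by \<open>1/p\<close> times the square and a remainder, so that \<open>1/p\<close> times the square survives.\<close>

lemma pointwise_energy:
  fixes \<xi> \<zeta> g :: "real^'n" and \<eta> d M q p :: real
  assumes q: "1 < q" "q < 2" and p: "p = q / (q - 1)" and \<eta>: "0 \<le> \<eta>" "\<eta> \<le> 1" and g: "norm g \<le> M"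
  shows "\<eta>\<^sup>2 * (norm (H (q/2) \<xi> - H (q/2) \<zeta>))\<^sup>2 / p - (6 * M) powr q / q * \<bar>d\<bar> powr q
    \<le> (H (q-1) \<xi> - H (q-1) \<zeta>) \<bullet> ((\<eta> * \<eta>) *\<^sub>R (\<xi> - \<zeta>) + d *\<^sub>R (\<eta> *\<^sub>R g + \<eta> *\<^sub>R g))"
proof -
  define \<gamma> where "\<gamma> = 2 * (q - 1) / q"
  have \<gamma>: "0 < \<gamma>" "\<gamma> \<le> 1" using q by (auto simp: \<gamma>_def field_simps)
  have pq: "1 < p" "1/p + 1/q = 1" "\<gamma> * p = 2" "2 * (q - 1) / q = 2 / p" using q unfolding p \<gamma>_def by (auto simp: field_simps)
  have M: "0 \<le> M" using g norm_ge_zero order_trans by blast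
  define V where "V = norm (H (q/2) \<xi> - H (q/2) \<zeta>)"
  define P where "P = H (q-1) \<xi> - H (q-1) \<zeta>"
  have mono: "2 / p * V\<^sup>2 \<le> P \<bullet> (\<xi> - \<zeta>)"
    using H_monotone[OF q, of \<xi> \<zeta>] unfolding V_def P_def pq(4) .
  have hoel: "norm P \<le> 3 * V powr \<gamma>"
    using H_Holder[OF q, of \<xi> \<zeta>] unfolding V_def P_def \<gamma>_def .
  have V0: "0 \<le> V" by (simp add: V_def)
  have inner_eq: "P \<bullet> (d *\<^sub>R (\<eta> *\<^sub>R g + \<eta> *\<^sub>R g)) = 2 * \<eta> * d * (P \<bullet> g)"
    by (simp only: inner_scaleR_right inner_add_right) simp
  have "\<bar>P \<bullet> (d *\<^sub>R (\<eta> *\<^sub>R g + \<eta> *\<^sub>R g))\<bar> = 2 * \<eta> * \<bar>d\<bar> * \<bar>P \<bullet> g\<bar>"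
    unfolding inner_eq using \<eta> by (simp add: abs_mult)
  also have "\<dots> \<le> 2 * \<eta> * \<bar>d\<bar> * (3 * V powr \<gamma> * M)"
  proof (intro mult_left_mono)
    have "\<bar>P \<bullet> g\<bar> \<le> norm P * norm g" by (rule Cauchy_Schwarz_ineq2)
    also have "\<dots> \<le> 3 * V powr \<gamma> * M" using hoel g V0 by (intro mult_mono) auto
    finally show "\<bar>P \<bullet> g\<bar> \<le> 3 * V powr \<gamma> * M" .
  qed (use \<eta> in simp)
  also have "\<dots> = \<eta> * V powr \<gamma> * (6 * M * \<bar>d\<bar>)" by simp
  also have "\<dots> \<le> (\<eta> powr \<gamma> * V powr \<gamma>) * (6 * M * \<bar>d\<bar>)"
  proof (intro mult_right_mono)
    show "\<eta> \<le> \<eta> powr \<gamma>" using powr_mono'[of \<gamma> 1 \<eta>] \<gamma> \<eta> by (cases "\<eta> = 0") auto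
  qed (use M in auto)
  also have "\<dots> = (\<eta> * V) powr \<gamma> * (6 * M * \<bar>d\<bar>)" using \<eta> V0 by (simp add: powr_mult)
  also have "\<dots> \<le> ((\<eta> * V) powr \<gamma>) powr p / p + (6 * M * \<bar>d\<bar>) powr q / q"
    using M q pq by (intro Youngs_inequality) auto
  also have "((\<eta> * V) powr \<gamma>) powr p = \<eta>\<^sup>2 * V\<^sup>2"
    using \<eta> V0 by (simp add: powr_powr pq powr_mult)
  also have "(6 * M * \<bar>d\<bar>) powr q = (6 * M) powr q * \<bar>d\<bar> powr q" using M by (simp add: powr_mult)
  finally have cross: "\<bar>P \<bullet> (d *\<^sub>R (\<eta> *\<^sub>R g + \<eta> *\<^sub>R g))\<bar> \<le> \<eta>\<^sup>2 * V\<^sup>2 / p + (6 * M) powr q * \<bar>d\<bar> powr q / q" .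
  have "\<eta>\<^sup>2 * (2 / p * V\<^sup>2) \<le> \<eta>\<^sup>2 * (P \<bullet> (\<xi> - \<zeta>))" using mono by (rule mult_left_mono) simp
  then have "2 * (\<eta>\<^sup>2 * V\<^sup>2 / p) \<le> P \<bullet> ((\<eta> * \<eta>) *\<^sub>R (\<xi> - \<zeta>))" by (simp add: power2_eq_square mult_ac)
  moreover have "(6 * M) powr q / q * \<bar>d\<bar> powr q = (6 * M) powr q * \<bar>d\<bar> powr q / q" by simp
  ultimately show ?thesis
    using cross unfolding V_def[symmetric] P_def[symmetric] inner_add_right by linarith
qed

text \<open>The equation is tested with \<open>v (x - h) - v x\<close>. The support of \<open>v\<close> is so small that only points of the ball of radius \<open>R\<close> matter, where the truncated functions \<open>D\<close> and \<open>F\<close> agree with \<open>Du\<close> and \<open>f\<close>. After the truncation both integrals are taken over the whole space and the shift can be moved to the coefficients.\<close>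

lemma weak_solution_difference_identity:
  fixes f u :: "real^'n \<Rightarrow> real" and h z :: "real^'n"
  assumes q: "1 < q" "q < 2" and p: "p = q / (q - 1)"
    and \<Omega>: "open \<Omega>" and sol: "weak_solution q \<Omega> f u" and wg: "weak_gradient \<Omega> u Du"
    and fp: "f \<in> Lp_loc p \<Omega>" and BO: "cball z R \<subseteq> \<Omega>" and rh: "r + norm h < R"
    and v: "wgrad v Dv" "v \<in> Lp q UNIV" "Dv \<in> Lp q UNIV"
    and v0: "\<And>x. x \<notin> ball z r \<Longrightarrow> v x = 0" "\<And>x. x \<notin> ball z r \<Longrightarrow> Dv x = 0"
  defines "D \<equiv> \<lambda>x. indicator (ball z R) x *\<^sub>R Du x" and "F \<equiv> \<lambda>x. indicator (ball z R) x *\<^sub>R f x"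
  shows "integrable lebesgue (\<lambda>x. (H (q-1) (D (x + h)) - H (q-1) (D x)) \<bullet> Dv x)" (is ?A)
    and "integrable lebesgue (\<lambda>x. (F (x + h) - F x) * v x)" (is ?B)
    and "(\<integral>x. (H (q-1) (D (x + h)) - H (q-1) (D x)) \<bullet> Dv x \<partial>lebesgue) = (\<integral>x. (F (x + h) - F x) * v x \<partial>lebesgue)" (is ?C)
proof -
  have pq: "1 < p" "1/p + 1/q = 1" "(q - 1) * p = q" using q unfolding p by (auto simp: field_simps)
  have BR: "ball z R \<subseteq> \<Omega>" using BO ball_subset_cball by blast
  have loc: "w \<in> Lp_loc m \<Omega> \<Longrightarrow> (\<lambda>x. indicator (ball z R) x *\<^sub>R w x) \<in> Lp m UNIV"
    for m and w :: "real^'n \<Rightarrow> 'b::euclidean_space"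
    unfolding Lp_restrict_iff[symmetric]
    by (rule Lp_subset[of _ _ "cball z R"]) (use BO in \<open>simp_all add: Lp_loc_def ball_subset_cball\<close>)
  have Dq: "D \<in> Lp q UNIV" unfolding D_def
    by (rule loc, rule W1_loc_weak_gradient[OF _ wg \<Omega>]) (use sol in \<open>simp add: weak_solution_def\<close>)
  have Fp: "F \<in> Lp p UNIV" unfolding F_def by (rule loc[OF fp])
  define P where "P x = H (q-1) (D x)" for x
  have Pp: "P \<in> Lp p UNIV" unfolding P_def using Lp_H[OF Dq, of "q-1" p] q pq by simp
  define \<phi> where "\<phi> x = v (x + - h) - v x" for x
  define D\<phi> where "D\<phi> x = Dv (x + - h) - Dv x" for x
  have wphi: "wgrad \<phi> D\<phi>" unfolding \<phi>_def D\<phi>_def by (intro wgrad_diff wgrad_shift v)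
  have Lphi: "\<phi> \<in> Lp q UNIV" "D\<phi> \<in> Lp q UNIV"
    unfolding \<phi>_def D\<phi>_def using q by (intro Lp_diff Lp_shift v; simp)+
  have out: "x \<notin> ball z r \<and> x + - h \<notin> ball z r" if "x \<notin> cball z (r + norm h)" for x
  proof -
    have "norm (z - x) \<le> norm (z - (x + - h)) + norm h"
      using norm_triangle_ineq4[of "z - (x + - h)" h] by simp
    then show ?thesis
      using that norm_ge_zero[of h] unfolding mem_ball mem_cball dist_norm by (intro conjI notI; linarith)
  qed
  have z1: "\<phi> x = 0" "D\<phi> x = 0" if "x \<notin> cball z (r + norm h)" for x
    using out[OF that] v0 by (simp_all add: \<phi>_def D\<phi>_def)
  have sub: "cball z (r + norm h) \<subseteq> ball z R" using rh by (auto simp: dist_norm)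
  have O: "\<Omega> \<in> sets lebesgue" using \<Omega> by simp
  have W1: "\<phi> \<in> W1 q \<Omega>"
    unfolding W1_def using Lp_subset[OF Lphi(1) subset_UNIV O] Lp_subset[OF Lphi(2) subset_UNIV O]
      wgrad_imp_weak_gradient[OF wphi] by blast
  have cs: "compact_support_in \<Omega> \<phi>"
    unfolding compact_support_in_def
    by (rule exI[of _ "cball z (r + norm h)"]) (use sub BR z1 in auto)
  have "weak_gradient \<Omega> u Du \<and> \<phi> \<in> W1 q \<Omega> \<and> weak_gradient \<Omega> \<phi> D\<phi> \<and> compact_support_in \<Omega> \<phi>"
    by (intro conjI wg W1 cs wgrad_imp_weak_gradient[OF wphi])
  from sol[unfolded weak_solution_def, THEN conjunct2, rule_format, OF this]
  have eq: "(LINT x:\<Omega>|lebesgue. H (q - 1) (Du x) \<bullet> D\<phi> x) = (LINT x:\<Omega>|lebesgue. f x * \<phi> x)"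
    by (elim conjE)
  have zR: "\<phi> x = 0" "D\<phi> x = 0" if "x \<notin> ball z R" for x
    using that sub by (auto intro!: z1)
  have e1: "H (q - 1) (Du x) \<bullet> D\<phi> x = P x \<bullet> D\<phi> x" for x
    by (cases "x \<in> ball z R") (simp_all add: zR P_def D_def)
  have e2: "f x * \<phi> x = F x * \<phi> x" for x
    by (cases "x \<in> ball z R") (simp_all add: zR F_def)
  have zO: "\<phi> x = 0" "D\<phi> x = 0" if "x \<notin> \<Omega>" for x
    using that BR by (auto intro!: zR)
  have "(LINT x:\<Omega>|lebesgue. H (q - 1) (Du x) \<bullet> D\<phi> x) = (\<integral>x. P x \<bullet> D\<phi> x \<partial>lebesgue)"
    unfolding e1 by (rule set_integral_eq_integral) (simp add: zO)
  moreover have "(LINT x:\<Omega>|lebesgue. f x * \<phi> x) = (\<integral>x. F x * \<phi> x \<partial>lebesgue)"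
    unfolding e2 by (rule set_integral_eq_integral) (simp add: zO)
  ultimately have eq': "(\<integral>x. P x \<bullet> D\<phi> x \<partial>lebesgue) = (\<integral>x. F x * \<phi> x \<partial>lebesgue)" using eq by simp
  note inn = Lp_inner_integrable[OF pq(1) q(1) pq(2)]
  \<comment> \<open>discrete integration by parts: the difference is moved from the test function to the coefficients\<close>
  have parts: "integrable lebesgue (\<lambda>x. (A (x + h) - A x) \<bullet> w x)"
    "(\<integral>x. A x \<bullet> (w (x + - h) - w x) \<partial>lebesgue) = (\<integral>x. (A (x + h) - A x) \<bullet> w x \<partial>lebesgue)"
    if A: "A \<in> Lp p UNIV" and w: "w \<in> Lp q UNIV" for A w :: "real^'n \<Rightarrow> 'b::euclidean_space"
  proof -
    have i1: "integrable lebesgue (\<lambda>x. A (x + h) \<bullet> w x)" by (rule inn[OF Lp_shift[OF A] w])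
    have i2: "integrable lebesgue (\<lambda>x. A x \<bullet> w x)" by (rule inn[OF A w])
    have i3: "integrable lebesgue (\<lambda>x. A x \<bullet> w (x + - h))" by (rule inn[OF A Lp_shift[OF w]])
    show "integrable lebesgue (\<lambda>x. (A (x + h) - A x) \<bullet> w x)" using i1 i2 by (simp add: inner_diff_left)
    have "(\<integral>x. A (x + h) \<bullet> w (x + h + - h) \<partial>lebesgue) = (\<integral>x. A x \<bullet> w (x + - h) \<partial>lebesgue)"
      by (rule integral_shift[of "\<lambda>x. A x \<bullet> w (x + - h)"]) (rule borel_measurable_integrable[OF i3])
    then show "(\<integral>x. A x \<bullet> (w (x + - h) - w x) \<partial>lebesgue) = (\<integral>x. (A (x + h) - A x) \<bullet> w x \<partial>lebesgue)"
      using i1 i2 i3 by (simp add: inner_diff_left inner_diff_right)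
  qed
  show ?A using parts(1)[OF Pp v(3)] by (simp add: P_def)
  show ?B using parts(1)[OF Fp v(2)] by simp
  show ?C using eq' parts(2)[OF Pp v(3)] parts(2)[OF Fp v(2)] by (simp add: P_def \<phi>_def D\<phi>_def)
qed

lemma norm_powr_2: "norm x powr 2 = (norm x)\<^sup>2"
  by (cases "norm x = 0") (simp_all add: powr_numeral)

lemma Lp_norm_nonneg: "0 \<le> Lp_norm m A v"
  by (simp add: Lp_norm_def)

lemma set_integral_nonneg_powr: "0 \<le> (LINT x:A|M. norm (v x) powr m)"
  unfolding set_lebesgue_integral_def by (intro integral_nonneg_AE) simp

lemma Lp_norm_powr:
  "0 < m \<Longrightarrow> Lp_norm m A v powr m = (LINT x:A|lebesgue. norm (v x) powr m)"
  using set_integral_nonneg_powr[of lebesgue A v m] by (simp add: Lp_norm_def powr_powr)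

lemma Lp_norm_mono:
  assumes "v \<in> Lp m B" "A \<subseteq> B" "A \<in> sets lebesgue" "0 < m"
  shows "Lp_norm m A v \<le> Lp_norm m B v"
proof -
  have B: "set_integrable lebesgue B (\<lambda>x. norm (v x) powr m)" using assms by (simp add: Lp_def)
  have "(LINT x:A|lebesgue. norm (v x) powr m) \<le> (LINT x:B|lebesgue. norm (v x) powr m)"
    unfolding set_lebesgue_integral_def
  proof (rule integral_mono)
    show "integrable lebesgue (\<lambda>x. indicator A x *\<^sub>R norm (v x) powr m)"
      using set_integrable_subset[OF B assms(3,2)] by (simp add: set_integrable_def)
    show "integrable lebesgue (\<lambda>x. indicator B x *\<^sub>R norm (v x) powr m)"
      using B by (simp add: set_integrable_def)
  qed (use assms(2) in \<open>auto simp: indicator_def\<close>)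
  then show ?thesis
    unfolding Lp_norm_def using assms(4) set_integral_nonneg_powr by (intro powr_mono2) auto
qed

lemma Lp_loc_ball:
  assumes "v \<in> Lp_loc m \<Omega>" "cball z R \<subseteq> \<Omega>"
  shows "v \<in> Lp m (ball z R)"
  by (rule Lp_subset[of _ _ "cball z R"]) (use assms in \<open>simp_all add: Lp_loc_def ball_subset_cball\<close>)

lemma ball_shift_mem:
  fixes f :: "real^'n \<Rightarrow> real"
  assumes "x \<in> ball z r" "r + norm h \<le> R"
  shows "x \<in> ball z R" "x + h \<in> ball z R"
proof -
  have "norm (z - (x + h)) \<le> norm (z - x) + norm h"
    using norm_triangle_ineq4[of "z - x" h] by (simp add: algebra_simps)
  then show "x + h \<in> ball z R" "x \<in> ball z R"
    using assms norm_ge_zero[of h] unfolding mem_ball dist_norm by linarith+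
qed

text \<open>Multiplication by a cutoff function that is \<open>1\<close> on the ball extends the function, without change on the ball, to a Sobolev function on the whole space.\<close>

lemma Sobolev_extension_from_ball:
  fixes u :: "real^'n \<Rightarrow> real"
  assumes wg: "weak_gradient \<Omega> u Du" and BO: "cball z R' \<subseteq> \<Omega>" and R: "0 \<le> R" "R < R'"
  obtains U G where "wgrad U G"
    and "\<And>x. x \<in> ball z R \<Longrightarrow> U x = u x" and "\<And>x. x \<in> ball z R \<Longrightarrow> G x = Du x"
    and "\<And>m. 0 \<le> m \<Longrightarrow> u \<in> Lp_loc m \<Omega> \<Longrightarrow> U \<in> Lp m UNIV"
    and "\<And>m. 0 \<le> m \<Longrightarrow> u \<in> Lp_loc m \<Omega> \<Longrightarrow> Du \<in> Lp_loc m \<Omega> \<Longrightarrow> G \<in> Lp m UNIV"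
proof -
  define \<zeta> where "\<zeta> = (\<lambda>x. cutoff R R' (x + (- z)))"
  have \<zeta>: "\<zeta> \<in> test_functions \<Omega>" unfolding \<zeta>_def by (rule ball_cutoff_test[OF R BO])
  have \<zeta>1: "\<zeta> x = 1" if "x \<in> ball z R" for x
    unfolding \<zeta>_def by (rule cutoff_eq_1[OF R]) (use that in \<open>simp add: dist_norm norm_minus_commute\<close>)
  have g\<zeta>: "grad \<zeta> x = 0" if "x \<in> ball z R" for x
    by (rule grad_eq_0_if_locally_constant[OF open_ball that \<zeta>1])
  have u1: "u \<in> Lp_loc 1 \<Omega>" using wg by (simp add: weak_gradient_def)
  show thesis
  proof (rule that)
    show "wgrad (\<lambda>x. \<zeta> x * u x) (\<lambda>x. \<zeta> x *\<^sub>R Du x + u x *\<^sub>R grad \<zeta> x)"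
      by (rule wgrad_test_mult[OF wg \<zeta>])
    show "(\<lambda>x. \<zeta> x * u x) \<in> Lp m UNIV" if "0 \<le> m" "u \<in> Lp_loc m \<Omega>" for m
      using test_mult_Lp[OF that(2) \<zeta> that(1)] by simp
    show "(\<lambda>x. \<zeta> x *\<^sub>R Du x + u x *\<^sub>R grad \<zeta> x) \<in> Lp m UNIV"
      if m: "0 \<le> m" "u \<in> Lp_loc m \<Omega>" "Du \<in> Lp_loc m \<Omega>" for m
      by (rule Lp_add[OF test_mult_Lp[OF m(3) \<zeta> m(1)] Lp_mult_grad[OF m(2) u1 \<zeta> m(1)] m(1)])
  qed (simp_all add: \<zeta>1 g\<zeta>)
qed

text \<open>The bound for difference quotients, applied to an extension of \<open>u\<close> from the ball of radius \<open>R\<close>, where it and its gradient are unchanged.\<close>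

lemma local_difference_bound:
  fixes u :: "real^'n \<Rightarrow> real" and h z :: "real^'n"
  assumes m: "1 < m" and wg: "weak_gradient \<Omega> u Du" and Du: "Du \<in> Lp_loc m \<Omega>"
    and BO: "cball z R' \<subseteq> \<Omega>" and R: "0 \<le> R" "R < R'" and rh: "r + norm h \<le> R"
  shows "Lp_norm m (ball z r) (\<lambda>x. u (x + h) - u x) \<le> norm h * Lp_norm m (ball z R) Du"
    and "set_integrable lebesgue (ball z r) (\<lambda>x. \<bar>u (x + h) - u x\<bar> powr m)"
proof -
  obtain U G where W: "wgrad U G" and onB: "\<And>x. x \<in> ball z R \<Longrightarrow> U x = u x" "\<And>x. x \<in> ball z R \<Longrightarrow> G x = Du x"
    by (rule Sobolev_extension_from_ball[OF wg BO R]) (rule that, assumption, simp_all)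
  have "cball z R \<subseteq> \<Omega>" using BO R by (meson order.strict_implies_order order_trans subset_cball)
  then have Dm: "Du \<in> Lp m (ball z R)" by (rule Lp_loc_ball[OF Du])
  have sub: "ball z (r + norm h) \<subseteq> ball z R" using rh by (rule subset_ball)
  have si: "set_integrable lebesgue (ball z (r + norm h)) (\<lambda>x. norm (Du x) powr m)"
    by (rule set_integrable_subset[of lebesgue "ball z R"]) (use Dm sub in \<open>simp_all add: Lp_def\<close>)
  have e1: "indicator (ball z (r + norm h)) x *\<^sub>R norm (G x) powr m = indicator (ball z (r + norm h)) x *\<^sub>R norm (Du x) powr m" for x
    using onB(2)[of x] sub by (cases "x \<in> ball z (r + norm h)") (auto simp: subset_iff)
  have e2: "indicator (ball z r) x *\<^sub>R \<bar>U (x + h) - U x\<bar> powr m = indicator (ball z r) x *\<^sub>R \<bar>u (x + h) - u x\<bar> powr m" for x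
    using onB(1) ball_shift_mem[OF _ rh, of x z] by (cases "x \<in> ball z r") simp_all
  have siG: "set_integrable lebesgue (ball z (r + norm h)) (\<lambda>x. norm (G x) powr m)"
    using si unfolding set_integrable_def e1 .
  show "set_integrable lebesgue (ball z r) (\<lambda>x. \<bar>u (x + h) - u x\<bar> powr m)"
    using difference_quotient_bound(1)[OF W m siG] unfolding set_integrable_def e2 .
  have "(LINT x:ball z r|lebesgue. \<bar>u (x + h) - u x\<bar> powr m) \<le> norm h powr m * (LINT x:ball z (r + norm h)|lebesgue. norm (Du x) powr m)"
    using difference_quotient_bound(2)[OF W m siG] unfolding set_lebesgue_integral_def e1 e2 .
  then have "Lp_norm m (ball z r) (\<lambda>x. u (x + h) - u x) \<le> (norm h powr m * (LINT x:ball z (r + norm h)|lebesgue. norm (Du x) powr m)) powr (1/m)"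
    unfolding Lp_norm_def real_norm_def
    using set_integral_nonneg_powr[of lebesgue "ball z r" "\<lambda>x. u (x + h) - u x" m] m
    by (intro powr_mono2) auto
  also have "\<dots> = norm h * Lp_norm m (ball z (r + norm h)) Du"
    using m set_integral_nonneg_powr[of lebesgue "ball z (r + norm h)" Du m]
    by (simp add: powr_mult powr_powr Lp_norm_def)
  also have "\<dots> \<le> norm h * Lp_norm m (ball z R) Du"
    by (intro mult_left_mono Lp_norm_mono[OF Dm sub]) (use m in auto)
  finally show "Lp_norm m (ball z r) (\<lambda>x. u (x + h) - u x) \<le> norm h * Lp_norm m (ball z R) Du" .
qed

theorem energy_estimate:
  fixes f u :: "real^'n \<Rightarrow> real" and h z :: "real^'n"
  assumes q: "1 < q" "q < 2" and p: "p = q / (q - 1)"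
    and \<Omega>: "open \<Omega>" and sol: "weak_solution q \<Omega> f u" and wg: "weak_gradient \<Omega> u Du"
    and fp: "f \<in> Lp_loc p \<Omega>" and BO: "cball z R' \<subseteq> \<Omega>" and R: "0 < R" "R < R'" and hR: "norm h \<le> R / 8"
    and M: "\<And>x. norm (grad (cutoff (R/2) (3*R/4)) (x::real^'n)) \<le> M"
  shows "shift_energy q Du z (R/2) h / p
    \<le> Lp_norm p (ball z (3*R/4)) (\<lambda>x. f (x + h) - f x) * (norm h * Lp_norm q (ball z R) Du)
      + (6 * M) powr q / q * (norm h powr q * Lp_norm q (ball z R) Du powr q)"
proof -
  have pq: "1 < p" "1/p + 1/q = 1" using q unfolding p by (auto simp: field_simps)
  have BR: "cball z R \<subseteq> \<Omega>" using BO R by (meson order.strict_implies_order order_trans subset_cball)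
  have uW: "u \<in> W1_loc q \<Omega>" and uq: "u \<in> Lp_loc q \<Omega>"
    using sol by (simp_all add: weak_solution_def W1_loc_def)
  have Duq: "Du \<in> Lp_loc q \<Omega>" by (rule W1_loc_weak_gradient[OF uW wg \<Omega>])
  have q0: "0 \<le> q" using q by simp
  have R0: "0 \<le> R" using R by simp
  obtain U G where W: "wgrad U G" and onB: "\<And>x. x \<in> ball z R \<Longrightarrow> U x = u x" "\<And>x. x \<in> ball z R \<Longrightarrow> G x = Du x"
    and UL: "\<And>m. 0 \<le> m \<Longrightarrow> u \<in> Lp_loc m \<Omega> \<Longrightarrow> U \<in> Lp m UNIV"
    and GL: "\<And>m. 0 \<le> m \<Longrightarrow> u \<in> Lp_loc m \<Omega> \<Longrightarrow> Du \<in> Lp_loc m \<Omega> \<Longrightarrow> G \<in> Lp m UNIV"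
    by (rule Sobolev_extension_from_ball[OF wg BO R0 R(2)]) (rule that, assumption, simp_all)
  have Uq: "U \<in> Lp q UNIV" by (rule UL[OF q0 uq])
  have Gq: "G \<in> Lp q UNIV" by (rule GL[OF q0 uq Duq])
  define w where "w = (\<lambda>x. U (x + h) - U x)"
  define Dw where "Dw = (\<lambda>x. G (x + h) - G x)"
  have ww: "wgrad w Dw" unfolding w_def Dw_def by (intro wgrad_diff wgrad_shift W)
  have wq: "w \<in> Lp q UNIV" "Dw \<in> Lp q UNIV"
    unfolding w_def Dw_def by (intro Lp_diff Lp_shift Uq Gq q0)+
  let ?c = "cutoff (R/2) (3*R/4) :: real^'n \<Rightarrow> real"
  have ab: "0 \<le> R/2" "R/2 < 3*R/4" using R by auto
  define \<eta> where "\<eta> = (\<lambda>x. ?c (x + (- z)))"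
  have \<eta>t: "\<eta> \<in> test_functions UNIV" unfolding \<eta>_def by (rule ball_cutoff_test[OF ab]) simp
  have \<eta>01: "0 \<le> \<eta> x" "\<eta> x \<le> 1" for x
    unfolding \<eta>_def by (rule cutoff_nonneg[OF ab], rule cutoff_le_1[OF ab])
  have \<eta>0: "\<eta> x = 0" if "x \<notin> ball z (3*R/4)" for x
    unfolding \<eta>_def by (rule cutoff_eq_0[OF ab]) (use that in \<open>simp add: dist_norm norm_minus_commute\<close>)
  have \<eta>1: "\<eta> x = 1" if "x \<in> ball z (R/2)" for x
    unfolding \<eta>_def by (rule cutoff_eq_1[OF ab]) (use that in \<open>simp add: dist_norm norm_minus_commute\<close>)
  define g where "g = grad \<eta>"
  have gM: "norm (g x) \<le> M" for x
    unfolding g_def \<eta>_def grad_shift[OF smooth_cutoff[OF ab]] by (rule M)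
  have \<eta>b: "\<eta> \<in> borel_measurable lebesgue" by (rule test_lebesgue[OF \<eta>t])
  define \<kappa> where "\<kappa> = (\<lambda>x. \<eta> x * \<eta> x)"
  have \<kappa>t: "\<kappa> \<in> test_functions UNIV" unfolding \<kappa>_def by (rule test_mult_smooth[OF \<eta>t test_smooth[OF \<eta>t]])
  have g\<kappa>: "grad \<kappa> x = \<eta> x *\<^sub>R g x + \<eta> x *\<^sub>R g x" for x
    unfolding \<kappa>_def g_def by (rule grad_mult[OF test_smooth[OF \<eta>t] test_smooth[OF \<eta>t]])
  have \<kappa>1: "\<bar>\<kappa> x\<bar> \<le> 1" for x using \<eta>01[of x] by (simp add: \<kappa>_def abs_mult mult_le_one)
  define v where "v = (\<lambda>x. \<kappa> x * w x)"
  define Dv where "Dv = (\<lambda>x. \<kappa> x *\<^sub>R Dw x + w x *\<^sub>R grad \<kappa> x)"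
  have wv: "wgrad v Dv" unfolding v_def Dv_def
    by (rule wgrad_test_mult[OF wgrad_imp_weak_gradient[OF ww, of UNIV] \<kappa>t])
  have vq: "v \<in> Lp q UNIV" unfolding v_def
    using Lp_scaleR[OF wq(1) test_lebesgue[OF \<kappa>t] \<kappa>1 q0] by simp
  have Dvq: "Dv \<in> Lp q UNIV" unfolding Dv_def
  proof (rule Lp_add[OF Lp_scaleR[OF wq(2) test_lebesgue[OF \<kappa>t] \<kappa>1 q0] _ q0])
    obtain B where B: "0 < B" "\<And>x. norm (grad \<kappa> x) \<le> B" using test_grad_bounded[OF \<kappa>t] by blast
    show "(\<lambda>x. w x *\<^sub>R grad \<kappa> x) \<in> Lp q UNIV"
    proof (rule Lp_bound[OF wq(1), where B=B])
      have "grad \<kappa> \<in> borel_measurable lebesgue"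
        by (rule measurable_completion) (simp add: grad_borel[OF test_smooth[OF \<kappa>t]])
      then show "(\<lambda>x. w x *\<^sub>R grad \<kappa> x) \<in> borel_measurable lebesgue"
        using wq(1) by (intro borel_measurable_scaleR) (simp_all add: Lp_UNIV_iff)
      show "norm (w x *\<^sub>R grad \<kappa> x) \<le> B * norm (w x)" for x
        using mult_right_mono[OF B(2)[of x], of "\<bar>w x\<bar>"] by (simp add: mult.commute)
    qed (use q0 B in auto)
  qed
  have v0: "v x = 0" "Dv x = 0" if "x \<notin> ball z (3*R/4)" for x
    using \<eta>0[OF that] by (simp_all add: v_def Dv_def g\<kappa>) (simp_all add: \<kappa>_def)
  have rh: "3*R/4 + norm h < R" "3*R/4 + norm h \<le> R" using hR R by auto
  define D where "D = (\<lambda>x. indicator (ball z R) x *\<^sub>R Du x)"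
  define F where "F = (\<lambda>x. indicator (ball z R) x *\<^sub>R f x)"
  note id0 = weak_solution_difference_identity[OF q p \<Omega> sol wg fp BR rh(1) wv vq Dvq v0]
  have id1: "integrable lebesgue (\<lambda>x. (H (q-1) (D (x + h)) - H (q-1) (D x)) \<bullet> Dv x)"
    unfolding D_def by (rule id0(1))
  have id2: "integrable lebesgue (\<lambda>x. (F (x + h) - F x) * v x)"
    unfolding F_def by (rule id0(2))
  have id3: "(\<integral>x. (H (q-1) (D (x + h)) - H (q-1) (D x)) \<bullet> Dv x \<partial>lebesgue) = (\<integral>x. (F (x + h) - F x) * v x \<partial>lebesgue)"
    unfolding D_def F_def by (rule id0(3))
  have DF: "D x = Du x" "F x = f x" if "x \<in> ball z R" for x using that by (simp_all add: D_def F_def)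
  define V where "V = (\<lambda>x. H (q/2) (D x))"
  have "Du \<in> Lp q (ball z R)" by (rule Lp_loc_ball[OF Duq BR])
  then have "D \<in> Lp q UNIV" unfolding D_def Lp_restrict_iff[of Du] .
  then have V2: "V \<in> Lp 2 UNIV" unfolding V_def by (rule Lp_H) (use q in auto)
  have dV: "integrable lebesgue (\<lambda>x. (norm (V (x + h) - V x))\<^sup>2)"
    using Lp_diff[OF Lp_shift[OF V2, of h] V2] by (simp add: Lp_UNIV_iff norm_powr_2)
  define E where "E = (\<lambda>x. (\<eta> x)\<^sup>2 * (norm (V (x + h) - V x))\<^sup>2)"
  have iE: "integrable lebesgue E"
  proof -
    have "\<bar>(\<eta> x)\<^sup>2\<bar> \<le> 1" for x using \<eta>01[of x] by (simp add: power_le_one)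
    then have "integrable lebesgue (\<lambda>x. (norm (V (x + h) - V x))\<^sup>2 * (\<eta> x)\<^sup>2)"
      using \<eta>b by (intro integrable_bounded_mult[OF dV]) auto
    then show ?thesis by (simp add: E_def mult.commute)
  qed
  let ?B = "ball z (3*R/4)"
  define I where "I = (\<lambda>x. indicator ?B x * \<bar>w x\<bar> powr q)"
  have iI: "integrable lebesgue I"
  proof -
    have "integrable lebesgue (\<lambda>x. \<bar>w x\<bar> powr q * indicator ?B x)"
      by (rule integrable_real_mult_indicator) (use wq(1) in \<open>simp_all add: Lp_UNIV_iff\<close>)
    then show ?thesis by (simp add: I_def mult.commute)
  qed
  let ?K = "(6 * M) powr q / q"
  have pw: "E x / p - ?K * I x \<le> (H (q-1) (D (x + h)) - H (q-1) (D x)) \<bullet> Dv x" for x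
  proof (cases "x \<in> ?B")
    case True
    note loc = ball_shift_mem[OF True rh(2)]
    have "Dv x = (\<eta> x * \<eta> x) *\<^sub>R (D (x + h) - D x) + w x *\<^sub>R (\<eta> x *\<^sub>R g x + \<eta> x *\<^sub>R g x)"
      using loc by (simp add: Dv_def g\<kappa> Dw_def onB DF) (simp add: \<kappa>_def)
    then show ?thesis
      using pointwise_energy[OF q p \<eta>01 gM, of x "D (x + h)" "D x" "w x" x] True
      by (simp add: E_def I_def V_def)
  next
    case False
    then show ?thesis using \<eta>0[OF False] v0[OF False] by (simp add: E_def I_def)
  qed
  have main: "integral\<^sup>L lebesgue E / p - ?K * integral\<^sup>L lebesgue I \<le> (\<integral>x. (F (x + h) - F x) * v x \<partial>lebesgue)"
  proof -
    have "integral\<^sup>L lebesgue E / p - ?K * integral\<^sup>L lebesgue I = (\<integral>x. E x / p - ?K * I x \<partial>lebesgue)"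
      using iE iI by (simp del: times_divide_eq_left)
    also have "\<dots> \<le> (\<integral>x. (H (q-1) (D (x + h)) - H (q-1) (D x)) \<bullet> Dv x \<partial>lebesgue)"
      using iE iI id1 pw by (intro integral_mono) (auto simp del: times_divide_eq_left)
    finally show ?thesis unfolding id3 .
  qed
  define a where "a = (\<lambda>x. indicator ?B x * (F (x + h) - F x))"
  define b where "b = (\<lambda>x. indicator ?B x * w x)"
  have Fp: "F \<in> Lp p UNIV" unfolding F_def Lp_restrict_iff[symmetric] by (rule Lp_loc_ball[OF fp BR])
  have "(\<lambda>x. indicator ?B x *\<^sub>R (F (x + h) - F x)) \<in> Lp p UNIV"
    using Lp_subset[OF Lp_diff[OF Lp_shift[OF Fp] Fp] subset_UNIV, of ?B] pq unfolding Lp_restrict_iff[of _ _ ?B] by simp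
  then have ap: "a \<in> borel_measurable lebesgue" "integrable lebesgue (\<lambda>x. \<bar>a x\<bar> powr p)" by (simp_all add: a_def Lp_UNIV_iff)
  have "(\<lambda>x. indicator ?B x *\<^sub>R w x) \<in> Lp q UNIV"
    using Lp_subset[OF wq(1) subset_UNIV, of ?B] unfolding Lp_restrict_iff[of _ _ ?B] by simp
  then have bq: "b \<in> borel_measurable lebesgue" "integrable lebesgue (\<lambda>x. \<bar>b x\<bar> powr q)" by (simp_all add: b_def Lp_UNIV_iff)
  have ea: "\<bar>a x\<bar> powr p = indicator ?B x *\<^sub>R norm (f (x + h) - f x) powr p" for x
    using ball_shift_mem[OF _ rh(2), of x z] DF(2) by (cases "x \<in> ?B") (simp_all add: a_def)
  have eb: "\<bar>b x\<bar> powr q = indicator ?B x *\<^sub>R norm (u (x + h) - u x) powr q" for x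
    using ball_shift_mem[OF _ rh(2), of x z] onB(1) by (cases "x \<in> ?B") (simp_all add: b_def w_def)
  have eI: "integral\<^sup>L lebesgue I = (\<integral>x. \<bar>b x\<bar> powr q \<partial>lebesgue)"
    by (rule Bochner_Integration.integral_cong) (auto simp: I_def b_def indicator_def)
  have Na: "(\<integral>x. \<bar>a x\<bar> powr p \<partial>lebesgue) powr (1/p) = Lp_norm p ?B (\<lambda>x. f (x + h) - f x)"
    unfolding ea Lp_norm_def set_lebesgue_integral_def ..
  have Nb: "(\<integral>x. \<bar>b x\<bar> powr q \<partial>lebesgue) powr (1/q) = Lp_norm q ?B (\<lambda>x. u (x + h) - u x)"
    unfolding eb Lp_norm_def set_lebesgue_integral_def ..
  let ?A = "Lp_norm q (ball z R) Du"
  have du: "Lp_norm q ?B (\<lambda>x. u (x + h) - u x) \<le> norm h * ?A"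
    by (rule local_difference_bound(1)[OF q(1) wg Duq BO R0 R(2) rh(2)])
  have "(\<integral>x. (F (x + h) - F x) * v x \<partial>lebesgue) \<le> (\<integral>x. \<bar>a x * b x\<bar> \<partial>lebesgue)"
  proof (rule integral_mono[OF id2])
    show "integrable lebesgue (\<lambda>x. \<bar>a x * b x\<bar>)"
      by (rule integrable_abs) (rule Holder_inequality_real(1)[OF pq(1) q(1) pq(2) ap bq])
    show "(F (x + h) - F x) * v x \<le> \<bar>a x * b x\<bar>" for x
    proof (cases "x \<in> ?B")
      case True
      have "(F (x + h) - F x) * v x = \<kappa> x * ((F (x + h) - F x) * w x)" by (simp add: v_def)
      also have "\<dots> \<le> \<bar>\<kappa> x\<bar> * \<bar>(F (x + h) - F x) * w x\<bar>" by (metis abs_ge_self abs_mult)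
      also have "\<dots> \<le> 1 * \<bar>(F (x + h) - F x) * w x\<bar>" by (intro mult_right_mono \<kappa>1) simp
      finally show ?thesis using True by (simp add: a_def b_def)
    qed (use v0(1) in simp)
  qed
  also have "\<dots> \<le> Lp_norm p ?B (\<lambda>x. f (x + h) - f x) * Lp_norm q ?B (\<lambda>x. u (x + h) - u x)"
    using Holder_inequality_real(2)[OF pq(1) q(1) pq(2) ap bq] unfolding Na Nb .
  also have "\<dots> \<le> Lp_norm p ?B (\<lambda>x. f (x + h) - f x) * (norm h * ?A)"
    by (rule mult_left_mono[OF du Lp_norm_nonneg])
  finally have rhs1: "(\<integral>x. (F (x + h) - F x) * v x \<partial>lebesgue) \<le> Lp_norm p ?B (\<lambda>x. f (x + h) - f x) * (norm h * ?A)" .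
  have "integral\<^sup>L lebesgue I = Lp_norm q ?B (\<lambda>x. u (x + h) - u x) powr q"
    unfolding eI eb using q Lp_norm_powr[of q ?B "\<lambda>x. u (x + h) - u x"] by (simp add: set_lebesgue_integral_def)
  also have "\<dots> \<le> (norm h * ?A) powr q" by (rule powr_mono2[OF q0 Lp_norm_nonneg du])
  also have "\<dots> = norm h powr q * ?A powr q" by (simp add: powr_mult Lp_norm_nonneg)
  finally have "?K * integral\<^sup>L lebesgue I \<le> ?K * (norm h powr q * ?A powr q)"
    using q by (intro mult_left_mono) auto
  moreover have "shift_energy q Du z (R/2) h \<le> integral\<^sup>L lebesgue E"
  proof -
    have h2: "R/2 + norm h \<le> R" using hR R by auto
    have eq: "indicator (ball z (R/2)) x *\<^sub>R (norm (H (q/2) (Du (x + h)) - H (q/2) (Du x)))\<^sup>2 = (norm (V (x + h) - V x))\<^sup>2 * indicator (ball z (R/2)) x" for x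
      using ball_shift_mem[OF _ h2, of x z] DF(1) by (cases "x \<in> ball z (R/2)") (simp_all add: V_def)
    have "(\<integral>x. (norm (V (x + h) - V x))\<^sup>2 * indicator (ball z (R/2)) x \<partial>lebesgue) \<le> integral\<^sup>L lebesgue E"
    proof (rule integral_mono[OF _ iE])
      show "integrable lebesgue (\<lambda>x. (norm (V (x + h) - V x))\<^sup>2 * indicator (ball z (R/2)) x)"
        by (rule integrable_real_mult_indicator[OF _ dV]) simp
      show "(norm (V (x + h) - V x))\<^sup>2 * indicator (ball z (R/2)) x \<le> E x" for x
        using \<eta>1[of x] by (cases "x \<in> ball z (R/2)") (simp_all add: E_def)
    qed
    then show ?thesis unfolding set_lebesgue_integral_def eq .
  qed
  then have "shift_energy q Du z (R/2) h / p \<le> integral\<^sup>L lebesgue E / p"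
    using pq by (intro divide_right_mono) auto
  ultimately show ?thesis using main rhs1 by linarith
qed

section \<open>The local estimate\<close>

lemma norm_diff_square_le: "(norm (a - b))\<^sup>2 \<le> 2 * (norm a)\<^sup>2 + 2 * (norm b)\<^sup>2"
  for a b :: "'a::real_normed_vector"
proof -
  have "(norm (a - b))\<^sup>2 \<le> (norm a + norm b)\<^sup>2" by (rule power_mono[OF norm_triangle_ineq4]) simp
  also have "\<dots> \<le> 2 * (norm a)\<^sup>2 + 2 * (norm b)\<^sup>2"
    using sum_squares_bound[of "norm a" "norm b"] by (simp add: power2_sum)
  finally show ?thesis .
qed

lemma integral_difference_square_le:
  fixes V :: "real^'n \<Rightarrow> 'a::euclidean_space"
  assumes V: "V \<in> Lp 2 UNIV"
  shows "integrable lebesgue (\<lambda>x. (norm (V (x + h) - V x))\<^sup>2)"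
    and "(\<integral>x. (norm (V (x + h) - V x))\<^sup>2 \<partial>lebesgue) \<le> 4 * (\<integral>x. (norm (V x))\<^sup>2 \<partial>lebesgue)"
proof -
  show i: "integrable lebesgue (\<lambda>x. (norm (V (x + h) - V x))\<^sup>2)"
    using Lp_diff[OF Lp_shift[OF V, of h] V] by (simp add: Lp_UNIV_iff norm_powr_2)
  have iV: "integrable lebesgue (\<lambda>x. (norm (V x))\<^sup>2)" using V by (simp add: Lp_UNIV_iff norm_powr_2)
  have iVh: "integrable lebesgue (\<lambda>x. (norm (V (x + h)))\<^sup>2)" by (rule integrable_shift[OF iV])
  have "(\<integral>x. (norm (V (x + h) - V x))\<^sup>2 \<partial>lebesgue) \<le> (\<integral>x. 2 * (norm (V (x + h)))\<^sup>2 + 2 * (norm (V x))\<^sup>2 \<partial>lebesgue)"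
    by (rule integral_mono[OF i]) (use iV iVh norm_diff_square_le in auto)
  also have "\<dots> = 4 * (\<integral>x. (norm (V x))\<^sup>2 \<partial>lebesgue)"
    using iV iVh integral_shift[OF borel_measurable_integrable[OF iV], of h] by simp
  finally show "(\<integral>x. (norm (V (x + h) - V x))\<^sup>2 \<partial>lebesgue) \<le> 4 * (\<integral>x. (norm (V x))\<^sup>2 \<partial>lebesgue)" .
qed

text \<open>The bound \<open>|H (q/2) \<xi>|\<^sup>2 \<le> |\<xi>| powr q\<close> at \<open>x\<close> and at \<open>x + h\<close> gives a uniform bound, which has the right order for shifts that stay away from \<open>0\<close>.\<close>

lemma large_shift_bound:
  fixes Du :: "real^'n \<Rightarrow> real^'n"
  assumes q: "0 < q" and Du: "Du \<in> Lp q (ball z S)" and h: "r + norm h \<le> S"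
  shows "shift_energy q Du z r h \<le> 4 * Lp_norm q (ball z S) Du powr q"
proof -
  define D where "D = (\<lambda>x. indicator (ball z S) x *\<^sub>R Du x)"
  define V where "V = (\<lambda>x. H (q/2) (D x))"
  have D: "D \<in> Lp q UNIV" unfolding D_def using Du unfolding Lp_restrict_iff[of Du] .
  have V: "V \<in> Lp 2 UNIV" unfolding V_def by (rule Lp_H[OF D]) (use q in auto)
  note dV = integral_difference_square_le[OF V, of h]
  have eq: "indicator (ball z r) x *\<^sub>R (norm (H (q/2) (Du (x + h)) - H (q/2) (Du x)))\<^sup>2
      = (norm (V (x + h) - V x))\<^sup>2 * indicator (ball z r) x" for x
    using ball_shift_mem[OF _ h, of x z] by (cases "x \<in> ball z r") (simp_all add: V_def D_def)
  have "shift_energy q Du z r h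
     = (\<integral>x. (norm (V (x + h) - V x))\<^sup>2 * indicator (ball z r) x \<partial>lebesgue)"
    unfolding set_lebesgue_integral_def eq ..
  also have "\<dots> \<le> (\<integral>x. (norm (V (x + h) - V x))\<^sup>2 \<partial>lebesgue)"
    by (rule integral_mono[OF integrable_real_mult_indicator[OF _ dV(1)] dV(1)]) (auto simp: indicator_def)
  also have "\<dots> \<le> 4 * (\<integral>x. (norm (V x))\<^sup>2 \<partial>lebesgue)" by (rule dV(2))
  also have "(\<integral>x. (norm (V x))\<^sup>2 \<partial>lebesgue) \<le> (\<integral>x. norm (D x) powr q \<partial>lebesgue)"
  proof (rule integral_mono)
    show "integrable lebesgue (\<lambda>x. (norm (V x))\<^sup>2)" using V by (simp add: Lp_UNIV_iff norm_powr_2)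
    show "integrable lebesgue (\<lambda>x. norm (D x) powr q)" using D by (simp add: Lp_UNIV_iff)
    show "(norm (V x))\<^sup>2 \<le> norm (D x) powr q" for x
      using norm_H_powr_le[of "q/2" 2 "D x"] q by (simp add: V_def norm_powr_2)
  qed
  also have "(\<integral>x. norm (D x) powr q \<partial>lebesgue) = (LINT x:ball z S|lebesgue. norm (Du x) powr q)"
    unfolding set_lebesgue_integral_def
    by (rule Bochner_Integration.integral_cong) (auto simp: D_def indicator_def)
  also have "\<dots> = Lp_norm q (ball z S) Du powr q" using Lp_norm_powr[OF q, of "ball z S" Du] by simp
  finally show ?thesis by simp
qed

text \<open>The common form of both estimates: \<open>N\<close> stands for any bound of the differences of \<open>f\<close>. The constant is chosen before the domain and the center of the ball. This is possible because the gradient bound \<open>M\<close> of the radial cutoff function is not changed by translations.\<close>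

theorem local_estimate:
  fixes q p R :: real
  assumes q: "1 < q" "q < 2" and p: "p = q / (q - 1)" and R: "0 < R"
  shows "\<exists>C>0. \<forall>(\<Omega>::(real^'n) set) f u Du z r0 h N.
     open \<Omega> \<longrightarrow> weak_solution q \<Omega> f u \<longrightarrow> weak_gradient \<Omega> u Du \<longrightarrow> f \<in> Lp_loc p \<Omega> \<longrightarrow>
     cball z (R + r0) \<subseteq> \<Omega> \<longrightarrow> 0 < r0 \<longrightarrow> norm h \<le> r0 \<longrightarrow> 0 \<le> N \<longrightarrow>
     Lp_norm p (ball z (3*R/4)) (\<lambda>x. f (x + h) - f x) \<le> N \<longrightarrow>
     shift_energy q Du z (R/2) h
       \<le> C * (N * Lp_norm q (ball z (R + r0)) Du * norm h
              + Lp_norm q (ball z (R + r0)) Du powr q * norm h powr (2 / (3 - q)))"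
proof -
  have ab: "0 \<le> R/2" "R/2 < 3*R/4" using R by auto
  obtain M where M: "0 < M" "\<And>x. norm (grad (cutoff (R/2) (3*R/4)) (x::real^'n)) \<le> M"
  proof -
    have "(\<lambda>x::real^'n. cutoff (R/2) (3*R/4) (x + - 0)) \<in> test_functions UNIV"
      by (rule ball_cutoff_test[OF ab]) simp
    then have "(cutoff (R/2) (3*R/4) :: real^'n \<Rightarrow> real) \<in> test_functions UNIV" by simp
    then show ?thesis using test_grad_bounded that by blast
  qed
  define e where "e = 2 / (3 - q)"
  have e: "0 < e" "e \<le> q"
  proof -
    have "0 \<le> (q - 1) * (2 - q)" using q by simp
    then have "2 \<le> q * (3 - q)" by (simp add: algebra_simps)
    then show "e \<le> q" using q by (simp add: e_def field_simps)
  qed (use q in \<open>simp add: e_def\<close>)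
  have p1: "1 < p" using q unfolding p by (auto simp: field_simps)
  \<comment> \<open>\<open>R/8\<close> leaves room for the shifts between the radii \<open>3R/4\<close> and \<open>R\<close>; \<open>1\<close> makes smaller exponents give larger powers\<close>
  define h0 where "h0 = min 1 (R/8)"
  have h0: "0 < h0" "h0 \<le> 1" "h0 \<le> R/8" using R by (auto simp: h0_def)
  define K where "K = (6 * M) powr q / q"
  have K: "0 \<le> K" using q by (simp add: K_def)
  \<comment> \<open>the summands belong to the term with \<open>f\<close>, to the remainder of Young's inequality, and to the shifts larger than \<open>h0\<close>\<close>
  define C where "C = p + p * K + 4 * h0 powr (- e)"
  have C: "0 < C" "p \<le> C" "p * K \<le> C" "4 * h0 powr (- e) \<le> C"
    using p1 K by (auto simp: C_def add_pos_nonneg)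
  show ?thesis
  proof (intro exI[of _ C] conjI allI impI C(1))
    fix \<Omega> :: "(real^'n) set" and f u Du z r0 h N
    assume as: "open \<Omega>" "weak_solution q \<Omega> f u" "weak_gradient \<Omega> u Du" "f \<in> Lp_loc p \<Omega>"
      "cball z (R + r0) \<subseteq> \<Omega>" "0 < r0" "norm h \<le> r0" "0 \<le> N"
      "Lp_norm p (ball z (3*R/4)) (\<lambda>x. f (x + h) - f x) \<le> N"
    let ?X = "shift_energy q Du z (R/2) h"
    let ?A = "Lp_norm q (ball z (R + r0)) Du"
    have A0: "0 \<le> ?A" by (rule Lp_norm_nonneg)
    have t1: "0 \<le> N * ?A * norm h" using as A0 by simp
    have t2: "0 \<le> ?A powr q * norm h powr e" by simp
    have "u \<in> W1_loc q \<Omega>" using as(2) by (simp add: weak_solution_def)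
    then have "Du \<in> Lp_loc q \<Omega>" by (rule W1_loc_weak_gradient[OF _ as(3,1)])
    then have Duq: "Du \<in> Lp q (ball z (R + r0))" by (rule Lp_loc_ball[OF _ as(5)])
    have "?X \<le> C * (N * ?A * norm h + ?A powr q * norm h powr e)"
    proof (cases "norm h \<le> h0")
      case True
      let ?A' = "Lp_norm q (ball z R) Du"
      have A': "?A' \<le> ?A" by (rule Lp_norm_mono[OF Duq]) (use as(6) q in \<open>auto intro: subset_ball\<close>)
      have "?X / p \<le> Lp_norm p (ball z (3*R/4)) (\<lambda>x. f (x + h) - f x) * (norm h * ?A') + K * (norm h powr q * ?A' powr q)"
        unfolding K_def
        by (rule energy_estimate[OF q p as(1-5) R _ _ M(2)]) (use as(6) True h0 in auto)
      also have "\<dots> \<le> N * (norm h * ?A) + K * (norm h powr e * ?A powr q)"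
      proof (intro add_mono mult_mono mult_left_mono powr_mono2 A' as(9))
        show "norm h powr q \<le> norm h powr e"
          using powr_mono'[OF e(2), of "norm h"] True h0 by simp
      qed (use as(8) K q in \<open>auto simp: Lp_norm_nonneg\<close>)
      finally have "?X \<le> p * (N * (norm h * ?A) + K * (norm h powr e * ?A powr q))"
        using p1 by (simp add: divide_le_eq mult.commute)
      also have "\<dots> = p * (N * ?A * norm h) + p * K * (?A powr q * norm h powr e)" by (simp add: algebra_simps)
      also have "\<dots> \<le> C * (N * ?A * norm h) + C * (?A powr q * norm h powr e)"
        by (intro add_mono mult_right_mono C t1 t2)
      finally show ?thesis by (simp add: distrib_left)
    next
      case False
      have "R/2 + norm h \<le> R + r0" using as(7) R by simp
      then have "?X \<le> 4 * ?A powr q" by (intro large_shift_bound[OF _ Duq]) (use q in simp)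
      also have "\<dots> \<le> 4 * ?A powr q * (h0 powr (- e) * norm h powr e)"
      proof -
        have "1 = h0 powr (- e) * h0 powr e" using h0 by (simp add: powr_minus)
        also have "\<dots> \<le> h0 powr (- e) * norm h powr e"
          using False h0 e by (intro mult_left_mono powr_mono2) auto
        finally show ?thesis using mult_left_mono[of 1 _ "4 * ?A powr q"] by simp
      qed
      also have "\<dots> = 4 * h0 powr (- e) * (?A powr q * norm h powr e)" by simp
      also have "\<dots> \<le> C * (?A powr q * norm h powr e)" by (intro mult_right_mono C t2)
      also have "\<dots> \<le> C * (N * ?A * norm h + ?A powr q * norm h powr e)"
        using t1 C by (intro mult_left_mono) auto
      finally show ?thesis .
    qed
    then show "?X \<le> C * (N * ?A * norm h + ?A powr q * norm h powr (2 / (3 - q)))" by (simp only: e_def)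
  qed
qed

section \<open>Besov functions and differences on balls\<close>

lemma besov_loc_imp_Lp_loc:
  assumes "f \<in> besov_loc \<alpha> p \<Omega>" "open \<Omega>" "0 \<le> p"
  shows "f \<in> Lp_loc p \<Omega>"
  unfolding Lp_loc_def
proof (intro CollectI allI impI)
  fix K assume K: "compact K \<and> K \<subseteq> \<Omega>"
  obtain \<zeta> where \<zeta>: "\<zeta> \<in> test_functions \<Omega>" "\<And>x. x \<in> K \<Longrightarrow> 1 \<le> \<zeta> x"
    using exists_test_function_ge_1[of K \<Omega>] K assms(2) by metis
  have "(\<lambda>x. \<zeta> x * f x) \<in> besov \<alpha> p"
    using assms(1) unfolding besov_loc_def mem_Collect_eq by (rule bspec[OF _ \<zeta>(1)])
  then have "(\<lambda>x. \<zeta> x *\<^sub>R f x) \<in> Lp p UNIV" by (simp only: besov_def mem_Collect_eq real_scaleR_def)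
  then show "f \<in> Lp p K"
    by (rule Lp_divide_test[OF _ test_lebesgue[OF \<zeta>(1)] \<zeta>(2)])
       (use K assms(3) in \<open>simp_all add: compact_in_sets_lebesgue\<close>)
qed

text \<open>The real-valued supremum in the seminorm bounds its quotients only if these are bounded. The bound comes from the global seminorm of the product of \<open>f\<close> with a cutoff function that is \<open>1\<close> on the ball: the quotients of \<open>f\<close> on the ball are at most those of the product.\<close>

lemma besov_norm_bounds_differences:
  fixes f :: "real^'n \<Rightarrow> real"
  assumes f: "f \<in> besov_loc \<alpha> p \<Omega>" and p: "1 < p"
    and BO: "cball z S' \<subseteq> \<Omega>" and S: "0 \<le> S" "S < S'" and rh: "r + norm h \<le> S"
  shows "Lp_norm p (ball z r) (\<lambda>x. f (x + h) - f x) \<le> norm h powr \<alpha> * besov_norm \<alpha> p (ball z S) f"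
    and "0 \<le> besov_norm \<alpha> p (ball z S) f"
proof -
  let ?B = "ball z S"
  define \<zeta> where "\<zeta> = (\<lambda>x. cutoff S S' (x + (- z)))"
  have \<zeta>: "\<zeta> \<in> test_functions \<Omega>" unfolding \<zeta>_def by (rule ball_cutoff_test[OF S BO])
  have \<zeta>1: "\<zeta> x = 1" if "x \<in> ?B" for x
    unfolding \<zeta>_def by (rule cutoff_eq_1[OF S]) (use that in \<open>simp add: dist_norm norm_minus_commute\<close>)
  define g where "g = (\<lambda>x. \<zeta> x * f x)"
  have g: "g \<in> besov \<alpha> p" unfolding g_def
    using f unfolding besov_loc_def mem_Collect_eq by (rule bspec[OF _ \<zeta>])
  then have gp: "g \<in> Lp p UNIV" by (simp add: besov_def)
  let ?S = "\<lambda>k. {x \<in> ?B. x + k \<in> ?B}"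
  have Sm: "?S k \<in> sets lebesgue" for k
  proof -
    have "{x. x + k \<in> ?B} = ball (z - k) S" by (auto simp: dist_norm algebra_simps)
    then have "open {x. x + k \<in> ?B}" by simp
    then have "open (?B \<inter> {x. x + k \<in> ?B})" by (rule open_Int[OF open_ball])
    moreover have "?S k = ?B \<inter> {x. x + k \<in> ?B}" by auto
    ultimately show ?thesis by simp
  qed
  have ig: "integrable lebesgue (\<lambda>x. \<bar>g (x + k) - g x\<bar> powr p)" for k
    using Lp_diff[OF Lp_shift[OF gp, of k] gp] p by (simp add: Lp_UNIV_iff)
  have ef: "indicator (?S k) x *\<^sub>R \<bar>f (x + k) - f x\<bar> powr p = \<bar>g (x + k) - g x\<bar> powr p * indicator (?S k) x" for k x
    using \<zeta>1[of x] \<zeta>1[of "x + k"] by (auto simp: g_def indicator_def)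
  have ifS: "integrable lebesgue (\<lambda>x. indicator (?S k) x *\<^sub>R \<bar>f (x + k) - f x\<bar> powr p)" for k
    unfolding ef by (rule integrable_real_mult_indicator[OF Sm ig])
  have quot: "besov_quot \<alpha> p A w k = (LINT x:{x \<in> A. x + k \<in> A}|lebesgue. \<bar>w (x + k) - w x\<bar> powr p) powr (1/p) / norm k powr \<alpha>"
    for A k and w :: "real^'n \<Rightarrow> real"
  proof -
    have "(LINT x:{x \<in> A. x + k \<in> A}|lebesgue. \<bar>w (x + k) - w x\<bar> powr p / norm k powr (\<alpha> * p)) =
      (LINT x:{x \<in> A. x + k \<in> A}|lebesgue. \<bar>w (x + k) - w x\<bar> powr p) / norm k powr (\<alpha> * p)"
      by (rule set_integral_divide_zero)
    moreover have "0 \<le> (LINT x:{x \<in> A. x + k \<in> A}|lebesgue. \<bar>w (x + k) - w x\<bar> powr p)"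
      using set_integral_nonneg_powr[of lebesgue _ "\<lambda>x. w (x + k) - w x" p] by simp
    ultimately show ?thesis using p by (simp add: besov_quot_def powr_divide powr_powr)
  qed
  have le: "besov_quot \<alpha> p ?B f k \<le> besov_quot \<alpha> p UNIV g k" for k
  proof -
    have "(LINT x:?S k|lebesgue. \<bar>f (x + k) - f x\<bar> powr p) \<le> (\<integral>x. \<bar>g (x + k) - g x\<bar> powr p \<partial>lebesgue)"
      unfolding set_lebesgue_integral_def
    proof (rule integral_mono[OF ifS ig])
      show "indicator (?S k) x *\<^sub>R \<bar>f (x + k) - f x\<bar> powr p \<le> \<bar>g (x + k) - g x\<bar> powr p" for x
        unfolding ef by (simp add: indicator_def)
    qed
    then have "(LINT x:?S k|lebesgue. \<bar>f (x + k) - f x\<bar> powr p) powr (1/p) \<le> (\<integral>x. \<bar>g (x + k) - g x\<bar> powr p \<partial>lebesgue) powr (1/p)"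
      using set_integral_nonneg_powr[of lebesgue "?S k" "\<lambda>x. f (x + k) - f x" p] p by (intro powr_mono2) auto
    then show ?thesis unfolding quot
      by (intro divide_right_mono) (simp_all add: set_lebesgue_integral_def)
  qed
  have bdd: "bdd_above (besov_quot \<alpha> p ?B f ` (UNIV - {0}))"
  proof -
    obtain b where b: "\<And>k. k \<noteq> 0 \<Longrightarrow> besov_quot \<alpha> p UNIV g k \<le> b"
      using g by (auto simp: besov_def bdd_above_def)
    show ?thesis by (rule bdd_aboveI[of _ b]) (use b le order_trans in blast)
  qed
  have up: "besov_quot \<alpha> p ?B f k \<le> besov_seminorm \<alpha> p ?B f" if "k \<noteq> 0" for k
    unfolding besov_seminorm_def by (rule cSUP_upper[OF _ bdd]) (use that in simp)
  have sn0: "0 \<le> besov_seminorm \<alpha> p ?B f"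
  proof -
    have "(axis undefined 1 :: real^'n) \<noteq> 0" by (simp add: axis_eq_0_iff)
    from up[OF this] show ?thesis unfolding besov_quot_def by (rule order_trans[OF powr_ge_zero])
  qed
  then show bn0: "0 \<le> besov_norm \<alpha> p ?B f" by (simp add: besov_norm_def Lp_norm_nonneg)
  show "Lp_norm p (ball z r) (\<lambda>x. f (x + h) - f x) \<le> norm h powr \<alpha> * besov_norm \<alpha> p ?B f"
  proof (cases "h = 0")
    case True
    have "Lp_norm p (ball z r) (\<lambda>x. f (x + h) - f x) = 0"
      using p True by (simp add: Lp_norm_def set_lebesgue_integral_def)
    then show ?thesis using bn0 by simp
  next
    case False
    have sub: "ball z r \<subseteq> ?S h" using ball_shift_mem[OF _ rh] by blast
    have "(LINT x:ball z r|lebesgue. \<bar>f (x + h) - f x\<bar> powr p) \<le> (LINT x:?S h|lebesgue. \<bar>f (x + h) - f x\<bar> powr p)"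
      unfolding set_lebesgue_integral_def
    proof (rule integral_mono[OF _ ifS])
      have "set_integrable lebesgue (ball z r) (\<lambda>x. \<bar>f (x + h) - f x\<bar> powr p)"
        by (rule set_integrable_subset[OF _ _ sub]) (use ifS[of h] in \<open>simp_all add: set_integrable_def\<close>)
      then show "integrable lebesgue (\<lambda>x. indicator (ball z r) x *\<^sub>R \<bar>f (x + h) - f x\<bar> powr p)"
        by (simp add: set_integrable_def)
      show "indicator (ball z r) x *\<^sub>R \<bar>f (x + h) - f x\<bar> powr p \<le> indicator (?S h) x *\<^sub>R \<bar>f (x + h) - f x\<bar> powr p" for x
        using sub by (intro scaleR_right_mono) (auto simp: indicator_def)
    qed
    then have "Lp_norm p (ball z r) (\<lambda>x. f (x + h) - f x) \<le> (LINT x:?S h|lebesgue. \<bar>f (x + h) - f x\<bar> powr p) powr (1/p)"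
      unfolding Lp_norm_def real_norm_def
      using set_integral_nonneg_powr[of lebesgue "ball z r" "\<lambda>x. f (x + h) - f x" p] p by (intro powr_mono2) auto
    also have "\<dots> = norm h powr \<alpha> * besov_quot \<alpha> p ?B f h"
      unfolding quot using False by simp
    also have "\<dots> \<le> norm h powr \<alpha> * besov_norm \<alpha> p ?B f"
      using up[OF False] Lp_norm_nonneg[of p ?B f] by (intro mult_left_mono) (auto simp: besov_norm_def)
    finally show ?thesis .
  qed
qed

text \<open>Let \<open>\<phi>\<close> be a test function. Since \<open>\<Delta>(\<phi> V) = \<phi> \<Delta>V + V(x + h) \<Delta>\<phi>\<close>, small shifts are treated by covering the support of \<open>\<phi>\<close> with finitely many balls on which the differences of \<open>V\<close> are controlled, and by the Lipschitz continuity of \<open>\<phi>\<close>. For the remaining shifts the square integrability of \<open>\<phi> V\<close> suffices.\<close>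

lemma besov_loc_vec_if_local_differences:
  fixes V :: "real^'n \<Rightarrow> real^'n"
  assumes \<Omega>: "open \<Omega>" and V: "V \<in> Lp_loc 2 \<Omega>" and \<beta>: "0 < \<beta>" "\<beta> \<le> 1"
    and loc: "\<And>z. z \<in> \<Omega> \<Longrightarrow> \<exists>\<rho>>0. \<exists>\<delta>>0. \<exists>C\<ge>0. cball z (\<rho> + \<delta>) \<subseteq> \<Omega> \<and>
      (\<forall>h. norm h \<le> \<delta> \<longrightarrow> (LINT x:ball z \<rho>|lebesgue. (norm (V (x + h) - V x))\<^sup>2) \<le> C * norm h powr (2 * \<beta>))"
  shows "V \<in> besov_loc_vec \<beta> 2 \<Omega>"
  unfolding besov_loc_vec_def besov_loc_def besov_def
proof (intro CollectI allI ballI conjI)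
  fix i and \<phi> :: "real^'n \<Rightarrow> real" assume \<phi>: "\<phi> \<in> test_functions \<Omega>"
  define g where "g = (\<lambda>x. \<phi> x * V x $ i)"
  have "(\<lambda>x. \<phi> x *\<^sub>R V x) \<in> Lp 2 UNIV" by (rule test_mult_Lp[OF V \<phi>]) simp
  then have g2: "g \<in> Lp 2 UNIV"
  proof (rule Lp_bound[where B=1])
    have "(\<lambda>x. (\<phi> x *\<^sub>R V x) $ i) \<in> borel_measurable lebesgue"
      by (rule measurable_compose[where N=borel])
         (use \<open>(\<lambda>x. \<phi> x *\<^sub>R V x) \<in> Lp 2 UNIV\<close> in \<open>simp_all add: Lp_UNIV_iff borel_measurable_continuous_onI continuous_on_component continuous_on_id\<close>)
    then show "g \<in> borel_measurable lebesgue" by (simp add: g_def)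
    show "norm (g x) \<le> 1 * norm (\<phi> x *\<^sub>R V x)" for x
      using component_le_norm_cart[of "V x" i] by (simp add: g_def abs_mult mult_left_mono)
  qed simp_all
  then show "(\<lambda>x. \<phi> x * V x $ i) \<in> Lp 2 UNIV" by (simp add: g_def)
  let ?K = "tsupp \<phi>"
  have K: "compact ?K" "?K \<subseteq> \<Omega>" by (rule test_compact[OF \<phi>], rule test_subset[OF \<phi>])
  have "\<forall>z\<in>\<Omega>. \<exists>t. 0 < fst t \<and> 0 < fst (snd t) \<and> 0 \<le> snd (snd t) \<and> cball z (fst t + fst (snd t)) \<subseteq> \<Omega> \<and>
      (\<forall>h. norm h \<le> fst (snd t) \<longrightarrow> (LINT x:ball z (fst t)|lebesgue. (norm (V (x + h) - V x))\<^sup>2) \<le> snd (snd t) * norm h powr (2 * \<beta>))"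
    using loc by simp
  from bchoice[OF this] obtain t where t: "\<forall>z\<in>\<Omega>. 0 < fst (t z) \<and> 0 < fst (snd (t z)) \<and> 0 \<le> snd (snd (t z)) \<and> cball z (fst (t z) + fst (snd (t z))) \<subseteq> \<Omega> \<and>
      (\<forall>h. norm h \<le> fst (snd (t z)) \<longrightarrow> (LINT x:ball z (fst (t z))|lebesgue. (norm (V (x + h) - V x))\<^sup>2) \<le> snd (snd (t z)) * norm h powr (2 * \<beta>))"
    ..
  define \<rho> \<delta> c where "\<rho> = (\<lambda>z. fst (t z))" and "\<delta> = (\<lambda>z. fst (snd (t z)))" and "c = (\<lambda>z. snd (snd (t z)))"
  have T: "0 < \<rho> z" "0 < \<delta> z" "0 \<le> c z" "cball z (\<rho> z + \<delta> z) \<subseteq> \<Omega>"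
    "\<And>h. norm h \<le> \<delta> z \<Longrightarrow> (LINT x:ball z (\<rho> z)|lebesgue. (norm (V (x + h) - V x))\<^sup>2) \<le> c z * norm h powr (2 * \<beta>)"
    if "z \<in> \<Omega>" for z
    using t that by (auto simp: \<rho>_def \<delta>_def c_def)
  have "?K \<subseteq> (\<Union>z\<in>?K. ball z (\<rho> z))" using T(1) K by force
  then obtain Z where Z: "Z \<subseteq> ?K" "finite Z" "?K \<subseteq> (\<Union>z\<in>Z. ball z (\<rho> z))"
    using compactE_image[OF K(1), of ?K "\<lambda>z. ball z (\<rho> z)"] by auto
  have ZO: "z \<in> \<Omega>" if "z \<in> Z" for z using Z K that by blast
  define d where "d = Min (insert 1 (\<delta> ` Z))"
  have d: "0 < d" "d \<le> 1" "\<And>z. z \<in> Z \<Longrightarrow> d \<le> \<delta> z"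
    using Z(2) T(2) ZO by (auto simp: d_def)
  \<comment> \<open>a compact subset of the domain that contains \<open>x\<close> and \<open>x + h\<close> whenever \<open>x\<close> lies in a ball of the covering and \<open>h\<close> is small\<close>
  define K' where "K' = (\<Union>z\<in>Z. cball z (\<rho> z + \<delta> z))"
  have K': "compact K'" "K' \<subseteq> \<Omega>" unfolding K'_def using Z(2) T(4) ZO by (auto intro!: compact_UN)
  define W where "W = (\<lambda>x. indicator K' x *\<^sub>R V x)"
  have W2: "W \<in> Lp 2 UNIV" unfolding W_def Lp_restrict_iff[symmetric] using V K' by (simp add: Lp_loc_def)
  have near: "x \<in> K'" "x + h \<in> K'" if z: "z \<in> Z" and x: "x \<in> ball z (\<rho> z)" and h: "norm h \<le> d" for x z h
  proof -
    have "\<rho> z + norm h \<le> \<rho> z + \<delta> z" using d(3)[OF z] h by simp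
    from ball_shift_mem[OF x this] show "x \<in> K'" "x + h \<in> K'"
      unfolding K'_def using z ball_subset_cball by blast+
  qed
  obtain B where B: "0 < B" "\<And>x. \<bar>\<phi> x\<bar> \<le> B" using test_bounded[OF \<phi>] by blast
  obtain L where L: "0 < L" "\<And>x y. \<bar>\<phi> x - \<phi> y\<bar> \<le> L * norm (x - y)" using test_lipschitz[OF \<phi>] by blast
  have iW: "integrable lebesgue (\<lambda>x. (norm (W x))\<^sup>2)" using W2 by (simp add: Lp_UNIV_iff norm_powr_2)
  note dW = integral_difference_square_le(1)[OF W2]
  note dg = integral_difference_square_le[OF g2]
  define IW where "IW = (\<integral>x. (norm (W x))\<^sup>2 \<partial>lebesgue)"
  define Ig where "Ig = (\<integral>x. (norm (g x))\<^sup>2 \<partial>lebesgue)"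
  have I0: "0 \<le> IW" "0 \<le> Ig" unfolding IW_def Ig_def by simp_all
  define C where "C = 2 * B\<^sup>2 * (\<Sum>z\<in>Z. c z) + 2 * L\<^sup>2 * IW + 4 * Ig * d powr (- (2 * \<beta>))"
  have c0: "0 \<le> (\<Sum>z\<in>Z. c z)" using T(3) ZO by (intro sum_nonneg) auto
  have small: "(\<integral>x. (norm (g (x + h) - g x))\<^sup>2 \<partial>lebesgue) \<le> C * norm h powr (2 * \<beta>)" if h: "norm h \<le> d" for h
  proof -
    let ?S = "\<lambda>x. \<Sum>z\<in>Z. (norm (W (x + h) - W x))\<^sup>2 * indicator (ball z (\<rho> z)) x"
    have iS: "integrable lebesgue ?S"
      by (intro Bochner_Integration.integrable_sum integrable_real_mult_indicator dW) simp
    have iWh: "integrable lebesgue (\<lambda>x. (norm (W (x + h)))\<^sup>2)" by (rule integrable_shift[OF iW])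
    have pw: "(norm (g (x + h) - g x))\<^sup>2 \<le> 2 * B\<^sup>2 * ?S x + 2 * L\<^sup>2 * (norm h)\<^sup>2 * (norm (W (x + h)))\<^sup>2" for x
    proof -
      let ?a = "\<phi> x * (V (x + h) $ i - V x $ i)" and ?b = "- ((\<phi> (x + h) - \<phi> x) * V (x + h) $ i)"
      have S0: "0 \<le> ?S x" by (intro sum_nonneg) simp
      have a: "(norm ?a)\<^sup>2 \<le> B\<^sup>2 * ?S x"
      proof (cases "x \<in> ?K")
        case True
        then obtain z where z: "z \<in> Z" "x \<in> ball z (\<rho> z)" using Z(3) by blast
        have "\<bar>V (x + h) $ i - V x $ i\<bar> \<le> norm (W (x + h) - W x)"
          using component_le_norm_cart[of "V (x + h) - V x" i] near[OF z h] by (simp add: W_def)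
        then have "\<bar>?a\<bar> \<le> B * norm (W (x + h) - W x)"
          unfolding abs_mult using B(2)[of x] B(1) by (intro mult_mono) auto
        then have "(norm ?a)\<^sup>2 \<le> (B * norm (W (x + h) - W x))\<^sup>2"
          unfolding real_norm_def by (rule power_mono) simp
        also have "\<dots> = B\<^sup>2 * ((norm (W (x + h) - W x))\<^sup>2 * indicator (ball z (\<rho> z)) x)"
          using z by (simp add: power_mult_distrib)
        also have "\<dots> \<le> B\<^sup>2 * ?S x"
          using member_le_sum[OF z(1), of "\<lambda>z. (norm (W (x + h) - W x))\<^sup>2 * indicator (ball z (\<rho> z)) x"] Z(2)
          by (intro mult_left_mono) auto
        finally show ?thesis .
      next
        case False
        then show ?thesis using zero_outside_tsupp[OF False] S0 by simp
      qed
      have b: "(norm ?b)\<^sup>2 \<le> L\<^sup>2 * (norm h)\<^sup>2 * (norm (W (x + h)))\<^sup>2"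
      proof (cases "\<phi> (x + h) - \<phi> x = 0")
        case True
        then show ?thesis by simp
      next
        case False
        then have "x \<in> ?K \<or> x + h \<in> ?K"
          using zero_outside_tsupp[of x \<phi>] zero_outside_tsupp[of "x + h" \<phi>]
          by (cases "x \<in> ?K"; cases "x + h \<in> ?K"; simp)
        then have "x + h \<in> K'"
        proof
          assume "x \<in> ?K"
          then obtain z where "z \<in> Z" "x \<in> ball z (\<rho> z)" using Z(3) by blast
          then show ?thesis using near(2) h by blast
        next
          assume "x + h \<in> ?K"
          then obtain z where "z \<in> Z" "x + h \<in> ball z (\<rho> z)" using Z(3) by blast
          then show ?thesis using near(1)[of z "x + h" 0] d by simp
        qed
        then have "\<bar>V (x + h) $ i\<bar> \<le> norm (W (x + h))"
          using component_le_norm_cart[of "V (x + h)" i] by (simp add: W_def)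
        moreover have "\<bar>\<phi> (x + h) - \<phi> x\<bar> \<le> L * norm h" using L(2)[of "x + h" x] by simp
        ultimately have "\<bar>?b\<bar> \<le> (L * norm h) * norm (W (x + h))"
          unfolding abs_minus_cancel abs_mult using L(1) by (intro mult_mono) auto
        then have "(norm ?b)\<^sup>2 \<le> ((L * norm h) * norm (W (x + h)))\<^sup>2"
          unfolding real_norm_def by (rule power_mono) simp
        then show ?thesis by (simp add: power_mult_distrib)
      qed
      have "g (x + h) - g x = ?a - ?b" by (simp add: g_def algebra_simps)
      then have "(norm (g (x + h) - g x))\<^sup>2 \<le> 2 * (norm ?a)\<^sup>2 + 2 * (norm ?b)\<^sup>2"
        using norm_diff_square_le[of ?a ?b] by simp
      then show ?thesis using a b by linarith
    qed
    have "integral\<^sup>L lebesgue ?S = (\<Sum>z\<in>Z. LINT x:ball z (\<rho> z)|lebesgue. (norm (V (x + h) - V x))\<^sup>2)"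
    proof -
      have "integral\<^sup>L lebesgue ?S = (\<Sum>z\<in>Z. (\<integral>x. (norm (W (x + h) - W x))\<^sup>2 * indicator (ball z (\<rho> z)) x \<partial>lebesgue))"
        by (rule Bochner_Integration.integral_sum) (rule integrable_real_mult_indicator[OF _ dW], simp)
      also have "\<dots> = (\<Sum>z\<in>Z. LINT x:ball z (\<rho> z)|lebesgue. (norm (V (x + h) - V x))\<^sup>2)"
      proof (rule sum.cong[OF refl])
        fix z assume z: "z \<in> Z"
        show "(\<integral>x. (norm (W (x + h) - W x))\<^sup>2 * indicator (ball z (\<rho> z)) x \<partial>lebesgue) = (LINT x:ball z (\<rho> z)|lebesgue. (norm (V (x + h) - V x))\<^sup>2)"
          unfolding set_lebesgue_integral_def
        proof (rule Bochner_Integration.integral_cong[OF refl])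
          show "(norm (W (x + h) - W x))\<^sup>2 * indicator (ball z (\<rho> z)) x = indicator (ball z (\<rho> z)) x *\<^sub>R (norm (V (x + h) - V x))\<^sup>2" for x
            using near[OF z _ h, of x] by (cases "x \<in> ball z (\<rho> z)") (simp_all add: W_def)
        qed
      qed
      finally show ?thesis .
    qed
    also have "\<dots> \<le> (\<Sum>z\<in>Z. c z * norm h powr (2 * \<beta>))"
      using T(5) ZO d(3) h by (intro sum_mono) (meson order_trans)
    also have "\<dots> = (\<Sum>z\<in>Z. c z) * norm h powr (2 * \<beta>)" by (simp add: sum_distrib_right)
    finally have sum_bound: "integral\<^sup>L lebesgue ?S \<le> (\<Sum>z\<in>Z. c z) * norm h powr (2 * \<beta>)" .
    have "(\<integral>x. (norm (g (x + h) - g x))\<^sup>2 \<partial>lebesgue) \<le> (\<integral>x. 2 * B\<^sup>2 * ?S x + 2 * L\<^sup>2 * (norm h)\<^sup>2 * (norm (W (x + h)))\<^sup>2 \<partial>lebesgue)"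
      by (rule integral_mono[OF dg(1) _ pw]) (intro Bochner_Integration.integrable_add integrable_mult_right iS iWh)
    also have "\<dots> = 2 * B\<^sup>2 * integral\<^sup>L lebesgue ?S + 2 * L\<^sup>2 * (norm h)\<^sup>2 * IW"
      using iS iWh integral_shift[OF borel_measurable_integrable[OF iW], of h] by (simp add: IW_def)
    also have "\<dots> \<le> 2 * B\<^sup>2 * ((\<Sum>z\<in>Z. c z) * norm h powr (2 * \<beta>)) + 2 * L\<^sup>2 * (norm h)\<^sup>2 * IW"
      by (intro add_right_mono mult_left_mono sum_bound) simp
    also have "\<dots> \<le> 2 * B\<^sup>2 * ((\<Sum>z\<in>Z. c z) * norm h powr (2 * \<beta>)) + 2 * L\<^sup>2 * norm h powr (2 * \<beta>) * IW"
    proof -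
      have "(norm h)\<^sup>2 \<le> norm h powr (2 * \<beta>)"
        using powr_mono'[of "2 * \<beta>" 2 "norm h"] \<beta> h d by (simp add: norm_powr_2)
      then show ?thesis using I0 by (intro add_left_mono mult_right_mono mult_left_mono) auto
    qed
    also have "\<dots> = (2 * B\<^sup>2 * (\<Sum>z\<in>Z. c z) + 2 * L\<^sup>2 * IW) * norm h powr (2 * \<beta>)" by (simp add: algebra_simps)
    also have "\<dots> \<le> C * norm h powr (2 * \<beta>)"
      using I0 by (intro mult_right_mono) (auto simp: C_def)
    finally show ?thesis .
  qed
  have large: "(\<integral>x. (norm (g (x + h) - g x))\<^sup>2 \<partial>lebesgue) \<le> C * norm h powr (2 * \<beta>)" if h: "d < norm h" for h
  proof -
    have "(\<integral>x. (norm (g (x + h) - g x))\<^sup>2 \<partial>lebesgue) \<le> 4 * Ig * 1" using dg(2)[of h] by (simp add: Ig_def)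
    also have "\<dots> \<le> 4 * Ig * (d powr (- (2 * \<beta>)) * norm h powr (2 * \<beta>))"
    proof (rule mult_left_mono)
      have "1 = d powr (- (2 * \<beta>)) * d powr (2 * \<beta>)" using d by (simp add: powr_minus)
      also have "\<dots> \<le> d powr (- (2 * \<beta>)) * norm h powr (2 * \<beta>)"
        using d \<beta> h by (intro mult_left_mono powr_mono2) auto
      finally show "1 \<le> d powr (- (2 * \<beta>)) * norm h powr (2 * \<beta>)" .
    qed (use I0 in simp)
    also have "\<dots> = 4 * Ig * d powr (- (2 * \<beta>)) * norm h powr (2 * \<beta>)" by simp
    also have "\<dots> \<le> C * norm h powr (2 * \<beta>)"
      using I0 c0 by (intro mult_right_mono) (auto simp: C_def)
    finally show ?thesis .
  qed
  show "bdd_above (besov_quot \<beta> 2 UNIV (\<lambda>x. \<phi> x * V x $ i) ` (UNIV - {0}))"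
  proof (rule bdd_aboveI2)
    fix h :: "real^'n" assume "h \<in> UNIV - {0}"
    then have h: "0 < norm h powr (2 * \<beta>)" by simp
    have "(LINT x:UNIV|lebesgue. \<bar>g (x + h) - g x\<bar> powr 2 / norm h powr (\<beta> * 2))
       = (\<integral>x. (norm (g (x + h) - g x))\<^sup>2 \<partial>lebesgue) / norm h powr (2 * \<beta>)"
      using norm_powr_2[of "g (_ + h) - g _"] by (simp add: set_lebesgue_integral_def mult.commute)
    also have "\<dots> \<le> C"
      using small[of h] large[of h] h by (cases "norm h \<le> d") (auto simp: divide_le_eq)
    finally have le: "(LINT x:UNIV|lebesgue. \<bar>g (x + h) - g x\<bar> powr 2 / norm h powr (\<beta> * 2)) \<le> C" .
    have "0 \<le> (LINT x:UNIV|lebesgue. \<bar>g (x + h) - g x\<bar> powr 2 / norm h powr (\<beta> * 2))"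
      unfolding set_lebesgue_integral_def by (intro integral_nonneg_AE) simp
    then have "besov_quot \<beta> 2 UNIV g h \<le> C powr (1/2)"
      unfolding besov_quot_def using le by (intro powr_mono2) auto
    then show "besov_quot \<beta> 2 UNIV (\<lambda>x. \<phi> x * V x $ i) h \<le> C powr (1/2)" by (simp add: g_def)
  qed
qed

section \<open>Balls inside the domain\<close>

lemma ball_plus_ball:
  fixes z :: "'a::real_normed_vector"
  assumes "0 < R" "0 < r"
  shows "ball z R + ball 0 r = ball z (R + r)"
proof
  show "ball z R + ball 0 r \<subseteq> ball z (R + r)"
  proof
    fix x assume "x \<in> ball z R + ball 0 r"
    then obtain a b where ab: "x = a + b" "norm (z - a) < R" "norm b < r"
      by (auto elim!: set_plus_elim simp: dist_norm)
    have "norm (z - x) \<le> norm (z - a) + norm b"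
      using norm_triangle_ineq4[of "z - a" b] ab(1) by (simp add: algebra_simps)
    then show "x \<in> ball z (R + r)" using ab by (simp add: dist_norm)
  qed
  show "ball z (R + r) \<subseteq> ball z R + ball 0 r"
  proof
    fix x assume "x \<in> ball z (R + r)"
    then have x: "norm (x - z) < R + r" by (simp add: dist_norm norm_minus_commute)
    define t where "t = R / (R + r)"
    have t: "0 < t" "t < 1" "t * (R + r) = R" "(1 - t) * (R + r) = r"
      using assms by (auto simp: t_def field_simps)
    have "t * norm (x - z) < R" using mult_strict_left_mono[OF x t(1)] t(3) by simp
    then have 1: "z + t *\<^sub>R (x - z) \<in> ball z R" using t by (simp add: dist_norm)
    have "(1 - t) * norm (x - z) < r" using mult_strict_left_mono[OF x, of "1 - t"] t by simp
    then have 2: "(1 - t) *\<^sub>R (x - z) \<in> ball 0 r" using t by simp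
    have "x = (z + t *\<^sub>R (x - z)) + (1 - t) *\<^sub>R (x - z)" by (simp add: algebra_simps)
    then show "x \<in> ball z R + ball 0 r" using set_plus_intro[OF 1 2] by simp
  qed
qed

text \<open>A point of the enlarged ball outside of the domain would yield a boundary point \<open>w\<close> on the segment from the center, at distance at most \<open>2 r\<close> from the ball, contrary to the assumption on the distance to the boundary.\<close>

lemma enlarged_ball_in_domain:
  fixes z :: "'a::euclidean_space"
  assumes "open \<Omega>" "closure (ball z R) \<subseteq> \<Omega>" "0 < R" "0 < r" "r < setdist (ball z R) (frontier \<Omega>) / 2"
  shows "cball z (R + 2 * r) \<subseteq> \<Omega>"
proof (rule ccontr)
  assume "\<not> cball z (R + 2 * r) \<subseteq> \<Omega>"
  then obtain y where "y \<in> cball z (R + 2 * r)" "y \<notin> \<Omega>" by blast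
  then have y: "norm (y - z) \<le> R + 2 * r" "y \<notin> \<Omega>" by (simp_all add: dist_norm norm_minus_commute)
  have cb: "closure (ball z R) = cball z R" using assms by simp
  have "z \<in> \<Omega>" using assms cb by auto
  then have "closed_segment z y \<inter> frontier \<Omega> \<noteq> {}"
    using y by (intro connected_Int_frontier) auto
  then obtain w where w: "w \<in> closed_segment z y" "w \<in> frontier \<Omega>" by blast
  have wz: "norm (w - z) \<le> R + 2 * r"
    using segment_bound(1)[OF w(1)] y(1) by simp
  have "w \<notin> \<Omega>" using w(2) assms(1) by (simp add: frontier_def interior_open)
  then have "w \<notin> cball z R" using assms(2) cb by blast
  then have wR: "R < norm (w - z)" by (simp add: dist_norm norm_minus_commute)
  define b where "b = z + (R / norm (w - z)) *\<^sub>R (w - z)"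
  have "b \<in> cball z R" using wR assms(3) by (simp add: b_def dist_norm)
  then have "setdist (cball z R) (frontier \<Omega>) \<le> dist b w" by (rule setdist_le_dist[OF _ w(2)])
  also have "w - b = (1 - R / norm (w - z)) *\<^sub>R (w - z)" by (simp add: b_def algebra_simps)
  then have "dist b w = norm ((1 - R / norm (w - z)) *\<^sub>R (w - z))" by (simp only: dist_norm norm_minus_commute[of b w])
  also have "\<dots> = norm (w - z) - R" 
  proof -
    have "0 < norm (w - z)" using wR assms(3) by linarith
    then have "\<bar>1 - R / norm (w - z)\<bar> = 1 - R / norm (w - z)" using wR by simp
    moreover have "(1 - R / s) * s = s - R" if "0 < s" for s :: real using that by (simp add: field_simps)
    ultimately show ?thesis using \<open>0 < norm (w - z)\<close> by (simp only: norm_scaleR)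
  qed
  finally have "setdist (ball z R) (frontier \<Omega>) \<le> 2 * r"
    using wz setdist_closure_1[of "ball z R" "frontier \<Omega>"] unfolding cb by linarith
  then show False using assms(5) by simp
qed

section \<open>The two estimates and Besov regularity\<close>

theorem estimate_Sobolev:
  fixes q p R :: real
  assumes q: "1 < q" "q < 2" and p: "p = q / (q - 1)" and R: "0 < R"
  shows "\<exists>C>0. \<forall>(\<Omega>::(real^'n) set) f u Du Df z r0 h.
     open \<Omega> \<longrightarrow> weak_solution q \<Omega> f u \<longrightarrow> weak_gradient \<Omega> u Du \<longrightarrow> f \<in> W1_loc p \<Omega> \<longrightarrow> weak_gradient \<Omega> f Df \<longrightarrow>
     cball z (R + 2 * r0) \<subseteq> \<Omega> \<longrightarrow> 0 < r0 \<longrightarrow> norm h \<le> r0 \<longrightarrow>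
     shift_energy q Du z (R/2) h
       \<le> C * (Lp_norm p (ball z (R + r0)) Df * Lp_norm q (ball z (R + r0)) Du * (norm h)\<^sup>2
              + Lp_norm q (ball z (R + r0)) Du powr q * norm h powr (2 / (3 - q)))"
proof -
  have p1: "1 < p" using q unfolding p by (auto simp: field_simps)
  from local_estimate[OF q p R, where 'n='n] show ?thesis
  proof (elim exE conjE, goal_cases)
    case (1 C)
    note C = 1(1) and est = 1(2)[rule_format]
    show ?case
  proof (intro exI[of _ C] conjI allI impI C)
    fix \<Omega> :: "(real^'n) set" and f u and Du Df and z h :: "real^'n" and r0
    assume as: "open \<Omega>" "weak_solution q \<Omega> f u" "weak_gradient \<Omega> u Du" "f \<in> W1_loc p \<Omega>" "weak_gradient \<Omega> f Df"
      "cball z (R + 2 * r0) \<subseteq> \<Omega>" "0 < r0" "norm h \<le> r0"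
    let ?N = "norm h * Lp_norm p (ball z (R + r0)) Df"
    have Df: "Df \<in> Lp_loc p \<Omega>" by (rule W1_loc_weak_gradient[OF as(4,5,1)])
    have fp: "f \<in> Lp_loc p \<Omega>" using as(4) by (simp add: W1_loc_def)
    have sub: "cball z (R + r0) \<subseteq> \<Omega>"
      by (rule order_trans[OF subset_cball as(6)]) (use as(7) in simp)
    have "Lp_norm p (ball z (3*R/4)) (\<lambda>x. f (x + h) - f x) \<le> ?N"
      by (rule local_difference_bound(1)[OF p1 as(5) Df as(6)]) (use R as(7,8) in auto)
    then have "shift_energy q Du z (R/2) h
       \<le> C * (?N * Lp_norm q (ball z (R + r0)) Du * norm h
              + Lp_norm q (ball z (R + r0)) Du powr q * norm h powr (2 / (3 - q)))"
      by (intro est[OF as(1-3) fp sub as(7,8)]) (simp_all add: Lp_norm_nonneg)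
    then show "shift_energy q Du z (R/2) h
       \<le> C * (Lp_norm p (ball z (R + r0)) Df * Lp_norm q (ball z (R + r0)) Du * (norm h)\<^sup>2
              + Lp_norm q (ball z (R + r0)) Du powr q * norm h powr (2 / (3 - q)))"
      by (simp add: power2_eq_square mult_ac)
  qed
  qed
qed

text \<open>The constant is chosen before \<open>\<alpha>\<close> as well, since \<open>\<alpha>\<close> only enters through the bound of the differences of \<open>f\<close>.\<close>

theorem estimate_Besov:
  fixes q p R :: real
  assumes q: "1 < q" "q < 2" and p: "p = q / (q - 1)" and R: "0 < R"
  shows "\<exists>C>0. \<forall>(\<Omega>::(real^'n) set) f u Du \<alpha> z r0 h.
     open \<Omega> \<longrightarrow> weak_solution q \<Omega> f u \<longrightarrow> weak_gradient \<Omega> u Du \<longrightarrow> f \<in> besov_loc \<alpha> p \<Omega> \<longrightarrow>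
     cball z (R + 2 * r0) \<subseteq> \<Omega> \<longrightarrow> 0 < r0 \<longrightarrow> norm h \<le> r0 \<longrightarrow>
     shift_energy q Du z (R/2) h
       \<le> C * (besov_norm \<alpha> p (ball z (R + r0)) f * Lp_norm q (ball z (R + r0)) Du * norm h powr (\<alpha> + 1)
              + Lp_norm q (ball z (R + r0)) Du powr q * norm h powr (2 / (3 - q)))"
proof -
  have p1: "1 < p" using q unfolding p by (auto simp: field_simps)
  from local_estimate[OF q p R, where 'n='n] show ?thesis
  proof (elim exE conjE, goal_cases)
    case (1 C)
    note C = 1(1) and est = 1(2)[rule_format]
    show ?case
  proof (intro exI[of _ C] conjI allI impI C)
    fix \<Omega> :: "(real^'n) set" and f u and Du and \<alpha> and z h :: "real^'n" and r0
    assume as: "open \<Omega>" "weak_solution q \<Omega> f u" "weak_gradient \<Omega> u Du" "f \<in> besov_loc \<alpha> p \<Omega>"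
      "cball z (R + 2 * r0) \<subseteq> \<Omega>" "0 < r0" "norm h \<le> r0"
    let ?b = "besov_norm \<alpha> p (ball z (R + r0)) f"
    have fp: "f \<in> Lp_loc p \<Omega>" by (rule besov_loc_imp_Lp_loc[OF as(4,1)]) (use p1 in simp)
    have sub: "cball z (R + r0) \<subseteq> \<Omega>"
      by (rule order_trans[OF subset_cball as(5)]) (use as(6) in simp)
    have r: "0 \<le> R + r0" "R + r0 < R + 2 * r0" "3*R/4 + norm h \<le> R + r0" using R as(6,7) by auto
    note bes = besov_norm_bounds_differences[OF as(4) p1 as(5) r]
    have e: "shift_energy q Du z (R/2) h
       \<le> C * (norm h powr \<alpha> * ?b * Lp_norm q (ball z (R + r0)) Du * norm h
              + Lp_norm q (ball z (R + r0)) Du powr q * norm h powr (2 / (3 - q)))"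
      by (rule est[OF as(1-3) fp sub as(6,7) _ bes(1)]) (simp add: bes(2))
    have "norm h powr \<alpha> * norm h = norm h powr (\<alpha> + 1)"
      by (cases "h = 0") (simp_all add: powr_add)
    moreover have "x * b * A * y = b * A * (x * y)" for x b A y :: real by simp
    ultimately have "norm h powr \<alpha> * ?b * Lp_norm q (ball z (R + r0)) Du * norm h
       = ?b * Lp_norm q (ball z (R + r0)) Du * norm h powr (\<alpha> + 1)" by (simp only:)
    with e show "shift_energy q Du z (R/2) h
       \<le> C * (?b * Lp_norm q (ball z (R + r0)) Du * norm h powr (\<alpha> + 1)
              + Lp_norm q (ball z (R + r0)) Du powr q * norm h powr (2 / (3 - q)))"
      by (simp only:)
  qed
  qed
qed

lemma H_gradient_in_Lp_loc:
  fixes Du :: "real^'n \<Rightarrow> real^'n"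
  assumes q: "0 < q" and Du: "Du \<in> Lp_loc q \<Omega>"
  shows "(\<lambda>x. H (q/2) (Du x)) \<in> Lp_loc 2 \<Omega>"
  unfolding Lp_loc_def
proof (intro CollectI allI impI)
  fix K assume "compact K \<and> K \<subseteq> \<Omega>"
  then have "Du \<in> Lp q K" using Du by (simp add: Lp_loc_def)
  then have "(\<lambda>x. indicator K x *\<^sub>R Du x) \<in> Lp q UNIV" unfolding Lp_restrict_iff[of Du] .
  then have "(\<lambda>x. H (q/2) (indicator K x *\<^sub>R Du x)) \<in> Lp 2 UNIV" by (rule Lp_H) (use q in auto)
  moreover have "H (q/2) (indicator K x *\<^sub>R Du x) = indicator K x *\<^sub>R H (q/2) (Du x)" for x
    by (cases "x \<in> K") simp_all
  ultimately show "(\<lambda>x. H (q/2) (Du x)) \<in> Lp 2 K" unfolding Lp_restrict_iff[of "\<lambda>x. H (q/2) (Du x)"] by simp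
qed

text \<open>For \<open>|h| \<le> 1\<close> the smallest exponent of \<open>|h|\<close> decides.\<close>

lemma besov_regularity_from_estimate:
  fixes \<Omega> :: "(real^'n) set"
  assumes q: "1 < q" "q < 2" and \<Omega>: "open \<Omega>" and sol: "weak_solution q \<Omega> f u" and wg: "weak_gradient \<Omega> u Du"
    and \<beta>: "0 < \<beta>" "\<beta> \<le> 1 / (3 - q)" "2 * \<beta> \<le> s"
    and est: "\<And>z R. 0 < R \<Longrightarrow> cball z (R + 2 * R) \<subseteq> \<Omega> \<Longrightarrow> \<exists>a b. 0 \<le> a \<and> 0 \<le> b \<and> (\<forall>h. norm h \<le> R \<longrightarrow>
      shift_energy q Du z (R/2) h
       \<le> a * norm h powr s + b * norm h powr (2 / (3 - q)))"
  shows "(\<lambda>x. H (q/2) (Du x)) \<in> besov_loc_vec \<beta> 2 \<Omega>"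
proof (rule besov_loc_vec_if_local_differences[OF \<Omega> _ \<beta>(1)])
  have "u \<in> W1_loc q \<Omega>" using sol by (simp add: weak_solution_def)
  then have "Du \<in> Lp_loc q \<Omega>" by (rule W1_loc_weak_gradient[OF _ wg \<Omega>])
  then show "(\<lambda>x. H (q/2) (Du x)) \<in> Lp_loc 2 \<Omega>" using q by (intro H_gradient_in_Lp_loc) auto
  have "1 / (3 - q) \<le> 1" using q by simp
  then show "\<beta> \<le> 1" using \<beta>(2) by linarith
  have \<beta>2: "2 * \<beta> \<le> 2 / (3 - q)" using \<beta>(2) by simp
  fix z assume "z \<in> \<Omega>"
  then obtain e where e: "0 < e" "cball z e \<subseteq> \<Omega>" using \<Omega> unfolding open_contains_cball by blast
  define R where "R = e / 3"
  have R: "0 < R" "cball z (R + 2 * R) \<subseteq> \<Omega>" using e by (simp_all add: R_def)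
  obtain a b where ab: "0 \<le> a" "0 \<le> b" and bound: "\<And>h. norm h \<le> R \<Longrightarrow>
      shift_energy q Du z (R/2) h
       \<le> a * norm h powr s + b * norm h powr (2 / (3 - q))"
    using est[OF R] by blast
  define d where "d = min 1 R"
  have d: "0 < d" "d \<le> 1" "d \<le> R" using R by (auto simp: d_def)
  show "\<exists>\<rho>>0. \<exists>\<delta>>0. \<exists>C\<ge>0. cball z (\<rho> + \<delta>) \<subseteq> \<Omega> \<and>
      (\<forall>h. norm h \<le> \<delta> \<longrightarrow> shift_energy q Du z \<rho> h \<le> C * norm h powr (2 * \<beta>))"
  proof (rule exI[of _ "R/2"], rule conjI, use R in simp, rule exI[of _ d], rule conjI, rule d,
      rule exI[of _ "a + b"], intro conjI allI impI)
    show "cball z (R/2 + d) \<subseteq> \<Omega>"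
      by (rule order_trans[OF subset_cball R(2)]) (use d in linarith)
    fix h :: "real^'n" assume h: "norm h \<le> d"
    have "shift_energy q Du z (R/2) h
       \<le> a * norm h powr s + b * norm h powr (2 / (3 - q))"
      by (rule bound) (use h d in linarith)
    also have "\<dots> \<le> a * norm h powr (2 * \<beta>) + b * norm h powr (2 * \<beta>)"
    proof (intro add_mono mult_left_mono ab)
      show "norm h powr s \<le> norm h powr (2 * \<beta>)" using powr_mono'[OF \<beta>(3), of "norm h"] h d by simp
      show "norm h powr (2 / (3 - q)) \<le> norm h powr (2 * \<beta>)" using powr_mono'[OF \<beta>2, of "norm h"] h d by simp
    qed
    finally show "shift_energy q Du z (R/2) h \<le> (a + b) * norm h powr (2 * \<beta>)"
      by (simp only: distrib_right)
  qed (use ab in simp)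
qed

theorem Besov_regularity_Sobolev:
  fixes \<Omega> :: "(real^'n) set"
  assumes q: "1 < q" "q < 2" and p: "p = q / (q - 1)"
    and \<Omega>: "open \<Omega>" and sol: "weak_solution q \<Omega> f u" and wg: "weak_gradient \<Omega> u Du" and f: "f \<in> W1_loc p \<Omega>"
  shows "(\<lambda>x. H (q/2) (Du x)) \<in> besov_loc_vec (1 / (3 - q)) 2 \<Omega>"
proof (rule besov_regularity_from_estimate[OF q \<Omega> sol wg, where s=2])
  obtain Df where Df: "weak_gradient \<Omega> f Df" using f unfolding W1_loc_def by blast
  fix z :: "real^'n" and R :: real assume R: "0 < R" and sub: "cball z (R + 2 * R) \<subseteq> \<Omega>"
  show "\<exists>a b. 0 \<le> a \<and> 0 \<le> b \<and> (\<forall>h. norm h \<le> R \<longrightarrow>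
      shift_energy q Du z (R/2) h
       \<le> a * norm h powr 2 + b * norm h powr (2 / (3 - q)))"
    using estimate_Sobolev[OF q p R, where 'n='n]
  proof (elim exE conjE, goal_cases)
    case (1 C)
    note C = 1(1) and est = 1(2)[rule_format, OF \<Omega> sol wg f Df sub R]
    show ?case
    proof (intro exI conjI allI impI)
    fix h :: "real^'n" assume h: "norm h \<le> R"
    show "shift_energy q Du z (R/2) h
       \<le> C * (Lp_norm p (ball z (R + R)) Df * Lp_norm q (ball z (R + R)) Du) * norm h powr 2
        + C * Lp_norm q (ball z (R + R)) Du powr q * norm h powr (2 / (3 - q))"
      using est[OF h] by (simp only: norm_powr_2 distrib_left mult.assoc)
  qed (use C in \<open>simp_all add: Lp_norm_nonneg\<close>)
  qed
qed (use q in \<open>simp_all add: divide_le_eq\<close>)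

theorem Besov_regularity_Besov:
  fixes \<Omega> :: "(real^'n) set"
  assumes q: "1 < q" "q < 2" and p: "p = q / (q - 1)" and \<alpha>: "0 < \<alpha>"
    and \<Omega>: "open \<Omega>" and sol: "weak_solution q \<Omega> f u" and wg: "weak_gradient \<Omega> u Du" and f: "f \<in> besov_loc \<alpha> p \<Omega>"
  shows "(\<lambda>x. H (q/2) (Du x)) \<in> besov_loc_vec (min ((\<alpha> + 1) / 2) (1 / (3 - q))) 2 \<Omega>"
proof (rule besov_regularity_from_estimate[OF q \<Omega> sol wg, where s="\<alpha> + 1"])
  have p1: "1 < p" using q unfolding p by (auto simp: field_simps)
  fix z :: "real^'n" and R :: real assume R: "0 < R" and sub: "cball z (R + 2 * R) \<subseteq> \<Omega>"
  have bn: "0 \<le> besov_norm \<alpha> p (ball z (R + R)) f"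
    by (rule besov_norm_bounds_differences(2)[OF f p1 sub, of _ 0 0]) (use R in auto)
  show "\<exists>a b. 0 \<le> a \<and> 0 \<le> b \<and> (\<forall>h. norm h \<le> R \<longrightarrow>
      shift_energy q Du z (R/2) h
       \<le> a * norm h powr (\<alpha> + 1) + b * norm h powr (2 / (3 - q)))"
    using estimate_Besov[OF q p R, where 'n='n]
  proof (elim exE conjE, goal_cases)
    case (1 C)
    note C = 1(1) and est = 1(2)[rule_format, OF \<Omega> sol wg f sub R]
    show ?case
    proof (intro exI conjI allI impI)
    fix h :: "real^'n" assume h: "norm h \<le> R"
    show "shift_energy q Du z (R/2) h
       \<le> C * (besov_norm \<alpha> p (ball z (R + R)) f * Lp_norm q (ball z (R + R)) Du) * norm h powr (\<alpha> + 1)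
        + C * Lp_norm q (ball z (R + R)) Du powr q * norm h powr (2 / (3 - q))"
      using est[OF h] by (simp only: distrib_left mult.assoc)
  qed (use C bn in \<open>simp_all add: Lp_norm_nonneg\<close>)
  qed
qed (use q \<alpha> in \<open>simp_all add: min_def\<close>)

theorem theorem1p1:
  fixes q p :: real
  assumes n: "2 \<le> CARD('n::finite)"
    and q: "1 < q" "q < 2"
    and p: "p = q / (q - 1)"
  shows
    "(\<forall>(\<Omega>::(real^'n) set) f u Du \<alpha>.
        bounded_domain \<Omega> \<and> weak_solution q \<Omega> f u \<and> weak_gradient \<Omega> u Du \<and> 0 < \<alpha> \<and> \<alpha> < 1 \<longrightarrow>
        (f \<in> W1_loc p \<Omega> \<longrightarrow>
           (\<lambda>x. H (q / 2) (Du x)) \<in> besov_loc_vec (1 / (3 - q)) 2 \<Omega>) \<and>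
        (f \<in> besov_loc \<alpha> p \<Omega> \<longrightarrow>
           (\<lambda>x. H (q / 2) (Du x)) \<in> besov_loc_vec (min ((\<alpha> + 1) / 2) (1 / (3 - q))) 2 \<Omega>))
     \<and>
     (\<forall>R>0. \<exists>C1>0. \<forall>(\<Omega>::(real^'n) set) f u Du Df.
        bounded_domain \<Omega> \<and> weak_solution q \<Omega> f u \<and> weak_gradient \<Omega> u Du \<and>
        f \<in> W1_loc p \<Omega> \<and> weak_gradient \<Omega> f Df \<longrightarrow>
        (\<forall>z r\<^sub>0 s h. closure (ball z R) \<subseteq> \<Omega> \<and>
           0 < r\<^sub>0 \<and> \<bar>h\<bar> \<le> r\<^sub>0 \<and> r\<^sub>0 < setdist (ball z R) (frontier \<Omega>) / 2 \<longrightarrow>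
           (let B' = ball z R + ball 0 r\<^sub>0; F = (\<lambda>x. H (q / 2) (Du x)) in
            (LINT x:ball z (R / 2)|lebesgue. (norm (shift s h F x - F x))\<^sup>2)
              \<le> C1 * (Lp_norm p B' Df * Lp_norm q B' Du * \<bar>h\<bar>\<^sup>2
                      + Lp_norm q B' Du powr q * \<bar>h\<bar> powr (2 / (3 - q))))))
     \<and>
     (\<forall>R>0. \<exists>C2>0. \<forall>(\<Omega>::(real^'n) set) f u Du \<alpha>.
        bounded_domain \<Omega> \<and> weak_solution q \<Omega> f u \<and> weak_gradient \<Omega> u Du \<and>
        0 < \<alpha> \<and> \<alpha> < 1 \<and> f \<in> besov_loc \<alpha> p \<Omega> \<longrightarrow>
        (\<forall>z r\<^sub>0 s h. closure (ball z R) \<subseteq> \<Omega> \<and>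
           0 < r\<^sub>0 \<and> \<bar>h\<bar> \<le> r\<^sub>0 \<and> r\<^sub>0 < setdist (ball z R) (frontier \<Omega>) / 2 \<longrightarrow>
           (let B' = ball z R + ball 0 r\<^sub>0; F = (\<lambda>x. H (q / 2) (Du x)) in
            (LINT x:ball z (R / 2)|lebesgue. (norm (shift s h F x - F x))\<^sup>2)
              \<le> C2 * (besov_norm \<alpha> p B' f * Lp_norm q B' Du * \<bar>h\<bar> powr (\<alpha> + 1)
                      + Lp_norm q B' Du powr q * \<bar>h\<bar> powr (2 / (3 - q))))))"
proof (intro conjI allI impI, goal_cases)
  case (1 \<Omega> f u Du \<alpha>)
  then have "open \<Omega>" "weak_solution q \<Omega> f u" "weak_gradient \<Omega> u Du"
    unfolding bounded_domain_def by blast+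
  from Besov_regularity_Sobolev[OF q p this 1(2)] show ?case .
next
  case (2 \<Omega> f u Du \<alpha>)
  then have "0 < \<alpha>" "open \<Omega>" "weak_solution q \<Omega> f u" "weak_gradient \<Omega> u Du"
    unfolding bounded_domain_def by blast+
  from Besov_regularity_Besov[OF q p this 2(2)] show ?case .
next
  case (3 R)
  from estimate_Sobolev[OF q p 3, where 'n='n] show ?case
  proof (elim exE conjE, goal_cases)
    case (1 C)
    note C = 1(1) and est = 1(2)[rule_format]
    show ?case
    proof (intro exI[of _ C] conjI C allI impI, goal_cases)
      case (1 \<Omega> f u Du Df z r s h)
      then have O: "open \<Omega>" and as: "weak_solution q \<Omega> f u" "weak_gradient \<Omega> u Du" "f \<in> W1_loc p \<Omega>" "weak_gradient \<Omega> f Df"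
        and B: "closure (ball z R) \<subseteq> \<Omega>" "0 < r" "\<bar>h\<bar> \<le> r" "r < setdist (ball z R) (frontier \<Omega>) / 2"
        unfolding bounded_domain_def by blast+
      have nh: "norm (h *\<^sub>R axis s 1 :: real^'n) = \<bar>h\<bar>" by simp
      from B(3) have "norm (h *\<^sub>R axis s 1 :: real^'n) \<le> r" by simp
      from est[OF O as enlarged_ball_in_domain[OF O B(1) 3 B(2,4)] B(2) this]
      show ?case unfolding Let_def shift_def ball_plus_ball[OF 3 B(2)] nh .
    qed
  qed
next
  case (4 R)
  from estimate_Besov[OF q p 4, where 'n='n] show ?case
  proof (elim exE conjE, goal_cases)
    case (1 C)
    note C = 1(1) and est = 1(2)[rule_format]
    show ?case
    proof (intro exI[of _ C] conjI C allI impI, goal_cases)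
      case (1 \<Omega> f u Du \<alpha> z r s h)
      then have O: "open \<Omega>" and as: "weak_solution q \<Omega> f u" "weak_gradient \<Omega> u Du" "f \<in> besov_loc \<alpha> p \<Omega>"
        and B: "closure (ball z R) \<subseteq> \<Omega>" "0 < r" "\<bar>h\<bar> \<le> r" "r < setdist (ball z R) (frontier \<Omega>) / 2"
        unfolding bounded_domain_def by blast+
      have nh: "norm (h *\<^sub>R axis s 1 :: real^'n) = \<bar>h\<bar>" by simp
      from B(3) have "norm (h *\<^sub>R axis s 1 :: real^'n) \<le> r" by simp
      from est[OF O as enlarged_ball_in_domain[OF O B(1) 4 B(2,4)] B(2) this]
      show ?case unfolding Let_def shift_def ball_plus_ball[OF 4 B(2)] nh .
    qed
  qed
qed

end
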